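(* Let $(G,\omega^+)$ be a connected symplectic Lie group of dimension $n$, endowed with its associated affine structure. Then the following assertions hold. (1) In a neighborhood of any element of $G$, there exists an affine chart $(x_1,\ldots,x_n)$ such that, for any $i,j=1,\ldots,n$, the Poisson bracket of $x_i$ and $x_j$ associated to $\omega^+$ is given by $$\{x_i,x_j\}=\sum_{k=1}^n C_{ij}^k x_k+\mu_{ij},$$ where the $C_{ij}^k$ are constants of structure of the Lie algebra of $G$ (i.e. its structure constants with respect to some basis) and the $\mu_{ij}$ are constants. (2) Any right invariant $k$-multivector field on $G$ is polynomial of degree at most $k$. (3) If $G$ is unimodular, then the symplectic form $\omega^+$ is polynomial of degree at most $n-1$, the volume form $\wedge^{n/2}\omega^+$ is parallel (with respect to the connection $\nabla$ defining the affine structure), and any right invariant differential form on $G$ is polynomial.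
   Context: Lie groups are real and finite-dimensional. Let $G$ be a Lie group with Lie algebra $\mathcal{G}=T_eG$. For a tensor $T$ on $\mathcal{G}$, $T^+$ denotes the left invariant tensor field and $T^-$ the right invariant tensor field on $G$ whose value at $e$ is $T$. A symplectic Lie group $(G,\omega^+)$ is a Lie group $G$ with a left invariant symplectic form $\omega^+$; equivalently $\omega^+$ is the left invariant 2-form associated to a non-degenerate scalar 2-cocycle $\omega$ of $\mathcal{G}$. Associated affine structure: the formula $$\omega^+(\nabla_{u^+}v^+,w^+)=-\omega^+(v^+,[u^+,w^+]),\qquad u,v,w\in\mathcal{G},$$ defines a left invariant flat and torsion free connection $\nabla$ on $G$, and hence an affine structure on $G$ (an atlas whose coordinate changes are locally restrictions of affine automorphisms of $\mathbb{R}^n$). Its affine charts are the local coordinates $(x_1,\ldots,x_n)$ (on connected open sets) with $\nabla dx_i=0$ for all $i$. A function or tensor field is polynomial (of degree at most $d$) if in affine coordinates its coefficients are polynomial functions (of degree at most $d$) of these coordinates. The Poisson tensor $\pi^+$ corresponding to $\omega^+$ is the left invariant bivector field with $\omega^+(\pi^+_\#(\alpha),\cdot)=-\alpha$ for every 1-form $\alpha$, where $\beta(\pi^+_\#(\alpha))=\pi^+(\alpha,\beta)$; the associated Poisson bracket is $\{f,g\}=\pi^+(df,dg)$. *)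

theory Defs
  imports "HOL-Analysis.Analysis"
begin

section \<open>Smooth manifolds\<close>

text \<open>Class \<open>C\<^sup>k\<close> and \<open>C\<^sup>\<infinity>\<close> on an open subset of a finite-dimensional space.\<close>

primrec Ck_on :: "nat \<Rightarrow> 'a::real_normed_vector set \<Rightarrow> ('a \<Rightarrow> 'b::real_normed_vector) \<Rightarrow> bool"
  where
    "Ck_on 0 S f \<longleftrightarrow> continuous_on S f"
  | "Ck_on (Suc k) S f \<longleftrightarrow> (\<forall>x\<in>S. f differentiable (at x)) \<and>
       (\<forall>v. Ck_on k S (\<lambda>x. frechet_derivative f (at x) v))"

definition smooth_on :: "'a::real_normed_vector set \<Rightarrow> ('a \<Rightarrow> 'b::real_normed_vector) \<Rightarrow> bool"
  where "smooth_on S f \<longleftrightarrow> (\<forall>k. Ck_on k S f)"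

text \<open>A chart is a pair of a domain and a coordinate map; the values of the coordinate map
  outside the domain are irrelevant.\<close>

type_synonym ('a, 'e) chart = "'a set \<times> ('a \<Rightarrow> 'e)"

definition chart_inv :: "('a, 'e) chart \<Rightarrow> 'e \<Rightarrow> 'a"
  where "chart_inv c = inv_into (fst c) (snd c)"

definition is_chart :: "('a::topological_space, 'e::euclidean_space) chart \<Rightarrow> bool"
  where "is_chart c \<longleftrightarrow> open (fst c) \<and> open (snd c ` fst c) \<and>
    homeomorphism (fst c) (snd c ` fst c) (snd c) (chart_inv c)"

definition smooth_compat ::
    "('a, 'e::euclidean_space) chart \<Rightarrow> ('a, 'e) chart \<Rightarrow> bool"
  where "smooth_compat c d \<longleftrightarrow>
    smooth_on (snd c ` (fst c \<inter> fst d)) (snd d \<circ> chart_inv c) \<and>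
    smooth_on (snd d ` (fst c \<inter> fst d)) (snd c \<circ> chart_inv d)"

definition smooth_atlas :: "('a::topological_space, 'e::euclidean_space) chart set \<Rightarrow> bool"
  where "smooth_atlas A \<longleftrightarrow> (\<forall>c\<in>A. is_chart c) \<and> (\<Union>c\<in>A. fst c) = UNIV \<and>
    (\<forall>c\<in>A. \<forall>d\<in>A. smooth_compat c d)"

text \<open>Membership in the maximal atlas generated by \<open>A\<close>.\<close>

definition smooth_chart ::
    "('a::topological_space, 'e::euclidean_space) chart set \<Rightarrow> ('a, 'e) chart \<Rightarrow> bool"
  where "smooth_chart A c \<longleftrightarrow> is_chart c \<and> (\<forall>d\<in>A. smooth_compat c d)"

definition prod_atlas :: "('a, 'e) chart set \<Rightarrow> ('b, 'f) chart set \<Rightarrow> ('a \<times> 'b, 'e \<times> 'f) chart set"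
  where "prod_atlas A B = (\<lambda>(c, d). (fst c \<times> fst d, map_prod (snd c) (snd d))) ` (A \<times> B)"

definition smooth_map ::
    "('a::topological_space, 'e::euclidean_space) chart set \<Rightarrow>
     ('b::topological_space, 'f::euclidean_space) chart set \<Rightarrow> ('a \<Rightarrow> 'b) \<Rightarrow> bool"
  where "smooth_map A B F \<longleftrightarrow> continuous_on UNIV F \<and>
    (\<forall>c\<in>A. \<forall>d\<in>B. smooth_on (snd c ` (fst c \<inter> F -` fst d)) (snd d \<circ> F \<circ> chart_inv c))"

definition smooth_fun :: "('a, 'e::euclidean_space) chart set \<Rightarrow> ('a \<Rightarrow> real) \<Rightarrow> bool"
  where "smooth_fun A f \<longleftrightarrow> (\<forall>c\<in>A. smooth_on (snd c ` fst c) (f \<circ> chart_inv c))"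


section \<open>Tangent vectors and tensor fields\<close>

text \<open>For every point \<open>p\<close> a chart of the atlas around \<open>p\<close> is chosen once and for all, and a
  tangent vector at \<open>p\<close> is represented by its coordinate vector in that chart. Thus every
  tangent space is a copy of the model space \<open>'e\<close>, every cotangent space a copy of its dual
  \<open>'e \<Rightarrow>\<^sub>L real\<close>, and vectors at different points are only related through the differentials
  \<open>dfun\<close> and \<open>tmap\<close> below, which take the chosen charts into account.\<close>

definition chart_at :: "('a, 'e) chart set \<Rightarrow> 'a \<Rightarrow> ('a, 'e) chart"
  where "chart_at A p = (SOME c. c \<in> A \<and> p \<in> fst c)"

text \<open>Differential at \<open>p\<close> of a vector valued map defined near \<open>p\<close>.\<close>

definition dfun :: "('a, 'e::euclidean_space) chart set \<Rightarrow> ('a \<Rightarrow> 'b::real_normed_vector) \<Rightarrow>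
    'a \<Rightarrow> 'e \<Rightarrow> 'b"
  where "dfun A f p =
    frechet_derivative (f \<circ> chart_inv (chart_at A p)) (at (snd (chart_at A p) p))"

text \<open>Tangent map at \<open>p\<close> of a map from the manifold to itself.\<close>

definition tmap :: "('a, 'e::euclidean_space) chart set \<Rightarrow> ('a \<Rightarrow> 'a) \<Rightarrow> 'a \<Rightarrow> 'e \<Rightarrow> 'e"
  where "tmap A F p = dfun A (snd (chart_at A (F p)) \<circ> F) p"

text \<open>The vector at \<open>p\<close> whose components in the chart \<open>c\<close> are given by \<open>v\<close>; for
  \<open>v = axis i 1\<close> this is the coordinate vector \<open>\<partial>/\<partial>x\<^sub>i\<close>.\<close>

definition coord_vec ::
    "('a, 'e::euclidean_space) chart set \<Rightarrow> ('a, 'e) chart \<Rightarrow> 'a \<Rightarrow> 'e \<Rightarrow> 'e"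
  where "coord_vec A c p v =
    frechet_derivative (snd (chart_at A p) \<circ> chart_inv c) (at (snd c p)) v"

definition local_rep ::
    "('a, 'e::euclidean_space) chart set \<Rightarrow> ('a, 'e) chart \<Rightarrow> ('a \<Rightarrow> 'e) \<Rightarrow> 'e \<Rightarrow> 'e"
  where "local_rep A c X y = dfun A (snd c) (chart_inv c y) (X (chart_inv c y))"

definition smooth_vector_field ::
    "('a, 'e::euclidean_space) chart set \<Rightarrow> ('a \<Rightarrow> 'e) \<Rightarrow> bool"
  where "smooth_vector_field A X \<longleftrightarrow> (\<forall>c\<in>A. smooth_on (snd c ` fst c) (local_rep A c X))"

text \<open>Coordinate expression of \<open>[X, Y]\<close>, with the sign convention \<open>[X, Y] f = X (Y f) - Y (X f)\<close>.\<close>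

definition lie_bracket ::
    "('a, 'e::euclidean_space) chart set \<Rightarrow> ('a \<Rightarrow> 'e) \<Rightarrow> ('a \<Rightarrow> 'e) \<Rightarrow> 'a \<Rightarrow> 'e"
  where "lie_bracket A X Y p =
    (let c = chart_at A p; y = snd c p in
      frechet_derivative (local_rep A c Y) (at y) (X p) -
      frechet_derivative (local_rep A c X) (at y) (Y p))"

text \<open>Alternating \<open>k\<close>-linear forms take their arguments as a family indexed by \<open>nat\<close>, of which
  only the members with index below \<open>k\<close> matter. Elements of the \<open>k\<close>-th exterior power of the
  tangent space are alternating \<open>k\<close>-linear forms on the cotangent space.\<close>

definition alternating :: "nat \<Rightarrow> ((nat \<Rightarrow> 'v::real_vector) \<Rightarrow> real) \<Rightarrow> bool"
  where "alternating k T \<longleftrightarrow>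
    (\<forall>v w. (\<forall>i<k. v i = w i) \<longrightarrow> T v = T w) \<and>
    (\<forall>v. \<forall>i<k. linear (\<lambda>x. T (v(i := x)))) \<and>
    (\<forall>v. \<forall>i<k. \<forall>j<k. i \<noteq> j \<and> v i = v j \<longrightarrow> T v = 0)"

definition pair :: "'v \<Rightarrow> 'v \<Rightarrow> nat \<Rightarrow> 'v"
  where "pair u v = (\<lambda>i. if i = 0 then u else v)"

type_synonym ('a, 'n) form_field = "'a \<Rightarrow> (nat \<Rightarrow> real^'n) \<Rightarrow> real"
type_synonym ('a, 'n) multivector_field = "'a \<Rightarrow> (nat \<Rightarrow> (real^'n) \<Rightarrow>\<^sub>L real) \<Rightarrow> real"

definition form_coeff :: "('a, real^'n) chart set \<Rightarrow> ('a, real^'n) chart \<Rightarrow>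
    ('a, 'n) form_field \<Rightarrow> (nat \<Rightarrow> 'n) \<Rightarrow> 'a \<Rightarrow> real"
  where "form_coeff A c T I p = T p (\<lambda>j. coord_vec A c p (axis (I j) 1))"

definition mv_coeff :: "('a, real^'n) chart set \<Rightarrow> ('a, real^'n) chart \<Rightarrow>
    ('a, 'n) multivector_field \<Rightarrow> (nat \<Rightarrow> 'n) \<Rightarrow> 'a \<Rightarrow> real"
  where "mv_coeff A c T I p = T p (\<lambda>j. Blinfun (dfun A (\<lambda>q. snd c q $ I j) p))"

definition differential_form ::
    "('a, real^'n) chart set \<Rightarrow> nat \<Rightarrow> ('a, 'n) form_field \<Rightarrow> bool"
  where "differential_form A k T \<longleftrightarrow> (\<forall>p. alternating k (T p)) \<and>
    (\<forall>c\<in>A. \<forall>I. smooth_on (snd c ` fst c) (form_coeff A c T I \<circ> chart_inv c))"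

definition is_multivector_field ::
    "('a, real^'n) chart set \<Rightarrow> nat \<Rightarrow> ('a, 'n) multivector_field \<Rightarrow> bool"
  where "is_multivector_field A k T \<longleftrightarrow> (\<forall>p. alternating k (T p)) \<and>
    (\<forall>c\<in>A. \<forall>I. smooth_on (snd c ` fst c) (mv_coeff A c T I \<circ> chart_inv c))"

text \<open>Exterior derivative of a \<open>k\<close>-form: extend \<open>v 0, \<dots>, v k\<close> to commuting vector fields, constant
  in the chosen chart around \<open>p\<close>.\<close>

definition ext_deriv ::
    "('a, real^'n) chart set \<Rightarrow> nat \<Rightarrow> ('a, 'n) form_field \<Rightarrow> ('a, 'n) form_field"
  where "ext_deriv A k T p v =
    (let c = chart_at A p in
      \<Sum>i\<le>k. (- 1) ^ i *
        frechet_derivative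
          (\<lambda>y. T (chart_inv c y)
             (\<lambda>j. coord_vec A c (chart_inv c y) (v (if j < i then j else Suc j))))
          (at (snd c p)) (v i))"

definition symplectic_form ::
    "('a, real^'n) chart set \<Rightarrow> ('a, 'n) form_field \<Rightarrow> bool"
  where "symplectic_form A \<omega> \<longleftrightarrow> differential_form A 2 \<omega> \<and>
    (\<forall>p u. (\<forall>v. \<omega> p (pair u v) = 0) \<longrightarrow> u = 0) \<and>
    (\<forall>p v. ext_deriv A 2 \<omega> p v = 0)"

text \<open>Wedge product of a \<open>k\<close>-form and an \<open>l\<close>-form (with the normalization for which
  \<open>(dx\<^sub>1 \<and> \<dots> \<and> dx\<^sub>n) (\<partial>\<^sub>1, \<dots>, \<partial>\<^sub>n) = 1\<close>), and the powers \<open>\<omega> \<and> \<dots> \<and> \<omega>\<close> of a 2-form.\<close>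

definition wedge :: "nat \<Rightarrow> nat \<Rightarrow> ((nat \<Rightarrow> 'v) \<Rightarrow> real) \<Rightarrow> ((nat \<Rightarrow> 'v) \<Rightarrow> real) \<Rightarrow>
    (nat \<Rightarrow> 'v) \<Rightarrow> real"
  where "wedge k l \<alpha> \<beta> v =
    (\<Sum>\<sigma> | \<sigma> permutes {..<k + l}.
      of_int (sign \<sigma>) * \<alpha> (\<lambda>i. v (\<sigma> i)) * \<beta> (\<lambda>i. v (\<sigma> (k + i)))) / (fact k * fact l)"

primrec wedge_power :: "((nat \<Rightarrow> 'v) \<Rightarrow> real) \<Rightarrow> nat \<Rightarrow> (nat \<Rightarrow> 'v) \<Rightarrow> real"
  where
    "wedge_power \<omega> 0 = (\<lambda>v. 1)"
  | "wedge_power \<omega> (Suc m) = wedge 2 (2 * m) \<omega> (wedge_power \<omega> m)"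

text \<open>\<open>\<pi>\<^sub>#(\<alpha>)\<close> is the vector \<open>u\<close> with \<open>\<omega>(u, \<cdot>) = -\<alpha>\<close>, and \<open>\<pi>(\<alpha>, \<beta>) = \<beta>(\<pi>\<^sub>#(\<alpha>))\<close>.\<close>

definition poisson_sharp ::
    "('a, 'n) form_field \<Rightarrow> 'a \<Rightarrow> ((real^'n) \<Rightarrow>\<^sub>L real) \<Rightarrow> real^'n"
  where "poisson_sharp \<omega> p \<alpha> = (THE u. \<forall>v. \<omega> p (pair u v) = - blinfun_apply \<alpha> v)"

definition poisson_tensor :: "('a, 'n::finite) form_field \<Rightarrow> ('a, 'n) multivector_field"
  where "poisson_tensor \<omega> p a = blinfun_apply (a 1) (poisson_sharp \<omega> p (a 0))"

definition poisson_bracket :: "('a, real^'n) chart set \<Rightarrow> ('a, 'n) form_field \<Rightarrow>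
    ('a \<Rightarrow> real) \<Rightarrow> ('a \<Rightarrow> real) \<Rightarrow> 'a \<Rightarrow> real"
  where "poisson_bracket A \<omega> f g p =
    poisson_tensor \<omega> p (pair (Blinfun (dfun A f p)) (Blinfun (dfun A g p)))"


section \<open>Connections and affine charts\<close>

type_synonym ('a, 'e) connection = "('a \<Rightarrow> 'e) \<Rightarrow> ('a \<Rightarrow> 'e) \<Rightarrow> 'a \<Rightarrow> 'e"

text \<open>\<open>D X Y\<close> is \<open>\<nabla>\<^sub>X Y\<close>; it is only constrained for smooth vector fields.\<close>

definition linear_connection ::
    "('a, 'e::euclidean_space) chart set \<Rightarrow> ('a, 'e) connection \<Rightarrow> bool"
  where "linear_connection A D \<longleftrightarrow>
    (\<forall>X Y. smooth_vector_field A X \<and> smooth_vector_field A Y \<longrightarrow>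
      smooth_vector_field A (D X Y)) \<and>
    (\<forall>X X' Y. smooth_vector_field A X \<and> smooth_vector_field A X' \<and> smooth_vector_field A Y \<longrightarrow>
      D (\<lambda>p. X p + X' p) Y = (\<lambda>p. D X Y p + D X' Y p)) \<and>
    (\<forall>X Y Y'. smooth_vector_field A X \<and> smooth_vector_field A Y \<and> smooth_vector_field A Y' \<longrightarrow>
      D X (\<lambda>p. Y p + Y' p) = (\<lambda>p. D X Y p + D X Y' p)) \<and>
    (\<forall>f X Y. smooth_fun A f \<and> smooth_vector_field A X \<and> smooth_vector_field A Y \<longrightarrow>
      D (\<lambda>p. f p *\<^sub>R X p) Y = (\<lambda>p. f p *\<^sub>R D X Y p)) \<and>
    (\<forall>f X Y. smooth_fun A f \<and> smooth_vector_field A X \<and> smooth_vector_field A Y \<longrightarrow>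
      D X (\<lambda>p. f p *\<^sub>R Y p) = (\<lambda>p. dfun A f p (X p) *\<^sub>R Y p + f p *\<^sub>R D X Y p))"

text \<open>\<open>(\<nabla>\<^sub>X T)(Y 0, \<dots>, Y (k - 1))\<close> at \<open>p\<close>, for a \<open>k\<close>-form \<open>T\<close> defined near \<open>p\<close>.\<close>

definition cov_deriv :: "('a, real^'n) chart set \<Rightarrow> ('a, real^'n) connection \<Rightarrow> nat \<Rightarrow>
    ('a, 'n) form_field \<Rightarrow> ('a \<Rightarrow> real^'n) \<Rightarrow> (nat \<Rightarrow> 'a \<Rightarrow> real^'n) \<Rightarrow> 'a \<Rightarrow> real"
  where "cov_deriv A D k T X Y p =
    dfun A (\<lambda>q. T q (\<lambda>j. Y j q)) p (X p) -
    (\<Sum>i<k. T p ((\<lambda>j. Y j p)(i := D X (Y i) p)))"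

text \<open>\<open>\<nabla>T = 0\<close> on the open set \<open>U\<close>; as \<open>\<nabla>\<close> is tensorial in \<open>X\<close> and the \<open>Y j\<close>, it is enough to
  test with global vector fields, even if \<open>T\<close> is only defined on \<open>U\<close>.\<close>

definition parallel_form_on :: "('a, real^'n) chart set \<Rightarrow> ('a, real^'n) connection \<Rightarrow> 'a set \<Rightarrow>
    nat \<Rightarrow> ('a, 'n) form_field \<Rightarrow> bool"
  where "parallel_form_on A D U k T \<longleftrightarrow>
    (\<forall>X Y. smooth_vector_field A X \<and> (\<forall>j<k. smooth_vector_field A (Y j)) \<longrightarrow>
      (\<forall>p\<in>U. cov_deriv A D k T X Y p = 0))"

definition affine_chart :: "('a::topological_space, real^'n) chart set \<Rightarrow>
    ('a, real^'n) connection \<Rightarrow> ('a, real^'n) chart \<Rightarrow> bool"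
  where "affine_chart A D c \<longleftrightarrow> smooth_chart A c \<and> connected (fst c) \<and>
    (\<forall>i. parallel_form_on A D (fst c) 1 (\<lambda>p v. dfun A (\<lambda>q. snd c q $ i) p (v 0)))"

definition poly_fun_deg_le :: "nat \<Rightarrow> (real^'n \<Rightarrow> real) \<Rightarrow> bool"
  where "poly_fun_deg_le d P \<longleftrightarrow>
    (\<exists>c. \<forall>y. P y = (\<Sum>m | (\<Sum>i\<in>UNIV. m i) \<le> d. c m * (\<Prod>i\<in>UNIV. (y $ i) ^ m i)))"

definition polynomial_form_deg_le :: "('a::topological_space, real^'n) chart set \<Rightarrow>
    ('a, real^'n) connection \<Rightarrow> nat \<Rightarrow> ('a, 'n) form_field \<Rightarrow> bool"
  where "polynomial_form_deg_le A D d T \<longleftrightarrow>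
    (\<forall>c. affine_chart A D c \<longrightarrow>
      (\<forall>I. \<exists>P. poly_fun_deg_le d P \<and> (\<forall>p\<in>fst c. form_coeff A c T I p = P (snd c p))))"

definition polynomial_mv_deg_le :: "('a::topological_space, real^'n) chart set \<Rightarrow>
    ('a, real^'n) connection \<Rightarrow> nat \<Rightarrow> ('a, 'n) multivector_field \<Rightarrow> bool"
  where "polynomial_mv_deg_le A D d T \<longleftrightarrow>
    (\<forall>c. affine_chart A D c \<longrightarrow>
      (\<forall>I. \<exists>P. poly_fun_deg_le d P \<and> (\<forall>p\<in>fst c. mv_coeff A c T I p = P (snd c p))))"


section \<open>Lie groups\<close>

locale lie_group = group mul e iv
  for mul :: "'a::{t2_space, second_countable_topology} \<Rightarrow> 'a \<Rightarrow> 'a" and e :: 'a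
    and iv :: "'a \<Rightarrow> 'a" +
  fixes A :: "('a, real^'n) chart set"
  assumes smooth_atlas: "smooth_atlas A"
    and smooth_mult: "smooth_map (prod_atlas A A) A (\<lambda>(g, h). mul g h)"
    and smooth_iv: "smooth_map A A iv"

text \<open>Invariance under a diffeomorphism \<open>F\<close>: \<open>F\<^sup>* T = T\<close> for forms, \<open>F\<^sub>* T = T\<close> for
  multivector fields.\<close>

definition form_invariant ::
    "('a, real^'n) chart set \<Rightarrow> ('a \<Rightarrow> 'a) \<Rightarrow> ('a, 'n) form_field \<Rightarrow> bool"
  where "form_invariant A F T \<longleftrightarrow> (\<forall>h v. T (F h) (\<lambda>j. tmap A F h (v j)) = T h v)"

definition mv_invariant ::
    "('a, real^'n) chart set \<Rightarrow> ('a \<Rightarrow> 'a) \<Rightarrow> ('a, 'n) multivector_field \<Rightarrow> bool"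
  where "mv_invariant A F T \<longleftrightarrow> (\<forall>h a. T (F h) a = T h (\<lambda>j. a j o\<^sub>L Blinfun (tmap A F h)))"

definition left_invariant_form ::
    "('a \<Rightarrow> 'a \<Rightarrow> 'a) \<Rightarrow> ('a, real^'n) chart set \<Rightarrow> ('a, 'n) form_field \<Rightarrow> bool"
  where "left_invariant_form mul A T \<longleftrightarrow> (\<forall>g. form_invariant A (\<lambda>h. mul g h) T)"

definition right_invariant_form ::
    "('a \<Rightarrow> 'a \<Rightarrow> 'a) \<Rightarrow> ('a, real^'n) chart set \<Rightarrow> ('a, 'n) form_field \<Rightarrow> bool"
  where "right_invariant_form mul A T \<longleftrightarrow> (\<forall>g. form_invariant A (\<lambda>h. mul h g) T)"

definition right_invariant_mv ::
    "('a \<Rightarrow> 'a \<Rightarrow> 'a) \<Rightarrow> ('a, real^'n) chart set \<Rightarrow> ('a, 'n) multivector_field \<Rightarrow> bool"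
  where "right_invariant_mv mul A T \<longleftrightarrow> (\<forall>g. mv_invariant A (\<lambda>h. mul h g) T)"

text \<open>The left invariant vector field \<open>u\<^sup>+\<close> with value \<open>u\<close> at the neutral element \<open>e\<close>.\<close>

definition left_field ::
    "('a \<Rightarrow> 'a \<Rightarrow> 'a) \<Rightarrow> 'a \<Rightarrow> ('a, real^'n) chart set \<Rightarrow> real^'n \<Rightarrow> 'a \<Rightarrow> real^'n"
  where "left_field mul e A u p = tmap A (\<lambda>h. mul p h) e u"

definition lie_algebra_bracket ::
    "('a \<Rightarrow> 'a \<Rightarrow> 'a) \<Rightarrow> 'a \<Rightarrow> ('a, real^'n) chart set \<Rightarrow> real^'n \<Rightarrow> real^'n \<Rightarrow> real^'n"
  where "lie_algebra_bracket mul e A u v =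
    lie_bracket A (left_field mul e A u) (left_field mul e A v) e"

definition structure_constants :: "('a \<Rightarrow> 'a \<Rightarrow> 'a) \<Rightarrow> 'a \<Rightarrow> ('a, real^'n) chart set \<Rightarrow>
    ('n \<Rightarrow> 'n \<Rightarrow> 'n \<Rightarrow> real) \<Rightarrow> bool"
  where "structure_constants mul e A C \<longleftrightarrow>
    (\<exists>b :: 'n \<Rightarrow> real^'n. inj b \<and> independent (range b) \<and> span (range b) = UNIV \<and>
      (\<forall>i j. lie_algebra_bracket mul e A (b i) (b j) = (\<Sum>k\<in>UNIV. C i j k *\<^sub>R b k)))"

text \<open>The modular function of a Lie group is \<open>\<bar>det Ad\<^sub>g\<bar>\<close> (up to inversion), where \<open>Ad\<^sub>g\<close> is the
  tangent map at \<open>e\<close> of the conjugation by \<open>g\<close>.\<close>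

definition unimodular ::
    "('a \<Rightarrow> 'a \<Rightarrow> 'a) \<Rightarrow> 'a \<Rightarrow> ('a \<Rightarrow> 'a) \<Rightarrow> ('a, real^'n) chart set \<Rightarrow> bool"
  where "unimodular mul e iv A \<longleftrightarrow>
    (\<forall>g. \<bar>det (matrix (tmap A (\<lambda>h. mul (mul g h) (iv g)) e))\<bar> = 1)"

locale symplectic_lie_group = lie_group mul e iv A
  for mul :: "'a::{t2_space, second_countable_topology} \<Rightarrow> 'a \<Rightarrow> 'a" and e :: 'a
    and iv :: "'a \<Rightarrow> 'a" and A :: "('a, real^'n) chart set" +
  fixes \<omega> :: "('a, 'n) form_field"
  assumes symplectic: "symplectic_form A \<omega>"
    and left_invariant: "left_invariant_form mul A \<omega>"

text \<open>The connection determined by \<open>\<omega>(\<nabla>\<^bsub>u\<^sup>+\<^esub> v\<^sup>+, w\<^sup>+) = -\<omega>(v\<^sup>+, [u\<^sup>+, w\<^sup>+])\<close>. As left invariant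
  vector fields form a global frame, the formula and \<open>linear_connection\<close> determine \<open>D\<close> on
  smooth vector fields.\<close>

definition associated_connection :: "('a \<Rightarrow> 'a \<Rightarrow> 'a) \<Rightarrow> 'a \<Rightarrow> ('a, real^'n) chart set \<Rightarrow>
    ('a, 'n) form_field \<Rightarrow> ('a, real^'n) connection \<Rightarrow> bool"
  where "associated_connection mul e A \<omega> D \<longleftrightarrow> linear_connection A D \<and>
    (\<forall>u v w p.
      \<omega> p (pair (D (left_field mul e A u) (left_field mul e A v) p) (left_field mul e A w p)) =
      - \<omega> p (pair (left_field mul e A v p)
               (lie_bracket A (left_field mul e A u) (left_field mul e A w) p)))"

end

theory Submission
  imports Defs
begin

text \<open>Everything is computed in the left trivialization of the tangent bundle. There the right
  invariant field \<open>u\<^sup>-\<close> becomes \<open>p \<mapsto> Ad(p\<inverse>) u\<close>, the connection becomes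
  \<open>\<nabla>\<^sub>x y = dy(x) + \<Gamma>(x, y)\<close> with \<open>\<omega>(\<Gamma>(x, y), z) = -\<omega>(y, [x, z])\<close>, and the parallel 1-forms turn
  out to be exactly the forms \<open>\<omega>(u\<^sup>-, \<cdot>)\<close>. They are closed by the cocycle identity, and their local
  primitives for a basis \<open>u\<^sub>i\<close> are the affine coordinates \<open>x\<^sub>i\<close>.

  Again by the cocycle identity \<open>d(\<omega>(u\<^sup>-, v\<^sup>-)) = \<omega>([u, v]\<^sup>-, \<cdot>)\<close>, so that each function
  \<open>\<omega>(u\<^sup>-, v\<^sup>-)\<close> is affine with linear part given by the structure constants. Since
  \<open>{x\<^sub>i, x\<^sub>j} = \<omega>(u\<^sub>i\<^sup>-, u\<^sub>j\<^sup>-)\<close> and \<open>dx\<^sub>i(v\<^sup>-) = \<omega>(u\<^sub>i\<^sup>-, v\<^sup>-)\<close>, this gives the first two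
  assertions. In the unimodular case the matrix \<open>\<omega>(u\<^sub>i\<^sup>-, e\<^sub>j\<^sup>-)\<close> has constant determinant, so its
  inverse, which expresses the coordinate fields in the right invariant frame, is polynomial. The
  volume form is parallel because \<open>\<Gamma>(x, \<cdot>)\<close> is minus the \<open>\<omega>\<close>-adjoint of \<open>ad x\<close>, which has trace
  zero.\<close>

text \<open>The definitions represent a tangent vector at \<open>p\<close> in a chart chosen
  separately at each point, so a field cannot simply be differentiated as a map into the model
  space. Its coefficients in the global left invariant frame can, and \<open>lt p\<close>, the chart
  around \<open>e\<close> followed by left translation, turns every derivative at \<open>p\<close>
  into one at the single point \<open>z0\<close>. As the axioms of a connection speak of global
  fields, the same frame lets \<open>D\<close> be expanded without cut-off functions.

  The polynomial assertions concern every affine chart, so constructing good charts does not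
  suffice: conversely, the differentials of an arbitrary affine chart must come from right invariant
  fields. Connectedness of the chart domain enters there, and again whenever a function is recovered
  from its differential.

  The determinant in the unimodular case contains \<open>det (Ad (iv p))\<close> squared, so knowing
  it up to sign is enough. Trace zero is obtained by differentiating the square of a volume form
  along the adjoints of \<open>Ad\<close>. The degree \<open>n - 1\<close> comes from minors with
  one constant column.\<close>

abbreviation fderiv where "fderiv f x \<equiv> frechet_derivative f (at x)"

lemmas has_derivative_cong_open = has_derivative_transform_within_open

lemma frechet_derivative_cong_open:
  assumes "open S" "x \<in> S" "\<And>y. y \<in> S \<Longrightarrow> f y = g y"
  shows "fderiv f x = fderiv g x"
proof -
  have "(f has_derivative D) (at x) \<longleftrightarrow> (g has_derivative D) (at x)" for D
    using has_derivative_cong_open[of _ D x UNIV S] assms by metis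
  then show ?thesis by (simp add: frechet_derivative_def)
qed

lemma differentiable_cong_open:
  assumes "open S" "x \<in> S" "\<And>y. y \<in> S \<Longrightarrow> f y = g y" "f differentiable (at x)"
  shows "g differentiable (at x)"
  using has_derivative_cong_open[of f _ x UNIV S g] assms
  unfolding differentiable_def by metis

lemma has_derivative_frechet:
  "f differentiable (at x) \<Longrightarrow> (f has_derivative fderiv f x) (at x)"
  using frechet_derivative_works by blast

lemma frechet_derivativeI:
  "(f has_derivative f') (at x) \<Longrightarrow> fderiv f x = f'"
  using frechet_derivative_at by metis

section \<open>Functions of class \<open>C\<^sup>k\<close>\<close>

lemma Ck_on_cong:
  assumes "open S" "\<And>x. x \<in> S \<Longrightarrow> f x = g x" "Ck_on k S f"
  shows "Ck_on k S g"
  using assms(2,3)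
proof (induction k arbitrary: f g)
  case 0
  then show ?case using continuous_on_cong by (metis Ck_on.simps(1))
next
  case (Suc k)
  have eq: "fderiv f x v = fderiv g x v" if "x \<in> S" for x v
    by (rule fun_cong[OF frechet_derivative_cong_open[OF assms(1) that Suc.prems(1)]])
  have "Ck_on k S (\<lambda>x. fderiv g x v)" for v
    by (rule Suc.IH[of "\<lambda>x. fderiv f x v", OF eq]) (use Suc.prems(2) in auto)
  moreover have "g differentiable (at x)" if "x \<in> S" for x
    by (rule differentiable_cong_open[OF assms(1) that Suc.prems(1)]) (use Suc.prems(2) that in auto)
  ultimately show ?case by auto
qed

lemma Ck_on_subset: "Ck_on k S f \<Longrightarrow> T \<subseteq> S \<Longrightarrow> Ck_on k T f"
  by (induction k arbitrary: f) (auto intro: continuous_on_subset)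

lemma Ck_on_Suc_imp: "Ck_on (Suc k) S f \<Longrightarrow> Ck_on k S f"
proof (induction k arbitrary: f)
  case 0
  then show ?case
    by (auto intro!: continuous_at_imp_continuous_on differentiable_imp_continuous_within)
qed auto

lemma Ck_on_SucI:
  assumes "open S" "\<And>x. x \<in> S \<Longrightarrow> (f has_derivative f' x) (at x)"
    "\<And>v. Ck_on k S (\<lambda>x. f' x v)"
  shows "Ck_on (Suc k) S f"
  unfolding Ck_on.simps
proof (intro conjI ballI allI)
  show "f differentiable at x" if "x \<in> S" for x
    using assms(2) that by (auto simp: differentiable_def)
  show "Ck_on k S (\<lambda>x. fderiv f x v)" for v
    by (rule Ck_on_cong[OF assms(1) _ assms(3)[of v]]) (simp add: frechet_derivativeI[OF assms(2)])
qed

lemma Ck_on_SucD: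
  assumes "Ck_on (Suc k) S f" "x \<in> S"
  shows "(f has_derivative fderiv f x) (at x)"
  using assms by (auto intro: has_derivative_frechet)

section \<open>Closure of the classes \<open>Ck_on\<close> under algebra, composition and solving
  linear systems\<close>

lemma Ck_on_const: "open S \<Longrightarrow> Ck_on k S (\<lambda>x. c)"
proof (induction k arbitrary: c)
  case (Suc k)
  show ?case by (rule Ck_on_SucI[OF Suc.prems has_derivative_const Suc.IH[OF Suc.prems]])
qed simp

lemma Ck_on_bounded_linear:
  assumes "open S" "bounded_linear h" "Ck_on k S f"
  shows "Ck_on k S (\<lambda>x. h (f x))"
  using assms(3)
proof (induction k arbitrary: f)
  case 0
  then show ?case
    using bounded_linear.continuous_on[OF assms(2)] by simp
next
  case (Suc k)
  show ?case
    by (rule Ck_on_SucI[OF assms(1) bounded_linear.has_derivative[OF assms(2) Ck_on_SucD[OF Suc.prems]]])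
       (use Suc in auto)
qed

lemma Ck_on_linear_map:
  assumes "open S" "bounded_linear h"
  shows "Ck_on k S h"
proof (cases k)
  case 0
  then show ?thesis using linear_continuous_on[OF assms(2)] by simp
next
  case (Suc m)
  show ?thesis unfolding Suc
    by (rule Ck_on_SucI[OF assms(1) bounded_linear.has_derivative[OF assms(2) has_derivative_ident]])
       (simp add: Ck_on_const assms)
qed

lemma Ck_on_add:
  assumes "open S" "Ck_on k S f" "Ck_on k S g"
  shows "Ck_on k S (\<lambda>x. f x + g x)"
  using assms(2,3)
proof (induction k arbitrary: f g)
  case 0
  then show ?case by (simp add: continuous_on_add)
next
  case (Suc k)
  show ?case
    by (rule Ck_on_SucI[OF assms(1) has_derivative_add[OF Ck_on_SucD[OF Suc.prems(1)] Ck_on_SucD[OF Suc.prems(2)]]])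
       (use Suc in auto)
qed

lemma Ck_on_sum:
  assumes "open S" "\<And>i. i \<in> I \<Longrightarrow> Ck_on k S (f i)"
  shows "Ck_on k S (\<lambda>x. \<Sum>i\<in>I. f i x)"
  using assms(2)
  by (induction I rule: infinite_finite_induct) (auto simp: Ck_on_const Ck_on_add assms(1))

lemma Ck_on_bilinear:
  assumes "open S" "bounded_bilinear h" "Ck_on k S f" "Ck_on k S g"
  shows "Ck_on k S (\<lambda>x. h (f x) (g x))"
  using assms(3,4)
proof (induction k arbitrary: f g)
  case 0
  then show ?case using bounded_bilinear.continuous_on[OF assms(2)] by simp
next
  case (Suc k)
  have "Ck_on k S (\<lambda>x. h (f x) (fderiv g x v) + h (fderiv f x v) (g x))" for v
  proof (intro Ck_on_add Suc.IH assms(1))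
    show "Ck_on k S f" "Ck_on k S g" using Suc.prems by (auto intro: Ck_on_Suc_imp simp del: Ck_on.simps)
    show "Ck_on k S (\<lambda>x. fderiv g x v)" "Ck_on k S (\<lambda>x. fderiv f x v)"
      using Suc.prems by auto
  qed
  moreover have "((\<lambda>x. h (f x) (g x)) has_derivative
      (\<lambda>v. h (f x) (fderiv g x v) + h (fderiv f x v) (g x))) (at x)"
    if "x \<in> S" for x
    by (rule bounded_bilinear.FDERIV[OF assms(2) Ck_on_SucD[OF Suc.prems(1) that] Ck_on_SucD[OF Suc.prems(2) that]])
  ultimately show ?case by (rule Ck_on_SucI[OF assms(1), rotated])
qed

lemmas Ck_on_scaleR = Ck_on_bilinear[OF _ bounded_bilinear_scaleR]
lemmas Ck_on_mult = Ck_on_bilinear[OF _ bounded_bilinear_mult]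

lemma Ck_on_prod:
  fixes f :: "'i \<Rightarrow> 'a::real_normed_vector \<Rightarrow> real"
  assumes "open S" "\<And>i. i \<in> I \<Longrightarrow> Ck_on k S (f i)"
  shows "Ck_on k S (\<lambda>x. \<Prod>i\<in>I. f i x)"
  using assms(2)
  by (induction I rule: infinite_finite_induct) (auto simp: Ck_on_const Ck_on_mult assms(1))

lemma Ck_on_compose:
  fixes g :: "'a::real_normed_vector \<Rightarrow> 'b::euclidean_space"
  assumes "open S" "open T" "g ` S \<subseteq> T" "Ck_on k T f" "Ck_on k S g"
  shows "Ck_on k S (\<lambda>x. f (g x))"
  using assms(4,5)
proof (induction k arbitrary: f)
  case 0
  then show ?case using continuous_on_compose2[of T f S g] assms by auto
next
  case (Suc k)
  have sub: "g x \<in> T" if "x \<in> S" for x using that assms(3) by auto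
  \<comment> \<open>In the chain rule both the base point and the direction of
    \<open>fderiv f\<close> vary with \<open>x\<close>, while the induction hypothesis treats a
    fixed direction only. Expanding the direction in the basis separates the two.\<close>
  have exp: "fderiv f y v = (\<Sum>b\<in>Basis. (v \<bullet> b) *\<^sub>R fderiv f y b)"
    if "y \<in> T" for y v
  proof -
    have "linear (fderiv f y)"
      using has_derivative_linear[OF Ck_on_SucD[OF Suc.prems(1) that]] .
    then have "fderiv f y (\<Sum>b\<in>Basis. (v \<bullet> b) *\<^sub>R b)
        = (\<Sum>b\<in>Basis. (v \<bullet> b) *\<^sub>R fderiv f y b)"
      by (simp add: linear_sum linear_cmul)
    then show ?thesis by (simp add: euclidean_representation)
  qed
  have der: "((\<lambda>x. f (g x)) has_derivative (\<lambda>v. fderiv f (g x) (fderiv g x v))) (at x)"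
    if "x \<in> S" for x
    using diff_chain_at[OF Ck_on_SucD[OF Suc.prems(2) that] Ck_on_SucD[OF Suc.prems(1) sub[OF that]]]
    by (simp add: o_def)
  have "Ck_on k S (\<lambda>x. \<Sum>b\<in>Basis. (fderiv g x v \<bullet> b) *\<^sub>R fderiv f (g x) b)" for v
    using Suc.prems Ck_on_Suc_imp[OF Suc.prems(2)]
    by (intro Ck_on_sum Ck_on_scaleR Suc.IH[where f="\<lambda>y. fderiv f y b" for b]
          Ck_on_bounded_linear[OF _ bounded_linear_inner_left] assms(1)) auto
  then have "Ck_on k S (\<lambda>x. fderiv f (g x) (fderiv g x v))" for v
    by (rule Ck_on_cong[OF assms(1), rotated]) (use exp sub in simp)
  then show ?case by (intro Ck_on_SucI[OF assms(1) der])
qed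

lemma Ck_on_inverse:
  fixes f :: "'a::real_normed_vector \<Rightarrow> real"
  assumes "open S" "\<And>x. x \<in> S \<Longrightarrow> f x \<noteq> 0" "Ck_on k S f"
  shows "Ck_on k S (\<lambda>x. inverse (f x))"
  using assms(3)
proof (induction k)
  case 0
  then show ?case using assms(2) by (auto intro: continuous_on_inverse)
next
  case (Suc k)
  have d: "((\<lambda>x. inverse (f x)) has_derivative
      (\<lambda>h. - (inverse (f x) * fderiv f x h * inverse (f x)))) (at x)" if "x \<in> S" for x
    by (rule Deriv.has_derivative_inverse[OF assms(2)[OF that] Ck_on_SucD[OF Suc.prems that]])
  have I: "Ck_on k S (\<lambda>x. inverse (f x))" by (rule Suc.IH[OF Ck_on_Suc_imp[OF Suc.prems]])
  have "Ck_on k S (\<lambda>x. - (inverse (f x) * fderiv f x h * inverse (f x)))" for h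
    using Suc.prems
    by (intro Ck_on_bounded_linear[OF assms(1) bounded_linear_minus[OF bounded_linear_ident]] Ck_on_mult assms(1) I) auto
  with d show ?case by (rule Ck_on_SucI[OF assms(1)])
qed

lemma Ck_on_vec_nth: "open S \<Longrightarrow> Ck_on k S f \<Longrightarrow> Ck_on k S (\<lambda>x. f x $ i)"
  by (rule Ck_on_bounded_linear[OF _ bounded_linear_vec_nth])

lemma Ck_on_vecI:
  fixes f :: "'a::real_normed_vector \<Rightarrow> real^'n"
  assumes "open S" "\<And>i. Ck_on k S (\<lambda>x. f x $ i)"
  shows "Ck_on k S f"
proof -
  have "Ck_on k S (\<lambda>x. \<Sum>i\<in>UNIV. (f x $ i) *\<^sub>R (axis i 1 :: real^'n))"
    by (intro Ck_on_sum Ck_on_scaleR Ck_on_const assms)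
  then show ?thesis
    by (rule Ck_on_cong[OF assms(1), rotated]) (simp add: scalar_mult_eq_scaleR[symmetric] basis_expansion)
qed

lemma Ck_on_Pair:
  fixes f :: "'a::real_normed_vector \<Rightarrow> 'b::real_normed_vector" and g :: "'a \<Rightarrow> 'c::real_normed_vector"
  assumes "open S" "Ck_on k S f" "Ck_on k S g"
  shows "Ck_on k S (\<lambda>x. (f x, g x))"
proof -
  have "Ck_on k S (\<lambda>x. (f x, 0::'c))" "Ck_on k S (\<lambda>x. (0::'b, g x))"
    using assms bounded_linear_Pair[OF bounded_linear_ident bounded_linear_zero]
      bounded_linear_Pair[OF bounded_linear_zero bounded_linear_ident]
    by (auto intro: Ck_on_bounded_linear[where h="\<lambda>x. (x, 0)"] Ck_on_bounded_linear[where h="\<lambda>x. (0, x)"])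
  from Ck_on_add[OF assms(1) this] show ?thesis by simp
qed

text \<open>Cramer's rule gives the solution as a quotient of determinants, which are polynomials in
  the entries. This yields the regularity of vectors known only through a linear system that they
  solve.\<close>

lemma Ck_on_linear_solve:
  fixes M :: "'a::real_normed_vector \<Rightarrow> real^'n^'n"
  assumes "open S" "\<And>i j. Ck_on k S (\<lambda>x. M x $ i $ j)" "\<And>i. Ck_on k S (\<lambda>x. b x $ i)"
    "\<And>x. x \<in> S \<Longrightarrow> det (M x) \<noteq> 0" "\<And>x. x \<in> S \<Longrightarrow> M x *v \<xi> x = b x"
  shows "Ck_on k S \<xi>"
proof (rule Ck_on_vecI[OF assms(1)])
  fix l
  have detC: "Ck_on k S (\<lambda>x. det (N x))" if "\<And>i j. Ck_on k S (\<lambda>x. N x $ i $ j)"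
    for N :: "'a \<Rightarrow> real^'n^'n"
    unfolding det_def by (intro Ck_on_sum Ck_on_mult Ck_on_prod Ck_on_const assms(1) that)
  have "Ck_on k S (\<lambda>x. det (\<chi> i j. if j = l then b x $ i else M x $ i $ j) * inverse (det (M x)))"
  proof (intro Ck_on_mult Ck_on_inverse detC assms(1,2,4))
    show "Ck_on k S (\<lambda>x. (\<chi> i j. if j = l then b x $ i else M x $ i $ j) $ i $ j)" for i j
      by (cases "j = l") (simp_all add: assms(2,3))
  qed
  moreover have "det (\<chi> i j. if j = l then b x $ i else M x $ i $ j) * inverse (det (M x)) = \<xi> x $ l"
    if "x \<in> S" for x
    using iffD1[OF cramer[OF assms(4)[OF that], of "\<xi> x" "b x"] assms(5)[OF that]]
    by (simp add: divide_inverse)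
  ultimately show "Ck_on k S (\<lambda>x. \<xi> x $ l)" using Ck_on_cong[OF assms(1)] by (metis (no_types, lifting))
qed

section \<open>The same rules for smooth maps\<close>

lemma smooth_on_cong:
  "open S \<Longrightarrow> (\<And>x. x \<in> S \<Longrightarrow> f x = g x) \<Longrightarrow> smooth_on S f \<Longrightarrow> smooth_on S g"
  unfolding smooth_on_def by (blast intro: Ck_on_cong)

lemma smooth_on_subset: "smooth_on S f \<Longrightarrow> T \<subseteq> S \<Longrightarrow> smooth_on T f"
  unfolding smooth_on_def by (blast intro: Ck_on_subset)

lemma smooth_on_compose:
  fixes g :: "'a::real_normed_vector \<Rightarrow> 'b::euclidean_space"
  shows "open S \<Longrightarrow> open T \<Longrightarrow> g ` S \<subseteq> T \<Longrightarrow> smooth_on T f \<Longrightarrow> smooth_on S g \<Longrightarrow> smooth_on S (\<lambda>x. f (g x))"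
  unfolding smooth_on_def by (blast intro: Ck_on_compose)

lemma smooth_on_has_derivative:
  "smooth_on S f \<Longrightarrow> x \<in> S \<Longrightarrow> (f has_derivative fderiv f x) (at x)"
  unfolding smooth_on_def by (blast intro: Ck_on_SucD)

lemma smooth_on_frechet: "smooth_on S f \<Longrightarrow> smooth_on S (\<lambda>x. fderiv f x v)"
  unfolding smooth_on_def by (metis Ck_on.simps(2))

lemma smooth_on_const: "open S \<Longrightarrow> smooth_on S (\<lambda>x. c)"
  unfolding smooth_on_def by (blast intro: Ck_on_const)

lemma smooth_on_vec_nth: "open S \<Longrightarrow> smooth_on S f \<Longrightarrow> smooth_on S (\<lambda>x. f x $ i)"
  unfolding smooth_on_def by (blast intro: Ck_on_vec_nth)

lemma smooth_on_vecI:
  fixes f :: "'a::real_normed_vector \<Rightarrow> real^'n"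
  shows "open S \<Longrightarrow> (\<And>i. smooth_on S (\<lambda>x. f x $ i)) \<Longrightarrow> smooth_on S f"
  unfolding smooth_on_def by (blast intro: Ck_on_vecI)

lemma smooth_on_ident: "open S \<Longrightarrow> smooth_on S (\<lambda>x. x)"
  unfolding smooth_on_def by (blast intro: Ck_on_linear_map bounded_linear_ident)

lemma smooth_on_Pair: "open S \<Longrightarrow> smooth_on S f \<Longrightarrow> smooth_on S g \<Longrightarrow> smooth_on S (\<lambda>x. (f x, g x))"
  unfolding smooth_on_def by (blast intro: Ck_on_Pair)

lemma smooth_on_bounded_linear:
  "open S \<Longrightarrow> bounded_linear h \<Longrightarrow> smooth_on S f \<Longrightarrow> smooth_on S (\<lambda>x. h (f x))"
  unfolding smooth_on_def by (blast intro: Ck_on_bounded_linear)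

lemma smooth_on_sum:
  "open S \<Longrightarrow> (\<And>i. i \<in> I \<Longrightarrow> smooth_on S (f i)) \<Longrightarrow> smooth_on S (\<lambda>x. \<Sum>i\<in>I. f i x)"
  unfolding smooth_on_def by (blast intro: Ck_on_sum)

lemma smooth_on_scaleR: "open S \<Longrightarrow> smooth_on S f \<Longrightarrow> smooth_on S g \<Longrightarrow> smooth_on S (\<lambda>x. f x *\<^sub>R g x)"
  unfolding smooth_on_def by (blast intro: Ck_on_scaleR)

lemma smooth_on_linear_solve:
  fixes M :: "'a::real_normed_vector \<Rightarrow> real^'n^'n"
  assumes "open S" "\<And>i j. smooth_on S (\<lambda>x. M x $ i $ j)" "smooth_on S b"
    "\<And>x. x \<in> S \<Longrightarrow> det (M x) \<noteq> 0" "\<And>x. x \<in> S \<Longrightarrow> M x *v \<xi> x = b x"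
  shows "smooth_on S \<xi>"
  unfolding smooth_on_def
proof
  fix k
  show "Ck_on k S \<xi>"
    by (rule Ck_on_linear_solve[where M=M and b=b])
       (use assms in \<open>auto simp: smooth_on_def intro: Ck_on_vec_nth\<close>)
qed

section \<open>Second derivatives, potentials and local inverses\<close>

text \<open>The mean value theorem is applied along \<open>u\<close> to the difference of the edges
  \<open>t = h\<close> and \<open>t = 0\<close>, and then along \<open>v\<close>. The second
  difference is symmetric in \<open>u\<close> and \<open>v\<close>, which is where the symmetry of
  second derivatives comes from.\<close>

lemma second_difference:
  fixes f :: "'a::real_normed_vector \<Rightarrow> real"
  assumes "open S" "Ck_on 2 S f" "h > 0"
    and "\<And>s t. 0 \<le> s \<Longrightarrow> s \<le> h \<Longrightarrow> 0 \<le> t \<Longrightarrow> t \<le> h \<Longrightarrow> x + s *\<^sub>R u + t *\<^sub>R v \<in> S"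
  obtains s t where "0 \<le> s" "s \<le> h" "0 \<le> t" "t \<le> h"
    "f (x + h *\<^sub>R u + h *\<^sub>R v) - f (x + h *\<^sub>R u) - f (x + h *\<^sub>R v) + f x
      = h * h * fderiv (\<lambda>y. fderiv f y u) (x + s *\<^sub>R u + t *\<^sub>R v) v"
proof -
  let ?p = "\<lambda>s t. x + s *\<^sub>R u + t *\<^sub>R v"
  let ?D = "\<lambda>y. fderiv f y"
  have C1: "Ck_on (Suc 1) S f" using assms(2) by (simp add: numeral_2_eq_2)
  have C2: "Ck_on (Suc 0) S (\<lambda>y. ?D y u)" using C1 unfolding One_nat_def by (metis Ck_on.simps(2))
  have inS: "?p s t \<in> S" if "0 \<le> s" "s \<le> h" "0 \<le> t" "t \<le> h" for s t
    using assms(4) that by blast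
  have d1: "((\<lambda>s. f (?p s t)) has_derivative (\<lambda>d. d * ?D (?p s t) u)) (at s)"
    if "0 \<le> s" "s \<le> h" "0 \<le> t" "t \<le> h" for s t
  proof -
    have fd: "(f has_derivative ?D (?p s t)) (at (?p s t))"
      by (rule Ck_on_SucD[OF C1 inS[OF that]])
    have "((\<lambda>s. ?p s t) has_derivative (\<lambda>d. d *\<^sub>R u)) (at s)"
      by (auto intro!: derivative_eq_intros)
    from diff_chain_at[OF this fd] show ?thesis
      by (simp add: o_def linear_cmul[OF has_derivative_linear[OF fd]])
  qed
  have "\<exists>s\<in>{0<..<h}. (f (?p h h) - f (?p h 0)) - (f (?p 0 h) - f (?p 0 0))
      = (h - 0) * ?D (?p s h) u - (h - 0) * ?D (?p s 0) u"
    by (rule mvt_simple[of 0 h "\<lambda>s. f (?p s h) - f (?p s 0)"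
          "\<lambda>s d. d * ?D (?p s h) u - d * ?D (?p s 0) u", OF assms(3)])
       (use assms(3) in \<open>intro has_derivative_diff has_derivative_at_withinI[OF d1], auto\<close>)
  then obtain s where s: "0 < s" "s < h" and eq1:
    "f (?p h h) - f (x + h *\<^sub>R u) - f (x + h *\<^sub>R v) + f x
      = h * (?D (?p s h) u - ?D (?p s 0) u)"
    by (auto simp: algebra_simps)
  have d2: "((\<lambda>t. ?D (?p s t) u) has_derivative
      (\<lambda>d. d * fderiv (\<lambda>y. ?D y u) (?p s t) v)) (at t)"
    if "0 \<le> t" "t \<le> h" for t
  proof -
    have "?p s t \<in> S" using inS s that by simp
    from Ck_on_SucD[OF C2 this] have fd: "((\<lambda>y. ?D y u) has_derivative
       fderiv (\<lambda>y. ?D y u) (?p s t)) (at (?p s t))" .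
    have "((\<lambda>t. ?p s t) has_derivative (\<lambda>d. d *\<^sub>R v)) (at t)"
      by (auto intro!: derivative_eq_intros)
    from diff_chain_at[OF this fd] show ?thesis
      by (simp add: o_def linear_cmul[OF has_derivative_linear[OF fd]])
  qed
  have "\<exists>t\<in>{0<..<h}. ?D (?p s h) u - ?D (?p s 0) u
      = (h - 0) * fderiv (\<lambda>y. ?D y u) (?p s t) v"
    by (rule mvt_simple[of 0 h "\<lambda>t. ?D (?p s t) u"
          "\<lambda>t d. d * fderiv (\<lambda>y. ?D y u) (?p s t) v", OF assms(3)])
       (intro has_derivative_at_withinI[OF d2], auto)
  then obtain t where "0 < t" "t < h" and eq2: "?D (?p s h) u - ?D (?p s 0) u
      = h * fderiv (\<lambda>y. ?D y u) (?p s t) v" by auto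
  show thesis
    by (rule that[of s t]) (use s \<open>0 < t\<close> \<open>t < h\<close> eq1 eq2 in auto)
qed

lemma second_derivative_symmetric_real:
  fixes f :: "'a::real_normed_vector \<Rightarrow> real"
  assumes "open S" "Ck_on 2 S f" "x \<in> S"
  shows "fderiv (\<lambda>y. fderiv f y u) x v =
         fderiv (\<lambda>y. fderiv f y v) x u"
proof -
  let ?p = "\<lambda>s t. x + s *\<^sub>R u + t *\<^sub>R v" and ?p' = "\<lambda>s t. x + s *\<^sub>R v + t *\<^sub>R u"
  define P where "P a b y = fderiv (\<lambda>y. fderiv f y a) y b" for a b y
  have C: "Ck_on 2 S f" by (rule assms(2))
  have contP: "continuous_on S (P a b)" for a b
    using C unfolding P_def by (auto simp: numeral_2_eq_2)
  have "\<bar>P u v x - P v u x\<bar> \<le> \<epsilon>" if "\<epsilon> > 0" for \<epsilon>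
  proof -
    have e2: "\<epsilon> / 2 > 0" using that by simp
    obtain d1 where d1: "d1 > 0" "\<And>y. y \<in> S \<Longrightarrow> dist y x < d1 \<Longrightarrow> dist (P u v y) (P u v x) < \<epsilon>/2"
      using contP[of u v] assms(3) e2 unfolding continuous_on_iff by metis
    obtain d2 where d2: "d2 > 0" "\<And>y. y \<in> S \<Longrightarrow> dist y x < d2 \<Longrightarrow> dist (P v u y) (P v u x) < \<epsilon>/2"
      using contP[of v u] assms(3) e2 unfolding continuous_on_iff by metis
    obtain d3 where d3: "d3 > 0" "ball x d3 \<subseteq> S" using assms(1,3) openE by blast
    define d where "d = min d1 (min d2 d3)"
    have d: "d > 0" using d1 d2 d3 by (simp add: d_def)
    \<comment> \<open>The summand 1 keeps \<open>n\<close> positive when \<open>u\<close> and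
      \<open>v\<close> both vanish; with \<open>h = d / (2 * n)\<close> the whole parallelogram lies
      within distance \<open>d\<close> of \<open>x\<close>.\<close>
    define n where "n = norm u + norm v + 1"
    define h where "h = d / (2 * n)"
    have N: "n > 0" by (simp add: add_nonneg_pos n_def)
    have h: "h > 0" using d N by (simp add: h_def)
    have near: "norm (s *\<^sub>R u + t *\<^sub>R v) < d" if "0 \<le> s" "s \<le> h" "0 \<le> t" "t \<le> h" for s t
    proof -
      have "norm (s *\<^sub>R u + t *\<^sub>R v) \<le> s * norm u + t * norm v"
        using norm_triangle_ineq[of "s *\<^sub>R u" "t *\<^sub>R v"] that by simp
      also have "\<dots> \<le> h * norm u + h * norm v"
        using that by (intro add_mono mult_right_mono) auto
      also have "\<dots> \<le> h * n" using h by (simp add: algebra_simps n_def)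
      also have "\<dots> = d / 2" using N by (simp add: h_def)
      finally show ?thesis using d by simp
    qed
    have dst: "dist (?p s t) x < d" if "0 \<le> s" "s \<le> h" "0 \<le> t" "t \<le> h" for s t
      using near[OF that] by (simp add: dist_norm algebra_simps)
    have inS: "?p s t \<in> S" if "0 \<le> s" "s \<le> h" "0 \<le> t" "t \<le> h" for s t
      using dst[OF that] d3(2) by (auto simp: d_def dist_commute)
    obtain s t where st: "0 \<le> s" "s \<le> h" "0 \<le> t" "t \<le> h" and
      E1: "f (?p h h) - f (x + h *\<^sub>R u) - f (x + h *\<^sub>R v) + f x = h * h * P u v (?p s t)"
      using second_difference[OF assms(1) C h inS] unfolding P_def by blast
    have inS': "?p' s t \<in> S" if "0 \<le> s" "s \<le> h" "0 \<le> t" "t \<le> h" for s t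
      using inS[of t s] that by (simp add: algebra_simps)
    obtain s' t' where st': "0 \<le> s'" "s' \<le> h" "0 \<le> t'" "t' \<le> h" and
      E2: "f (?p' h h) - f (x + h *\<^sub>R v) - f (x + h *\<^sub>R u) + f x = h * h * P v u (?p' s' t')"
      using second_difference[OF assms(1) C h inS'] unfolding P_def by blast
    \<comment> \<open>Both mixed derivatives express the same second difference, possibly at
      different points of the parallelogram; continuity then moves both points to
      \<open>x\<close>.\<close>
    have "h * h * P u v (?p s t) = h * h * P v u (?p' s' t')"
      using E1 E2 by (simp add: algebra_simps)
    then have "P u v (?p s t) = P v u (?p' s' t')" using h by simp
    moreover have "dist (P u v (?p s t)) (P u v x) < \<epsilon>/2"
      by (rule d1(2)[OF inS[OF st]]) (use dst[OF st] in \<open>simp add: d_def\<close>)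
    moreover have "dist (P v u (?p' s' t')) (P v u x) < \<epsilon>/2"
      by (rule d2(2)[OF inS'[OF st']]) (use dst[OF st'(3,4,1,2)] in \<open>simp add: d_def algebra_simps\<close>)
    ultimately show ?thesis unfolding dist_real_def by linarith
  qed
  then have "\<bar>P u v x - P v u x\<bar> \<le> 0" by (rule field_le_epsilon) simp
  then show ?thesis unfolding P_def by simp
qed

lemma second_derivative_symmetric:
  fixes f :: "'a::real_normed_vector \<Rightarrow> 'b::euclidean_space"
  assumes "open S" "Ck_on 2 S f" "x \<in> S"
  shows "fderiv (\<lambda>y. fderiv f y u) x v =
         fderiv (\<lambda>y. fderiv f y v) x u"
proof (rule euclidean_eqI)
  fix b :: 'b assume "b \<in> Basis"
  have C1: "Ck_on (Suc (Suc 0)) S f" using assms(2) by (simp only: numeral_2_eq_2)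
  have C2: "Ck_on (Suc 0) S (\<lambda>y. fderiv f y a)" for a
    using C1 by (metis Ck_on.simps(2))
  have fb: "Ck_on 2 S (\<lambda>y. f y \<bullet> b)"
    by (rule Ck_on_bounded_linear[OF assms(1) bounded_linear_inner_left assms(2)])
  have 1: "fderiv (\<lambda>y. f y \<bullet> b) y = (\<lambda>a. fderiv f y a \<bullet> b)" if "y \<in> S" for y
    by (rule frechet_derivativeI[OF bounded_linear.has_derivative[OF bounded_linear_inner_left Ck_on_SucD[OF C1 that]]])
  have 2: "fderiv (\<lambda>y. fderiv (\<lambda>y. f y \<bullet> b) y a) x c
      = fderiv (\<lambda>y. fderiv f y a) x c \<bullet> b" for a c
  proof -
    have "fderiv (\<lambda>y. fderiv (\<lambda>y. f y \<bullet> b) y a) x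
      = fderiv (\<lambda>y. fderiv f y a \<bullet> b) x"
      by (rule frechet_derivative_cong_open[OF assms(1,3)]) (simp add: 1)
    also have "\<dots> = (\<lambda>c. fderiv (\<lambda>y. fderiv f y a) x c \<bullet> b)"
      by (rule frechet_derivativeI[OF bounded_linear.has_derivative[OF bounded_linear_inner_left Ck_on_SucD[OF C2 assms(3)]]])
    finally show ?thesis by simp
  qed
  show "fderiv (\<lambda>y. fderiv f y u) x v \<bullet> b =
         fderiv (\<lambda>y. fderiv f y v) x u \<bullet> b"
    using second_derivative_symmetric_real[OF assms(1) fb assms(3), of u v] by (simp add: 2)
qed

lemma linear_basis_expansion:
  fixes L :: "'a::euclidean_space \<Rightarrow> 'b::real_vector"
  assumes "linear L"
  shows "L v = (\<Sum>b\<in>Basis. (v \<bullet> b) *\<^sub>R L b)"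
proof -
  have "L (\<Sum>b\<in>Basis. (v \<bullet> b) *\<^sub>R b) = (\<Sum>b\<in>Basis. (v \<bullet> b) *\<^sub>R L b)"
    using assms by (simp add: linear_sum linear_cmul)
  then show ?thesis by (simp add: euclidean_representation)
qed

text \<open>A product rule for a derivative whose base point and direction both move. Expanding the
  direction in the basis leaves only derivatives in constant directions to be
  differentiated.\<close>

lemma has_derivative_directional:
  fixes F :: "'a::euclidean_space \<Rightarrow> 'b::real_normed_vector" and \<phi> V :: "'c::real_normed_vector \<Rightarrow> 'a"
  assumes "open S" "Ck_on 2 S F" "\<phi> x \<in> S"
    and \<phi>: "(\<phi> has_derivative \<phi>') (at x)" and V: "(V has_derivative V') (at x)"
  shows "((\<lambda>z. fderiv F (\<phi> z) (V z)) has_derivative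
     (\<lambda>u. fderiv (\<lambda>y. fderiv F y (V x)) (\<phi> x) (\<phi>' u)
        + fderiv F (\<phi> x) (V' u))) (at x)"
proof -
  let ?G = "\<lambda>b y. fderiv F y b"
  have C1: "Ck_on (Suc (Suc 0)) S F" using assms(2) by (simp only: numeral_2_eq_2)
  have C2: "Ck_on (Suc 0) S (?G a)" for a
    using C1 by (metis Ck_on.simps(2))
  have lin: "linear (fderiv F y)" if "y \<in> S" for y
    using has_derivative_linear[OF Ck_on_SucD[OF C1 that]] .
  have dG: "(?G b has_derivative fderiv (?G b) (\<phi> x)) (at (\<phi> x))" for b
    by (rule Ck_on_SucD[OF C2 assms(3)])
  have dGc: "((\<lambda>z. ?G b (\<phi> z)) has_derivative (\<lambda>u. fderiv (?G b) (\<phi> x) (\<phi>' u))) (at x)" for b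
    using diff_chain_at[OF \<phi> dG] by (simp add: o_def)
  have s: "((\<lambda>z. \<Sum>b\<in>Basis. (V z \<bullet> b) *\<^sub>R ?G b (\<phi> z)) has_derivative
      (\<lambda>u. \<Sum>b\<in>Basis. (V x \<bullet> b) *\<^sub>R fderiv (?G b) (\<phi> x) (\<phi>' u) + (V' u \<bullet> b) *\<^sub>R ?G b (\<phi> x))) (at x)"
    by (intro has_derivative_sum has_derivative_scaleR dGc bounded_linear.has_derivative[OF bounded_linear_inner_left V])
  have ev: "\<forall>\<^sub>F z in at x. \<phi> z \<in> S"
    using \<phi> assms(1,3) has_derivative_continuous[OF \<phi>] unfolding continuous_within tendsto_def by blast
  have t: "((\<lambda>z. fderiv F (\<phi> z) (V z)) has_derivative
      (\<lambda>u. \<Sum>b\<in>Basis. (V x \<bullet> b) *\<^sub>R fderiv (?G b) (\<phi> x) (\<phi>' u) + (V' u \<bullet> b) *\<^sub>R ?G b (\<phi> x))) (at x)"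
  proof (rule has_derivative_transform_eventually[OF s])
    show "\<forall>\<^sub>F z in at x. (\<Sum>b\<in>Basis. (V z \<bullet> b) *\<^sub>R ?G b (\<phi> z)) = fderiv F (\<phi> z) (V z)"
      using ev by (rule eventually_mono) (metis lin linear_basis_expansion)
    show "(\<Sum>b\<in>Basis. (V x \<bullet> b) *\<^sub>R ?G b (\<phi> x)) = fderiv F (\<phi> x) (V x)"
      using linear_basis_expansion[OF lin[OF assms(3)]] by metis
  qed simp
  have "fderiv (\<lambda>y. fderiv F y (V x)) (\<phi> x) w
      = (\<Sum>b\<in>Basis. (V x \<bullet> b) *\<^sub>R fderiv (?G b) (\<phi> x) w)" for w
  proof -
    have "fderiv (\<lambda>y. fderiv F y (V x)) (\<phi> x)
       = fderiv (\<lambda>y. \<Sum>b\<in>Basis. (V x \<bullet> b) *\<^sub>R ?G b y) (\<phi> x)"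
      by (rule frechet_derivative_cong_open[OF assms(1,3)]) (metis lin linear_basis_expansion)
    also have "\<dots> = (\<lambda>w. \<Sum>b\<in>Basis. (V x \<bullet> b) *\<^sub>R fderiv (?G b) (\<phi> x) w)"
      by (rule frechet_derivativeI) (intro has_derivative_sum has_derivative_scaleR_right dG)
    finally show ?thesis by simp
  qed
  moreover have "fderiv F (\<phi> x) (V' u) = (\<Sum>b\<in>Basis. (V' u \<bullet> b) *\<^sub>R ?G b (\<phi> x))" for u
    using linear_basis_expansion[OF lin[OF assms(3)]] .
  ultimately show ?thesis using t by (simp add: sum.distrib)
qed

text \<open>The Poincare lemma for 1-forms: the potential is the integral of \<open>a\<close> along
  the segment from a base point, differentiated under the integral sign.\<close>

lemma gradient_potential:
  fixes a :: "'a::euclidean_space \<Rightarrow> 'a"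
  assumes "open S" "convex S" and C: "Ck_on (Suc 0) S a"
    and sym: "\<And>y u v. y \<in> S \<Longrightarrow> fderiv a y u \<bullet> v = fderiv a y v \<bullet> u"
  shows "\<exists>f. \<forall>y\<in>S. (f has_derivative (\<lambda>v. a y \<bullet> v)) (at y)"
proof (cases "S = {}")
  case False
  then obtain y0 where y0: "y0 \<in> S" by auto
  let ?D = "\<lambda>y. fderiv a y"
  define p where "p y t = y0 + t *\<^sub>R (y - y0)" for y and t :: real
  have pS: "p y t \<in> S" if "y \<in> S" "t \<in> cbox 0 1" for y t
  proof -
    have "p y t = (1 - t) *\<^sub>R y0 + t *\<^sub>R y" by (simp add: p_def algebra_simps)
    then show ?thesis using convexD_alt[OF assms(2) y0 that(1)] that(2) by simp
  qed
  have aD: "(a has_derivative ?D y) (at y)" if "y \<in> S" for y by (rule Ck_on_SucD[OF C that])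
  \<comment> \<open>The derivative in \<open>y\<close> of the integrand
    \<open>a (p y t) \<bullet> (y - y0)\<close>, already rewritten by the symmetry of the Jacobian.
    In this form it is also the \<open>t\<close>-derivative of \<open>t *\<^sub>R a (p y t)\<close>,
    so its integral over the unit interval is \<open>a y\<close>.\<close>
  define fx where "fx y t = blinfun_inner_right (t *\<^sub>R ?D (p y t) (y - y0) + a (p y t))" for y t
  have cp: "continuous_on (S \<times> cbox 0 1) (\<lambda>(y, t). p y t)"
    unfolding p_def split_beta by (intro continuous_intros)
  have ca: "continuous_on S a" using Ck_on_Suc_imp[OF C] by simp
  have cD: "continuous_on S (\<lambda>y. ?D y b)" for b using C by simp
  have cpa: "continuous_on (S \<times> cbox 0 1) (\<lambda>z. q (p (fst z) (snd z)))" if "continuous_on S q" for q :: "'a \<Rightarrow> 'a"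
    by (rule continuous_on_compose2[OF that cp[unfolded split_beta]]) (use pS in auto)
  have cDp: "continuous_on (S \<times> cbox 0 1) (\<lambda>z. ?D (p (fst z) (snd z)) (fst z - y0))"
  proof -
    have "continuous_on (S \<times> cbox 0 1) (\<lambda>z. \<Sum>b\<in>Basis. ((fst z - y0) \<bullet> b) *\<^sub>R ?D (p (fst z) (snd z)) b)"
      by (intro continuous_intros cpa[OF cD])
    then show ?thesis
    proof (rule continuous_on_eq)
      fix z assume z: "z \<in> S \<times> cbox (0::real) 1"
      then have "linear (?D (p (fst z) (snd z)))"
        by (intro has_derivative_linear[OF aD] pS) auto
      from linear_basis_expansion[OF this, of "fst z - y0"]
      show "(\<Sum>b\<in>Basis. ((fst z - y0) \<bullet> b) *\<^sub>R ?D (p (fst z) (snd z)) b) = ?D (p (fst z) (snd z)) (fst z - y0)"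
        by simp
    qed
  qed
  have cfx: "continuous_on (S \<times> cbox 0 1) (\<lambda>(y, t). fx y t)"
    unfolding fx_def split_beta
    by (intro bounded_linear.continuous_on[OF bounded_linear_blinfun_inner_right] continuous_intros cDp cpa[OF ca])
  have dfx: "((\<lambda>y. a (p y t) \<bullet> (y - y0)) has_derivative blinfun_apply (fx y t)) (at y within S)"
    if "y \<in> S" "t \<in> cbox 0 1" for y t
  proof -
    have P: "p y t \<in> S" by (rule pS[OF that])
    have "((\<lambda>y. p y t) has_derivative (\<lambda>v. t *\<^sub>R v)) (at y)"
      unfolding p_def by (auto intro!: derivative_eq_intros)
    from diff_chain_at[OF this aD[OF P]]
    have "((\<lambda>y. a (p y t)) has_derivative (\<lambda>v. ?D (p y t) (t *\<^sub>R v))) (at y)" by (simp add: o_def)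
    then have "((\<lambda>y. a (p y t) \<bullet> (y - y0)) has_derivative
       (\<lambda>v. a (p y t) \<bullet> v + ?D (p y t) (t *\<^sub>R v) \<bullet> (y - y0))) (at y)"
      by (auto intro!: derivative_eq_intros)
    moreover have "(\<lambda>v. a (p y t) \<bullet> v + ?D (p y t) (t *\<^sub>R v) \<bullet> (y - y0)) = blinfun_apply (fx y t)"
      by (rule ext) (simp add: fx_def linear_cmul[OF has_derivative_linear[OF aD[OF P]]] sym[OF P, of _ "y - y0"] inner_left_distrib)
    ultimately show ?thesis by (simp add: has_derivative_at_withinI)
  qed
  have intg: "(\<lambda>t. a (p y t) \<bullet> (y - y0)) integrable_on cbox 0 1" if "y \<in> S" for y
  proof (rule integrable_continuous, intro continuous_intros)
    show "continuous_on (cbox 0 1) (\<lambda>t. a (p y t))"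
      by (rule continuous_on_compose2[OF ca]) (use pS[OF that] in \<open>auto simp: p_def intro!: continuous_intros\<close>)
  qed
  have val: "(fx y has_integral blinfun_inner_right (a y)) (cbox 0 1)" if "y \<in> S" for y
  proof -
    have "((\<lambda>t. blinfun_inner_right (t *\<^sub>R a (p y t))) has_vector_derivative fx y t) (at t within {0..1})"
      if "t \<in> {0..1}" for t
    proof -
      have P: "p y t \<in> S" using pS[OF \<open>y \<in> S\<close>] that by simp
      have "((\<lambda>t. p y t) has_vector_derivative (y - y0)) (at t)"
        unfolding p_def by (auto intro!: derivative_eq_intros)
      from vector_derivative_diff_chain_within[OF this has_derivative_at_withinI[OF aD[OF P]]]
      have d: "((\<lambda>t. a (p y t)) has_vector_derivative ?D (p y t) (y - y0)) (at t)" by (simp add: o_def)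
      have "((\<lambda>t. t *\<^sub>R a (p y t)) has_vector_derivative (t *\<^sub>R ?D (p y t) (y - y0) + a (p y t))) (at t)"
        using has_vector_derivative_scaleR[OF DERIV_ident d] by simp
      from bounded_linear.has_vector_derivative[OF bounded_linear_blinfun_inner_right this]
      show ?thesis unfolding fx_def by (rule has_vector_derivative_at_within)
    qed
    from fundamental_theorem_of_calculus[OF _ this]
    have "(fx y has_integral (blinfun_inner_right (1 *\<^sub>R a (p y 1)) - blinfun_inner_right (0 *\<^sub>R a (p y 0)))) {0..1}" by simp
    moreover have "blinfun_inner_right (0::'a) = 0" by (rule blinfun_eqI) simp
    ultimately show ?thesis by (simp add: p_def)
  qed
  have "((\<lambda>y. integral (cbox 0 1) (\<lambda>t. a (p y t) \<bullet> (y - y0))) has_derivative (\<lambda>v. a y \<bullet> v)) (at y)"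
    if "y \<in> S" for y
  proof -
    have "((\<lambda>y. integral (cbox 0 1) (\<lambda>t. a (p y t) \<bullet> (y - y0))) has_derivative
        blinfun_apply (integral (cbox 0 1) (fx y))) (at y within S)"
      by (rule leibniz_rule[OF dfx intg cfx that assms(2)])
    then show ?thesis
      using at_within_open[OF that assms(1)] integral_unique[OF val[OF that]] by simp
  qed
  then show ?thesis by blast
qed simp

lemma det_matrix_nonzero:
  fixes L :: "real^'n \<Rightarrow> real^'n"
  assumes "linear L" "\<And>v. L v = 0 \<Longrightarrow> v = 0"
  shows "det (matrix L) \<noteq> 0"
  using assms det_nz_iff_inj linear_injective_0 by blast

lemma smooth_on_linear_solve':
  fixes M :: "'a::real_normed_vector \<Rightarrow> real^'n \<Rightarrow> real^'n"
  assumes "open S" "\<And>v. smooth_on S (\<lambda>x. M x v)" "smooth_on S b"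
    "\<And>x. x \<in> S \<Longrightarrow> linear (M x)" "\<And>x v. x \<in> S \<Longrightarrow> M x v = 0 \<Longrightarrow> v = 0" "\<And>x. x \<in> S \<Longrightarrow> M x (\<xi> x) = b x"
  shows "smooth_on S \<xi>"
proof (rule smooth_on_linear_solve[where M="\<lambda>x. matrix (M x)", OF assms(1) _ assms(3)])
  show "smooth_on S (\<lambda>x. matrix (M x) $ i $ j)" for i j
    by (simp add: matrix_def smooth_on_vec_nth assms(1,2))
  show "det (matrix (M x)) \<noteq> 0" if "x \<in> S" for x
    by (rule det_matrix_nonzero[OF assms(4)[OF that] assms(5)[OF that]])
  show "matrix (M x) *v \<xi> x = b x" if "x \<in> S" for x
    using matrix_works[of "M x"] assms(4,6)[OF that] by (simp add: matrix_vector_mul_linear)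
qed

text \<open>The inverse function theorem supplies a differentiable inverse; its smoothness is
  bootstrapped from the linear equation satisfied by its derivative.\<close>

lemma smooth_local_inverse:
  fixes f :: "real^'n \<Rightarrow> real^'n"
  assumes "open S" "smooth_on S f" "x0 \<in> S"
    and inj: "\<And>x v. x \<in> S \<Longrightarrow> fderiv f x v = 0 \<Longrightarrow> v = 0"
  obtains U V g where "open U" "connected U" "U \<subseteq> S" "x0 \<in> U" "open V" "homeomorphism U V f g" "smooth_on V g"
proof -
  let ?D = "\<lambda>x. fderiv f x"
  have fD: "(f has_derivative ?D x) (at x)" if "x \<in> S" for x
    by (rule smooth_on_has_derivative[OF assms(2) that])
  have bl: "blinfun_apply (Blinfun (?D x)) = ?D x" if "x \<in> S" for x
    using bounded_linear_Blinfun_apply has_derivative_bounded_linear[OF fD[OF that]] by blast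
  have cont: "continuous_on S (\<lambda>x. Blinfun (?D x))"
  proof (rule continuous_on_blinfun_componentwise)
    fix i :: "real^'n" assume "i \<in> Basis"
    have "continuous_on S (\<lambda>x. ?D x i)"
      using smooth_on_frechet[OF assms(2), of i] unfolding smooth_on_def by (metis Ck_on.simps(1))
    then show "continuous_on S (\<lambda>x. blinfun_apply (Blinfun (?D x)) i)"
      by (rule continuous_on_eq) (simp add: bl)
  qed
  have linD: "linear (?D x)" if "x \<in> S" for x using has_derivative_linear[OF fD[OF that]] .
  have injD: "Real_Vector_Spaces.linear (?D x) \<and> inj (?D x)" if "x \<in> S" for x
    using linD[OF that] inj[OF that] linear_injective_0 by blast
  obtain h where h: "linear h" "\<And>v. h (?D x0 v) = v"
    using linear_injective_left_inverse[of "?D x0"] injD[OF assms(3)] by (metis comp_apply id_apply)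
  have inv: "Blinfun h o\<^sub>L Blinfun (?D x0) = id_blinfun"
    by (rule blinfun_eqI) (simp add: bl[OF assms(3)] h bounded_linear_Blinfun_apply linear_conv_bounded_linear[symmetric])
  have fB: "(f has_derivative blinfun_apply (Blinfun (?D x))) (at x)" if "x \<in> S" for x
    using fD[OF that] bl[OF that] by simp
  obtain U' V g g' where U': "open U'" "U' \<subseteq> S" "x0 \<in> U'" "open V" "f x0 \<in> V"
    and hom: "homeomorphism U' V f g"
    and gd: "\<And>y. y \<in> V \<Longrightarrow> (g has_derivative (g' y)) (at y)"
    and g'eq: "\<And>y. y \<in> V \<Longrightarrow> g' y = inv (blinfun_apply (Blinfun (?D (g y))))"
    and "\<And>y. y \<in> V \<Longrightarrow> bij (blinfun_apply (Blinfun (?D (g y))))"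
    by (rule inverse_function_theorem[OF assms(1) fB cont assms(3) inv]) (assumption, rule that)
  \<comment> \<open>Shrinking the image to a ball makes the domain connected, as required of an
    affine chart.\<close>
  obtain r where r: "r > 0" "ball (f x0) r \<subseteq> V" using U'(4,5) openE by blast
  define W where "W = ball (f x0) r"
  define U where "U = g ` W"
  have WV: "W \<subseteq> V" using r by (simp add: W_def)
  have homU: "homeomorphism U W f g"
  proof (rule homeomorphism_of_subsets[OF hom])
    show "U \<subseteq> U'" "f ` U = W" using hom WV unfolding U_def homeomorphism_def by force+
  qed (rule WV)
  have gS: "g y \<in> S" if "y \<in> V" for y using hom U'(2) that unfolding homeomorphism_def by auto
  have Ueq: "U = {x \<in> U'. f x \<in> W}"
    using hom WV unfolding U_def homeomorphism_def by force
  have openU: "open U"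
  proof -
    have "continuous_on U' f" using hom unfolding homeomorphism_def by simp
    from continuous_open_preimage[OF this U'(1), of W]
    have "open (U' \<inter> f -` W)" by (simp add: W_def)
    moreover have "U' \<inter> f -` W = U" using Ueq by auto
    ultimately show ?thesis by simp
  qed
  have connU: "connected U"
    unfolding U_def by (rule connected_continuous_image)
      (use homU in \<open>auto simp: homeomorphism_def W_def\<close>)
  have W: "open W" by (simp add: W_def)
  have Dg: "?D (g y) (g' y v) = v" if "y \<in> W" for y v
  proof -
    have "g y \<in> S" using gS WV that by auto
    then have "surj (?D (g y))" using injD linear_injective_imp_surjective by blast
    then show ?thesis using g'eq[of y] that WV bl[OF \<open>g y \<in> S\<close>] surj_f_inv_f[of "?D (g y)" v] by auto
  qed
  \<comment> \<open>The derivative \<open>g' y\<close> solves a linear system with matrix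
    \<open>?D (g y)\<close>. If \<open>g\<close> is of class \<open>k\<close>, so is this matrix,
    hence so is \<open>g'\<close>, and \<open>g\<close> is of class \<open>Suc k\<close>.\<close>
  have "Ck_on k W g" for k
  proof (induction k)
    case 0
    then show ?case using homU by (simp add: homeomorphism_def)
  next
    case (Suc k)
    show ?case
    proof (rule Ck_on_SucI[OF W])
      show "(g has_derivative (g' y)) (at y)" if "y \<in> W" for y using gd WV that by auto
      have *: "Ck_on k W (\<lambda>y. ?D (g y) w)" for w
        by (rule Ck_on_compose[OF W assms(1) _ _ Suc.IH])
           (use gS WV smooth_on_frechet[OF assms(2)] in \<open>auto simp: smooth_on_def\<close>)
      show "Ck_on k W (\<lambda>y. g' y v)" for v
      proof (rule Ck_on_linear_solve[where M="\<lambda>y. matrix (?D (g y))" and b="\<lambda>_. v", OF W])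
        show "Ck_on k W (\<lambda>y. matrix (?D (g y)) $ i $ j)" for i j
          unfolding matrix_def by (simp add: Ck_on_vec_nth[OF W *])
        show "Ck_on k W (\<lambda>_. v $ i)" for i by (rule Ck_on_const[OF W])
        fix y assume "y \<in> W"
        then have y: "g y \<in> S" using gS WV by auto
        show "det (matrix (?D (g y))) \<noteq> 0" by (rule det_matrix_nonzero[OF linD[OF y] inj[OF y]])
        show "matrix (?D (g y)) *v g' y v = v"
          using matrix_works[of "?D (g y)" "g' y v"] linD[OF y] Dg[OF \<open>y \<in> W\<close>] by (simp add: matrix_vector_mul_linear)
      qed
    qed
  qed
  then have "smooth_on W g" by (simp add: smooth_on_def)
  moreover have "x0 \<in> U" using Ueq U'(3) r(1) by (simp add: W_def)
  moreover have "U \<subseteq> S" using Ueq U'(2) by auto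
  ultimately show thesis using that openU connU W homU by blast
qed

section \<open>Charts and left translations\<close>

lemma has_derivative_slice2:
  assumes "(F has_derivative F') (at (a, b))"
  shows "((\<lambda>z. F (a, z)) has_derivative (\<lambda>v. F' (0, v))) (at b)"
proof -
  have "((\<lambda>z. (a, z)) has_derivative (\<lambda>v. (0, v))) (at b)"
    by (auto intro!: derivative_eq_intros)
  from diff_chain_at[OF this] assms show ?thesis by (simp add: o_def)
qed

lemma has_derivative_slice1:
  assumes "(F has_derivative F') (at (a, b))"
  shows "((\<lambda>z. F (z, b)) has_derivative (\<lambda>v. F' (v, 0))) (at a)"
proof -
  have "((\<lambda>z. (z, b)) has_derivative (\<lambda>v. (v, 0))) (at a)"
    by (auto intro!: derivative_eq_intros)
  from diff_chain_at[OF this] assms show ?thesis by (simp add: o_def)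
qed

lemma is_chartD:
  assumes "is_chart c"
  shows "open (fst c)" "open (snd c ` fst c)"
    "continuous_on (fst c) (snd c)" "continuous_on (snd c ` fst c) (chart_inv c)"
    "\<And>p. p \<in> fst c \<Longrightarrow> chart_inv c (snd c p) = p"
    "\<And>y. y \<in> snd c ` fst c \<Longrightarrow> snd c (chart_inv c y) = y"
    "\<And>y. y \<in> snd c ` fst c \<Longrightarrow> chart_inv c y \<in> fst c"
  using assms unfolding is_chart_def homeomorphism_def by auto

lemma chart_image_open:
  assumes "is_chart c" "open U" "U \<subseteq> fst c"
  shows "open (snd c ` U)"
proof -
  have "open (snd c ` fst c \<inter> chart_inv c -` U)"
    using is_chartD(2,4)[OF assms(1)] assms(2) by (intro continuous_open_preimage)
  moreover have "snd c ` fst c \<inter> chart_inv c -` U = snd c ` U"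
    using is_chartD(5,6,7)[OF assms(1)] assms(3) by force
  ultimately show ?thesis by simp
qed

context lie_group
begin

abbreviation c0 where "c0 \<equiv> chart_at A e"
abbreviation z0 where "z0 \<equiv> snd c0 e"

lemma chart_at: "chart_at A p \<in> A" "p \<in> fst (chart_at A p)"
proof -
  have "p \<in> (\<Union>c\<in>A. fst c)" using smooth_atlas unfolding smooth_atlas_def by simp
  then have "\<exists>c. c \<in> A \<and> p \<in> fst c" by blast
  from someI_ex[OF this] show "chart_at A p \<in> A" "p \<in> fst (chart_at A p)" unfolding chart_at_def by auto
qed

lemma atlas_chart: "c \<in> A \<Longrightarrow> is_chart c"
  using smooth_atlas unfolding smooth_atlas_def by auto

lemma atlas_smooth_chart: "c \<in> A \<Longrightarrow> smooth_chart A c"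
  using smooth_atlas unfolding smooth_atlas_def smooth_chart_def by auto

lemmas chart_at_smooth = atlas_smooth_chart[OF chart_at(1)]
lemmas chart_atD = is_chartD[OF atlas_chart[OF chart_at(1)[of g]]] for g

lemma smooth_chart_chart: "smooth_chart A c \<Longrightarrow> is_chart c"
  unfolding smooth_chart_def by auto

lemma z0_in: "z0 \<in> snd c0 ` fst c0" using chart_at by auto

lemmas c0_chart = atlas_chart[OF chart_at(1)[of e]]

lemma c0_inv_z0 [simp]: "chart_inv c0 z0 = e"
  by (rule is_chartD(5)[OF c0_chart chart_at(2)])

lemma transition_smooth:
  assumes "smooth_chart A c" "d \<in> A"
  shows "open (snd d ` (fst c \<inter> fst d))" "smooth_on (snd d ` (fst c \<inter> fst d)) (\<lambda>y. snd c (chart_inv d y))"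
    "open (snd c ` (fst c \<inter> fst d))" "smooth_on (snd c ` (fst c \<inter> fst d)) (\<lambda>y. snd d (chart_inv c y))"
proof -
  have o: "is_chart c" "is_chart d" "open (fst c \<inter> fst d)"
    using assms atlas_chart[of d] smooth_chart_chart is_chartD(1) by (blast intro: open_Int)+
  show "open (snd d ` (fst c \<inter> fst d))" "open (snd c ` (fst c \<inter> fst d))"
    using o by (auto intro: chart_image_open)
  show "smooth_on (snd d ` (fst c \<inter> fst d)) (\<lambda>y. snd c (chart_inv d y))"
    "smooth_on (snd c ` (fst c \<inter> fst d)) (\<lambda>y. snd d (chart_inv c y))"
    using assms unfolding smooth_chart_def smooth_compat_def by (auto simp: o_def)
qed

lemma continuous_mul:
  assumes "continuous_on S f" "continuous_on S g"
  shows "continuous_on S (\<lambda>x. mul (f x) (g x))"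
proof -
  have "continuous_on UNIV (\<lambda>(g, h). mul g h)" using smooth_mult unfolding smooth_map_def by simp
  from continuous_on_compose2[OF this continuous_on_Pair[OF assms]] show ?thesis by simp
qed

lemma continuous_iv: "continuous_on UNIV iv"
  using smooth_iv unfolding smooth_map_def by simp

section \<open>The group multiplication in charts\<close>

definition mulc where
  "mulc c d k w = snd k (mul (chart_inv c (fst w)) (chart_inv d (snd w)))"

definition muldom where
  "muldom c d k = {w \<in> (snd c ` fst c) \<times> (snd d ` fst d). mul (chart_inv c (fst w)) (chart_inv d (snd w)) \<in> fst k}"

lemma mulc_smooth:
  assumes c: "c \<in> A" and d: "d \<in> A" and k: "k \<in> A"
  shows "open (muldom c d k)" "smooth_on (muldom c d k) (mulc c d k)"
proof -
  note C = is_chartD[OF atlas_chart[OF c]]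
  note D = is_chartD[OF atlas_chart[OF d]]
  note K = is_chartD[OF atlas_chart[OF k]]
  have cont: "continuous_on ((snd c ` fst c) \<times> (snd d ` fst d)) (\<lambda>w. mul (chart_inv c (fst w)) (chart_inv d (snd w)))"
  proof (rule continuous_mul)
    show "continuous_on ((snd c ` fst c) \<times> (snd d ` fst d)) (\<lambda>w. chart_inv c (fst w))"
      by (rule continuous_on_compose2[OF C(4) continuous_on_fst[OF continuous_on_id]]) auto
    show "continuous_on ((snd c ` fst c) \<times> (snd d ` fst d)) (\<lambda>w. chart_inv d (snd w))"
      by (rule continuous_on_compose2[OF D(4) continuous_on_snd[OF continuous_on_id]]) auto
  qed
  have "open (((snd c ` fst c) \<times> (snd d ` fst d)) \<inter> (\<lambda>w. mul (chart_inv c (fst w)) (chart_inv d (snd w))) -` fst k)"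
    by (intro continuous_open_preimage[OF cont] open_Times C(2) D(2) K(1))
  then show op: "open (muldom c d k)"
    by (rule back_subst[where P="open"]) (auto simp: muldom_def)
  let ?P = "(fst c \<times> fst d, map_prod (snd c) (snd d))"
  have P: "?P \<in> prod_atlas A A" unfolding prod_atlas_def using c d by force
  have inj: "inj_on (map_prod (snd c) (snd d)) (fst c \<times> fst d)"
    by (rule inj_on_inverseI[of _ "map_prod (chart_inv c) (chart_inv d)"]) (use C(5) D(5) in auto)
  \<comment> \<open>\<open>chart_inv\<close> is an \<open>inv_into\<close>, so the inverse of a
    product chart is a product only on the image, where injectivity determines it.\<close>
  have ci: "chart_inv ?P w = (chart_inv c (fst w), chart_inv d (snd w))" if "w \<in> (snd c ` fst c) \<times> (snd d ` fst d)" for w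
    unfolding chart_inv_def[of ?P] fst_conv snd_conv
    by (rule inv_into_f_eq[OF inj]) (use that C(6,7) D(6,7) in auto)
  have set: "snd ?P ` (fst ?P \<inter> (\<lambda>(g, h). mul g h) -` fst k) = muldom c d k"
  proof (rule set_eqI, rule iffI)
    fix w assume "w \<in> muldom c d k"
    then show "w \<in> snd ?P ` (fst ?P \<inter> (\<lambda>(g, h). mul g h) -` fst k)"
      unfolding muldom_def
      by (intro image_eqI[of _ _ "(chart_inv c (fst w), chart_inv d (snd w))"]) (use C(6,7) D(6,7) in auto)
  qed (use C(5) D(5) in \<open>auto simp: muldom_def\<close>)
  have "smooth_on (muldom c d k) (snd k \<circ> (\<lambda>(g, h). mul g h) \<circ> chart_inv ?P)"
    using smooth_mult P k set unfolding smooth_map_def by metis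
  then show "smooth_on (muldom c d k) (mulc c d k)"
    by (rule smooth_on_cong[OF op, rotated]) (use ci in \<open>auto simp: muldom_def mulc_def\<close>)
qed

section \<open>Left translated charts and derivatives along left invariant fields\<close>

definition lt where "lt p z = mul p (chart_inv c0 z)"

lemma lt_z0 [simp]: "lt p z0 = p" by (simp add: lt_def)

lemma open_lt:
  assumes "open U"
  shows "open {z \<in> snd c0 ` fst c0. lt p z \<in> U}"
proof -
  have "continuous_on (snd c0 ` fst c0) (lt p)"
    unfolding lt_def by (intro continuous_mul continuous_on_const is_chartD(4)[OF c0_chart])
  from continuous_open_preimage[OF this is_chartD(2)[OF c0_chart] assms]
  show ?thesis by (rule back_subst[where P="open"]) auto
qed

text \<open>\<open>hld f p f'\<close>: the map \<open>f\<close> has at \<open>p\<close> the derivative \<open>v \<mapsto> f' v\<close> along the left invariant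
  fields \<open>v\<^sup>+\<close>; all differentiation on the group is reduced to the chart around the neutral element.\<close>

definition hld where "hld f p f' \<longleftrightarrow> ((\<lambda>z. f (lt p z)) has_derivative f') (at z0)"
definition ld where "ld f p = fderiv (\<lambda>z. f (lt p z)) z0"

lemma hld_ld: "hld f p f' \<Longrightarrow> ld f p = f'"
  unfolding hld_def ld_def by (rule frechet_derivativeI)

lemma hld_cong:
  assumes "open U" "p \<in> U" "\<And>q. q \<in> U \<Longrightarrow> f q = g q" "hld f p f'"
  shows "hld g p f'"
  using assms(4) unfolding hld_def
  by (rule has_derivative_cong_open[OF _ open_lt[OF assms(1), of p]]) (use assms z0_in in auto)

text \<open>Smoothness of the multiplication is given in charts of \<open>A\<close>, whereas
  \<open>c\<close> may be any chart of the maximal atlas; hence the detour through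
  \<open>chart_at A p\<close> and a transition map.\<close>

lemma smooth_lt:
  assumes c: "smooth_chart A c" and p: "p \<in> fst c"
  shows "\<exists>S. open S \<and> z0 \<in> S \<and> S \<subseteq> snd c0 ` fst c0 \<and> (\<forall>z\<in>S. lt p z \<in> fst c) \<and>
    smooth_on S (\<lambda>z. snd c (lt p z))"
proof -
  let ?k = "chart_at A p"
  note K = chart_atD[where g=p]
  define S where "S = {z \<in> snd c0 ` fst c0. lt p z \<in> fst c \<inter> fst ?k}"
  have S: "open S" unfolding S_def by (intro open_lt open_Int K(1) is_chartD(1)[OF smooth_chart_chart[OF c]])
  have z: "z0 \<in> S" using z0_in p chart_at by (auto simp: S_def)
  have "smooth_on S (\<lambda>z. mulc ?k c0 ?k (snd ?k p, z))"
  proof (rule smooth_on_compose[OF S mulc_smooth(1) _ mulc_smooth(2)])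
    show "(\<lambda>z. (snd ?k p, z)) ` S \<subseteq> muldom ?k c0 ?k"
      using K(5)[OF chart_at(2)] chart_at(2)[of p] by (auto simp: S_def muldom_def lt_def)
  qed (auto simp: chart_at intro!: smooth_on_Pair smooth_on_const smooth_on_ident S)
  then have k: "smooth_on S (\<lambda>z. snd ?k (lt p z))"
    by (simp add: mulc_def K(5)[OF chart_at(2)] lt_def)
  have "smooth_on S (\<lambda>z. snd c (chart_inv ?k (snd ?k (lt p z))))"
    by (rule smooth_on_compose[OF S transition_smooth(1)[OF c chart_at(1)] _ transition_smooth(2)[OF c chart_at(1)] k])
       (auto simp: S_def)
  then have "smooth_on S (\<lambda>z. snd c (lt p z))"
    by (rule smooth_on_cong[OF S, rotated]) (auto simp: S_def K(5))
  moreover have "S \<subseteq> snd c0 ` fst c0" "\<forall>z\<in>S. lt p z \<in> fst c" by (auto simp: S_def)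
  ultimately show ?thesis using S z by blast
qed

lemma hld_chart:
  assumes "smooth_chart A c" "p \<in> fst c"
  shows "hld (snd c) p (ld (snd c) p)"
proof -
  obtain S where "z0 \<in> S" "smooth_on S (\<lambda>z. snd c (lt p z))"
    using smooth_lt[OF assms] by blast
  from smooth_on_has_derivative[OF this(2,1)] show ?thesis unfolding hld_def ld_def .
qed

lemma hld_from_chart:
  assumes c: "smooth_chart A c" and p: "p \<in> fst c"
    and f: "((\<lambda>y. f (chart_inv c y)) has_derivative f') (at (snd c p))"
  shows "hld f p (\<lambda>v. f' (ld (snd c) p v))"
proof -
  note C = is_chartD[OF smooth_chart_chart[OF c]]
  have "((\<lambda>z. f (chart_inv c (snd c (lt p z)))) has_derivative (\<lambda>v. f' (ld (snd c) p v))) (at z0)"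
    using diff_chain_at[OF hld_chart[OF c p, unfolded hld_def]] f by (simp add: o_def)
  then have "hld (\<lambda>q. f (chart_inv c (snd c q))) p (\<lambda>v. f' (ld (snd c) p v))" by (simp add: hld_def)
  then show ?thesis by (rule hld_cong[OF C(1) p, rotated]) (simp add: C)
qed

text \<open>The inverse of the differential of the chart \<open>c\<close> at \<open>p\<close>, in the left trivialization.\<close>

definition lcoord where
  "lcoord c p = fderiv (\<lambda>y. snd c0 (mul (iv p) (chart_inv c y))) (snd c p)"

lemma lcoord_has_derivative:
  assumes c: "smooth_chart A c" and p: "p \<in> fst c"
  shows "((\<lambda>y. snd c0 (mul (iv p) (chart_inv c y))) has_derivative lcoord c p) (at (snd c p))"
proof -
  let ?k = "chart_at A p" and ?d = "chart_at A (iv p)"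
  note K = chart_atD[where g=p]
  note D = chart_atD[where g="iv p"]
  note C = is_chartD[OF smooth_chart_chart[OF c]]
  let ?S = "snd c ` (fst c \<inter> fst ?k)"
  have pin: "snd c p \<in> ?S" using p chart_at by auto
  have tr: "((\<lambda>y. snd ?k (chart_inv c y)) has_derivative fderiv (\<lambda>y. snd ?k (chart_inv c y)) (snd c p)) (at (snd c p))"
    by (rule smooth_on_has_derivative[OF transition_smooth(4)[OF c chart_at(1)] pin])
  have "(snd ?d (iv p), snd ?k p) \<in> muldom ?d ?k c0"
    using chart_at K(5) D(5) by (auto simp: muldom_def)
  from smooth_on_has_derivative[OF mulc_smooth(2)[OF chart_at(1) chart_at(1) chart_at(1)] this, THEN has_derivative_slice2]
  have "((\<lambda>z. mulc ?d ?k c0 (snd ?d (iv p), z)) has_derivative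
      (\<lambda>v. fderiv (mulc ?d ?k c0) (snd ?d (iv p), snd ?k p) (0, v))) (at (snd ?k p))" .
  moreover have "snd ?k (chart_inv c (snd c p)) = snd ?k p" using C(5)[OF p] by simp
  ultimately have "((\<lambda>y. mulc ?d ?k c0 (snd ?d (iv p), snd ?k (chart_inv c y))) has_derivative
      (\<lambda>v. fderiv (mulc ?d ?k c0) (snd ?d (iv p), snd ?k p) (0, fderiv (\<lambda>y. snd ?k (chart_inv c y)) (snd c p) v))) (at (snd c p))"
    using diff_chain_at[OF tr, of "\<lambda>z. mulc ?d ?k c0 (snd ?d (iv p), z)"] by (simp add: o_def)
  then have "((\<lambda>y. snd c0 (mul (iv p) (chart_inv c y))) has_derivative
      (\<lambda>v. fderiv (mulc ?d ?k c0) (snd ?d (iv p), snd ?k p) (0, fderiv (\<lambda>y. snd ?k (chart_inv c y)) (snd c p) v))) (at (snd c p))"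
    by (rule has_derivative_cong_open[OF _ transition_smooth(3)[OF c chart_at(1)] pin])
       (auto simp: mulc_def D(5)[OF chart_at(2)] K(5) C(5))
  then show ?thesis unfolding lcoord_def by (metis frechet_derivativeI)
qed

text \<open>Near \<open>p\<close> the parametrization \<open>lt p\<close> is inverted by
  \<open>q \<mapsto> snd c0 (mul (iv p) q)\<close>, so the chain rule leads back from the left
  trivialization to any smooth chart.\<close>

lemma chart_from_hld:
  assumes c: "smooth_chart A c" and p: "p \<in> fst c" and f: "hld f p f'"
  shows "((\<lambda>y. f (chart_inv c y)) has_derivative (\<lambda>v. f' (lcoord c p v))) (at (snd c p))"
proof -
  note C = is_chartD[OF smooth_chart_chart[OF c]]
  let ?S = "snd c ` fst c \<inter> (\<lambda>y. mul (iv p) (chart_inv c y)) -` fst c0"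
  have S: "open ?S"
    by (intro continuous_open_preimage continuous_mul continuous_on_const C(2,4) is_chartD(1)[OF c0_chart])
  have pS: "snd c p \<in> ?S" using p chart_at(2)[of e] by (simp add: C(5)[OF p])
  have "snd c0 (mul (iv p) (chart_inv c (snd c p))) = z0" by (simp add: C(5)[OF p])
  then have "((\<lambda>y. f (lt p (snd c0 (mul (iv p) (chart_inv c y))))) has_derivative (\<lambda>v. f' (lcoord c p v))) (at (snd c p))"
    using diff_chain_at[OF lcoord_has_derivative[OF c p], of "\<lambda>z. f (lt p z)" f'] f by (simp add: o_def hld_def)
  then show ?thesis
  proof (rule has_derivative_cong_open[OF _ S pS])
    fix y assume "y \<in> ?S"
    then show "f (lt p (snd c0 (mul (iv p) (chart_inv c y)))) = f (chart_inv c y)"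
      using is_chartD(5)[OF c0_chart, of "mul (iv p) (chart_inv c y)"] by (simp add: lt_def assoc[symmetric])
  qed
qed

lemma ld_lcoord:
  assumes c: "smooth_chart A c" and p: "p \<in> fst c"
  shows "ld (snd c) p (lcoord c p v) = v"
proof -
  note C = is_chartD[OF smooth_chart_chart[OF c]]
  have "((\<lambda>y. snd c (chart_inv c y)) has_derivative (\<lambda>v. ld (snd c) p (lcoord c p v))) (at (snd c p))"
    by (rule chart_from_hld[OF c p hld_chart[OF c p]])
  moreover have "((\<lambda>y. snd c (chart_inv c y)) has_derivative (\<lambda>v. v)) (at (snd c p))"
    by (rule has_derivative_cong_open[OF has_derivative_ident C(2)]) (use p C in auto)
  ultimately show ?thesis by (metis has_derivative_unique)
qed

lemma lcoord_ld:
  assumes c: "smooth_chart A c" and p: "p \<in> fst c"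
  shows "lcoord c p (ld (snd c) p v) = v"
proof -
  have "hld (\<lambda>q. snd c0 (mul (iv p) q)) p (\<lambda>v. lcoord c p (ld (snd c) p v))"
    by (rule hld_from_chart[OF c p lcoord_has_derivative[OF c p]])
  moreover have "hld (\<lambda>q. snd c0 (mul (iv p) q)) p (\<lambda>v. v)"
    unfolding hld_def
    by (rule has_derivative_cong_open[OF has_derivative_ident is_chartD(2)[OF c0_chart] z0_in])
       (simp add: lt_def assoc[symmetric] is_chartD(6)[OF c0_chart])
  ultimately show ?thesis unfolding hld_def by (metis has_derivative_unique)
qed

lemma linear_ld: "hld f p f' \<Longrightarrow> linear (ld f p)"
  using has_derivative_linear hld_ld unfolding hld_def by blast

lemma linear_lcoord: "smooth_chart A c \<Longrightarrow> p \<in> fst c \<Longrightarrow> linear (lcoord c p)"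
  using has_derivative_linear lcoord_has_derivative by blast

section \<open>Left invariant fields as a global frame\<close>

abbreviation lf where "lf \<equiv> left_field mul e A"

lemma lf_eq: "lf v p = ld (snd (chart_at A p)) p v"
  by (simp add: left_field_def tmap_def dfun_def ld_def lt_def o_def)

text \<open>The bridge between the differential of the definitions, which depends on the chosen
  charts, and the derivative in the left trivialization, which does not.\<close>

lemma dfun_lf:
  assumes "hld f p f'"
  shows "dfun A f p (lf v p) = f' v"
proof -
  let ?c = "chart_at A p"
  have c: "smooth_chart A ?c" "p \<in> fst ?c" using atlas_smooth_chart chart_at by auto
  have "dfun A f p = (\<lambda>v. f' (lcoord ?c p v))"
    unfolding dfun_def o_def by (rule frechet_derivativeI[OF chart_from_hld[OF c assms]])
  then show ?thesis by (simp add: lf_eq lcoord_ld[OF c])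
qed

lemma dfun_bounded_linear:
  assumes "hld f p f'"
  shows "bounded_linear (dfun A f p)"
proof -
  let ?c = "chart_at A p"
  have c: "smooth_chart A ?c" "p \<in> fst ?c" using atlas_smooth_chart chart_at by auto
  show ?thesis
    unfolding dfun_def o_def
    using has_derivative_bounded_linear[OF chart_from_hld[OF c assms]] frechet_derivativeI[OF chart_from_hld[OF c assms]] by simp
qed

lemma linear_lf: "linear (\<lambda>v. lf v p)"
  using linear_ld[OF hld_chart[OF chart_at_smooth chart_at(2)]] by (simp add: lf_eq)

text \<open>The coefficients of a tangent vector at \<open>p\<close> in the left invariant frame,
  that is, the inverse of \<open>\<lambda>v. lf v p\<close>.\<close>

definition lco where "lco p x = lcoord (chart_at A p) p x"

lemma lf_lco [simp]: "lf (lco p x) p = x" and lco_lf [simp]: "lco p (lf v p) = v"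
  unfolding lf_eq lco_def
  using ld_lcoord[OF chart_at_smooth chart_at(2)] lcoord_ld[OF chart_at_smooth chart_at(2)]
  by auto

lemma coord_vec_eq:
  assumes "smooth_chart A c" "p \<in> fst c"
  shows "coord_vec A c p v = lf (lcoord c p v) p"
  using frechet_derivativeI[OF chart_from_hld[OF assms hld_chart[OF chart_at_smooth chart_at(2)]]]
  unfolding coord_vec_def lf_eq by (simp add: o_def)

lemma local_rep_lf:
  assumes "smooth_chart A c" "y \<in> snd c ` fst c"
  shows "local_rep A c (lf v) y = ld (snd c) (chart_inv c y) v"
  unfolding local_rep_def
  by (rule dfun_lf[OF hld_chart[OF assms(1) is_chartD(7)[OF smooth_chart_chart[OF assms(1)] assms(2)]]])

text \<open>Writes the differential of left translation as a partial derivative of one map in both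
  variables, so that smooth dependence on the base point becomes visible.\<close>

lemma ld_mulc:
  assumes c: "c \<in> A" and y: "y \<in> snd c ` fst c"
  shows "(y, z0) \<in> muldom c c0 c" "ld (snd c) (chart_inv c y) v = fderiv (mulc c c0 c) (y, z0) (0, v)"
proof -
  note C = is_chartD[OF atlas_chart[OF c]]
  show m: "(y, z0) \<in> muldom c c0 c" using y z0_in C(7)[OF y] by (simp add: muldom_def)
  from smooth_on_has_derivative[OF mulc_smooth(2)[OF c chart_at(1) c] this, THEN has_derivative_slice2]
  have "hld (snd c) (chart_inv c y) (\<lambda>v. fderiv (mulc c c0 c) (y, z0) (0, v))"
    by (simp add: hld_def mulc_def lt_def)
  from hld_ld[OF this] show "ld (snd c) (chart_inv c y) v = fderiv (mulc c c0 c) (y, z0) (0, v)" by simp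
qed

lemma ld_chart_smooth:
  assumes c: "c \<in> A"
  shows "smooth_on (snd c ` fst c) (\<lambda>y. ld (snd c) (chart_inv c y) v)"
proof -
  note C = is_chartD[OF atlas_chart[OF c]]
  have "smooth_on (snd c ` fst c) (\<lambda>y. fderiv (mulc c c0 c) (y, z0) (0, v))"
    by (rule smooth_on_compose[OF C(2) mulc_smooth(1)[OF c chart_at(1) c] _ smooth_on_frechet[OF mulc_smooth(2)[OF c chart_at(1) c]]])
       (auto simp: ld_mulc(1)[OF c] intro!: smooth_on_Pair smooth_on_const smooth_on_ident C(2))
  then show ?thesis by (rule smooth_on_cong[OF C(2), rotated]) (simp add: ld_mulc(2)[OF c])
qed

lemma lf_smooth: "smooth_vector_field A (lf v)"
  unfolding smooth_vector_field_def
proof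
  fix c assume c: "c \<in> A"
  show "smooth_on (snd c ` fst c) (local_rep A c (lf v))"
    by (rule smooth_on_cong[OF is_chartD(2)[OF atlas_chart[OF c]] _ ld_chart_smooth[OF c]])
       (simp add: local_rep_lf[OF atlas_smooth_chart[OF c]])
qed

lemma smooth_fun_hld:
  assumes "smooth_fun A f"
  shows "hld f p (ld f p)"
proof -
  let ?c = "chart_at A p"
  have "hld f p (\<lambda>v. fderiv (f \<circ> chart_inv ?c) (snd ?c p) (ld (snd ?c) p v))"
    by (rule hld_from_chart[OF chart_at_smooth chart_at(2)])
       (use smooth_on_has_derivative assms chart_at in \<open>force simp: smooth_fun_def o_def\<close>)
  then show ?thesis using hld_ld by metis
qed

text \<open>Left frame coefficients solve a linear system whose matrix is smooth and invertible; all
  smoothness of such coefficients is deduced in this way.\<close>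

lemma smooth_on_ld_solve:
  assumes c: "c \<in> A" and b: "smooth_on (snd c ` fst c) b"
    and eq: "\<And>y. y \<in> snd c ` fst c \<Longrightarrow> ld (snd c) (chart_inv c y) (\<xi> y) = b y"
  shows "smooth_on (snd c ` fst c) \<xi>"
proof -
  note C = is_chartD[OF atlas_chart[OF c]]
  note cs = atlas_smooth_chart[OF c]
  show ?thesis
  proof (rule smooth_on_linear_solve'[OF C(2) ld_chart_smooth[OF c] b])
    fix y assume y: "y \<in> snd c ` fst c"
    show "linear (ld (snd c) (chart_inv c y))" by (rule linear_ld[OF hld_chart[OF cs C(7)[OF y]]])
    show "v = 0" if "ld (snd c) (chart_inv c y) v = 0" for v
      using lcoord_ld[OF cs C(7)[OF y], of v] linear_0[OF linear_lcoord[OF cs C(7)[OF y]]] that by simp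
    show "ld (snd c) (chart_inv c y) (\<xi> y) = b y" by (rule eq[OF y])
  qed
qed

lemma vector_field_lco_smooth:
  assumes "smooth_vector_field A X"
  shows "smooth_fun A (\<lambda>p. lco p (X p) $ i)"
  unfolding smooth_fun_def
proof
  fix c assume c: "c \<in> A"
  note C = is_chartD[OF atlas_chart[OF c]]
  have "smooth_on (snd c ` fst c) (\<lambda>y. lco (chart_inv c y) (X (chart_inv c y)))"
  proof (rule smooth_on_ld_solve[OF c])
    show "smooth_on (snd c ` fst c) (local_rep A c X)" using assms c unfolding smooth_vector_field_def by blast
    fix y assume y: "y \<in> snd c ` fst c"
    show "ld (snd c) (chart_inv c y) (lco (chart_inv c y) (X (chart_inv c y))) = local_rep A c X y"
      using dfun_lf[OF hld_chart[OF atlas_smooth_chart[OF c] C(7)[OF y]], of "lco (chart_inv c y) (X (chart_inv c y))"]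
      by (simp add: local_rep_def)
  qed
  from smooth_on_vec_nth[OF C(2) this]
  show "smooth_on (snd c ` fst c) ((\<lambda>p. lco p (X p) $ i) \<circ> chart_inv c)" by (simp add: o_def)
qed

text \<open>The source of every integration constant below: a derivative vanishing on a chart domain
  forces constancy because affine charts have connected domains. Locally, a ball in a chart reduces
  this to the Euclidean case.\<close>

lemma constant_on_connected:
  assumes U: "open U" "connected U" and d: "\<And>p. p \<in> U \<Longrightarrow> hld f p (\<lambda>_. 0)"
    and ab: "a \<in> U" "b \<in> U"
  shows "f a = f b"
proof (rule connected_local_const[OF U(2) ab], rule ballI)
  fix p assume p: "p \<in> U"
  let ?c = "chart_at A p"
  note C = chart_atD[where g=p]
  have "open (snd ?c ` (U \<inter> fst ?c))"
    by (rule chart_image_open[OF atlas_chart[OF chart_at(1)]]) (use U C in auto)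
  moreover have "snd ?c p \<in> snd ?c ` (U \<inter> fst ?c)" using p chart_at(2) by auto
  ultimately obtain r where r: "r > 0" "ball (snd ?c p) r \<subseteq> snd ?c ` (U \<inter> fst ?c)" using openE by blast
  have der: "((\<lambda>y. f (chart_inv ?c y)) has_derivative (\<lambda>_. 0)) (at y within ball (snd ?c p) r)"
    if y: "y \<in> ball (snd ?c p) r" for y
  proof -
    obtain q where q: "q \<in> U" "q \<in> fst ?c" "y = snd ?c q" using r(2) y by blast
    show ?thesis
      using chart_from_hld[OF chart_at_smooth q(2) d[OF q(1)]] q(3)
      by (simp add: has_derivative_at_withinI)
  qed
  have loc: "f p = f q" if "q \<in> fst ?c" "snd ?c q \<in> ball (snd ?c p) r" for q
    using has_derivative_zero_unique[OF convex_ball der, of "snd ?c p" "snd ?c q"] r(1) that C(5) chart_at(2)[of p] by auto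
  have "open (fst ?c \<inter> snd ?c -` ball (snd ?c p) r)"
    by (intro continuous_open_preimage C(1,3) open_ball)
  then show "\<forall>\<^sub>F q in at p within U. f p = f q"
    unfolding eventually_at_topological
    by (intro exI[of _ "fst ?c \<inter> snd ?c -` ball (snd ?c p) r"]) (use loc r(1) chart_at(2) in auto)
qed

end

section \<open>The adjoint representation and the Lie bracket\<close>

lemma smooth_on_continuous: "smooth_on S f \<Longrightarrow> continuous_on S f"
  unfolding smooth_on_def using Ck_on.simps(1) by blast

context lie_group
begin

lemmas c0D = is_chartD[OF c0_chart]
lemmas c0_smooth_chart = chart_at_smooth[of e]

lemma ld_c0_e [simp]: "ld (snd c0) e v = v"
proof -
  have "hld (snd c0) e (\<lambda>v. v)"
    unfolding hld_def
    by (rule has_derivative_cong_open[OF has_derivative_ident c0D(2) z0_in])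
       (simp add: lt_def c0D(6))
  then show ?thesis using hld_ld by metis
qed

lemma lf_e [simp]: "lf v e = v" by (simp add: lf_eq)

section \<open>The adjoint representation and right translations\<close>

definition Ad where
  "Ad g = fderiv (\<lambda>z. snd c0 (mul (mul g (chart_inv c0 z)) (iv g))) z0"

lemma tmap_conj: "tmap A (\<lambda>h. mul (mul g h) (iv g)) e = Ad g"
  by (simp add: tmap_def dfun_def Ad_def o_def)

lemma conj_has_derivative:
  "((\<lambda>z. snd c0 (mul (mul g (chart_inv c0 z)) (iv g))) has_derivative Ad g) (at z0)"
proof -
  let ?k = "chart_at A g" and ?d = "chart_at A (iv g)"
  note K = chart_atD[where g=g]
  note D = chart_atD[where g="iv g"]
  have "(snd ?k g, snd ?d (iv g)) \<in> muldom ?k ?d c0"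
    using chart_at K(5) D(5) by (auto simp: muldom_def)
  from smooth_on_has_derivative[OF mulc_smooth(2)[OF chart_at(1) chart_at(1) chart_at(1)] this, THEN has_derivative_slice1]
  have "((\<lambda>z. mulc ?k ?d c0 (z, snd ?d (iv g))) has_derivative
      (\<lambda>v. fderiv (mulc ?k ?d c0) (snd ?k g, snd ?d (iv g)) (v, 0))) (at (snd ?k (lt g z0)))" by simp
  from diff_chain_at[OF hld_chart[OF chart_at_smooth chart_at(2), unfolded hld_def] this]
  have "((\<lambda>z. mulc ?k ?d c0 (snd ?k (lt g z), snd ?d (iv g))) has_derivative
      (\<lambda>v. fderiv (mulc ?k ?d c0) (snd ?k g, snd ?d (iv g)) (ld (snd ?k) g v, 0))) (at z0)"
    by (simp add: o_def)
  then have "((\<lambda>z. snd c0 (mul (mul g (chart_inv c0 z)) (iv g))) has_derivative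
      (\<lambda>v. fderiv (mulc ?k ?d c0) (snd ?k g, snd ?d (iv g)) (ld (snd ?k) g v, 0))) (at z0)"
    by (rule has_derivative_cong_open[OF _ open_lt[OF K(1), of g]])
       (use z0_in chart_at(2) in \<open>auto simp: mulc_def K(5) D(5) lt_def\<close>)
  then show ?thesis unfolding Ad_def by (metis frechet_derivativeI)
qed

lemma linear_Ad: "linear (Ad g)"
  by (rule has_derivative_linear[OF conj_has_derivative])

lemma conj_open: "open {z \<in> snd c0 ` fst c0. mul (mul g (chart_inv c0 z)) (iv g) \<in> fst c0}"
proof -
  have "continuous_on (snd c0 ` fst c0) (\<lambda>z. mul (mul g (chart_inv c0 z)) (iv g))"
    by (intro continuous_mul continuous_on_const c0D(4))
  from continuous_open_preimage[OF this c0D(2) c0D(1)]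
  show ?thesis by (rule back_subst[where P="open"]) auto
qed

lemma conj_z0 [simp]: "snd c0 (mul (mul g (chart_inv c0 z0)) (iv g)) = z0" by simp

lemma Ad_mul: "Ad (mul g h) v = Ad g (Ad h v)"
proof -
  let ?S = "{z \<in> snd c0 ` fst c0. mul (mul h (chart_inv c0 z)) (iv h) \<in> fst c0}"
  have "((\<lambda>z. snd c0 (mul (mul g (chart_inv c0 (snd c0 (mul (mul h (chart_inv c0 z)) (iv h))))) (iv g)))
      has_derivative (\<lambda>v. Ad g (Ad h v))) (at z0)"
    using diff_chain_at[OF conj_has_derivative[of h], of "\<lambda>z. snd c0 (mul (mul g (chart_inv c0 z)) (iv g))" "Ad g"]
      conj_has_derivative[of g] unfolding conj_z0 by (simp add: o_def)
  then have "((\<lambda>z. snd c0 (mul (mul (mul g h) (chart_inv c0 z)) (iv (mul g h)))) has_derivative (\<lambda>v. Ad g (Ad h v))) (at z0)"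
    by (rule has_derivative_cong_open[OF _ conj_open[of h]])
       (use z0_in chart_at(2)[of e] in \<open>auto simp: c0D(5) assoc inverse_distrib_swap\<close>)
  then show ?thesis using has_derivative_unique[OF conj_has_derivative[of "mul g h"]] by metis
qed

lemma Ad_e [simp]: "Ad e v = v"
proof -
  have "((\<lambda>z. snd c0 (mul (mul e (chart_inv c0 z)) (iv e))) has_derivative (\<lambda>v. v)) (at z0)"
    by (rule has_derivative_cong_open[OF has_derivative_ident c0D(2) z0_in]) (simp add: c0D(6))
  then show ?thesis using has_derivative_unique[OF conj_has_derivative[of e]] by metis
qed

lemma Ad_iv [simp]: "Ad g (Ad (iv g) v) = v" "Ad (iv g) (Ad g v) = v"
  by (simp_all flip: Ad_mul)

text \<open>From \<open>h p = p (p\<inverse> h p)\<close>, right translation is a conjugation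
  followed by left translation. This is why a right invariant field has the left frame coefficients
  \<open>Ad (iv p) v\<close>.\<close>

lemma right_chart_hld:
  assumes c: "smooth_chart A c" and p: "p \<in> fst c"
  shows "((\<lambda>z. snd c (mul (chart_inv c0 z) p)) has_derivative (\<lambda>v. ld (snd c) p (Ad (iv p) v))) (at z0)"
proof -
  have h: "((\<lambda>z. snd c (lt p z)) has_derivative ld (snd c) p) (at (snd c0 (mul (mul (iv p) (chart_inv c0 z0)) (iv (iv p)))))"
    using hld_chart[OF c p] unfolding hld_def by simp
  have "((\<lambda>z. snd c (lt p (snd c0 (mul (mul (iv p) (chart_inv c0 z)) (iv (iv p))))))
      has_derivative (\<lambda>v. ld (snd c) p (Ad (iv p) v))) (at z0)"
    using diff_chain_at[OF conj_has_derivative[of "iv p"] h] by (simp add: o_def)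
  then show ?thesis
    by (rule has_derivative_cong_open[OF _ conj_open[of "iv p"]])
       (use z0_in chart_at(2)[of e] in \<open>auto simp: c0D(5) lt_def assoc[symmetric]\<close>)
qed

lemma tmap_right: "tmap A (\<lambda>h. mul h p) e v = lf (Ad (iv p) v) p"
  using frechet_derivativeI[OF right_chart_hld[OF chart_at_smooth chart_at(2)[of p]]]
  by (simp add: tmap_def dfun_def lf_eq o_def)

text \<open>The differential of \<open>z \<mapsto> z p\<close> at \<open>e\<close> is both a partial
  derivative of the multiplication, hence smooth in \<open>p\<close>, and left translation applied
  to \<open>Ad (iv p) v\<close>. The latter factor is then found by solving a linear system.\<close>

lemma Ad_iv_smooth:
  assumes c: "c \<in> A"
  shows "smooth_on (snd c ` fst c) (\<lambda>y. Ad (iv (chart_inv c y)) v)"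
proof -
  note C = is_chartD[OF atlas_chart[OF c]]
  note cs = atlas_smooth_chart[OF c]
  have dom: "(z0, y) \<in> muldom c0 c c" if "y \<in> snd c ` fst c" for y
    using that z0_in C(7)[OF that] by (simp add: muldom_def)
  have eq: "ld (snd c) (chart_inv c y) (Ad (iv (chart_inv c y)) u) = fderiv (mulc c0 c c) (z0, y) (u, 0)"
    if y: "y \<in> snd c ` fst c" for y u
  proof -
    have "((\<lambda>z. mulc c0 c c (z, y)) has_derivative (\<lambda>u. fderiv (mulc c0 c c) (z0, y) (u, 0))) (at z0)"
      by (rule has_derivative_slice1[OF smooth_on_has_derivative[OF mulc_smooth(2)[OF chart_at(1) c c] dom[OF y]]])
    moreover have "((\<lambda>z. mulc c0 c c (z, y)) has_derivative (\<lambda>v. ld (snd c) (chart_inv c y) (Ad (iv (chart_inv c y)) v))) (at z0)"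
      using right_chart_hld[OF cs C(7)[OF y]] by (simp add: mulc_def)
    ultimately show ?thesis by (metis has_derivative_unique)
  qed
  show ?thesis
  proof (rule smooth_on_ld_solve[OF c _ eq])
    show "smooth_on (snd c ` fst c) (\<lambda>y. fderiv (mulc c0 c c) (z0, y) (v, 0))"
      by (rule smooth_on_compose[OF C(2) mulc_smooth(1)[OF chart_at(1) c c] _ smooth_on_frechet[OF mulc_smooth(2)[OF chart_at(1) c c]]])
         (auto simp: dom intro!: smooth_on_Pair smooth_on_const smooth_on_ident C(2))
  qed
qed

section \<open>The second order term of the multiplication and the Lie bracket\<close>

abbreviation br where "br \<equiv> lie_algebra_bracket mul e A"

abbreviation m where "m \<equiv> mulc c0 c0 c0"
abbreviation Wm where "Wm \<equiv> muldom c0 c0 c0"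

text \<open>The second order term \<open>D\<^sup>2 m (u, 0) (0, v)\<close> of the multiplication at the neutral element.\<close>

definition B where
  "B u v = fderiv (\<lambda>w. fderiv m w (0, v)) (z0, z0) (u, 0)"

lemmas m_smooth = mulc_smooth[OF chart_at(1)[of e] chart_at(1)[of e] chart_at(1)[of e]]

lemma m_C2: "Ck_on 2 Wm m" using m_smooth(2) unfolding smooth_on_def by blast

lemma z00_in: "(z0, z0) \<in> Wm" using z0_in chart_at(2)[of e] by (simp add: muldom_def)

lemma m_derivative_left: "fderiv m (z0, z0) (v, 0) = v"
proof -
  have "((\<lambda>z. m (z, z0)) has_derivative (\<lambda>v. fderiv m (z0, z0) (v, 0))) (at z0)"
    by (rule has_derivative_slice1[OF smooth_on_has_derivative[OF m_smooth(2) z00_in]])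
  moreover have "((\<lambda>z. m (z, z0)) has_derivative (\<lambda>v. v)) (at z0)"
    by (rule has_derivative_cong_open[OF has_derivative_ident c0D(2) z0_in])
       (simp add: mulc_def c0D(6))
  ultimately show ?thesis by (metis has_derivative_unique)
qed

lemma m_derivative_right: "fderiv m (z0, z0) (0, v) = v"
  using ld_mulc(2)[OF chart_at(1)[of e] z0_in, of v] by simp

text \<open>In the chart around \<open>e\<close> the left invariant field of \<open>v\<close> is
  \<open>y \<mapsto> fderiv m (y, z0) (0, v)\<close>. Its Jacobian at \<open>e\<close> is therefore
  the mixed second derivative \<open>B\<close>, and the bracket becomes the antisymmetrization of
  \<open>B\<close>.\<close>

lemma lf_coord_derivative:
  "((\<lambda>y. fderiv m (y, z0) (0, v)) has_derivative (\<lambda>u. B u v)) (at z0)"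
proof -
  have "((\<lambda>y. (y, z0)) has_derivative (\<lambda>u. (u, 0))) (at z0)" by (auto intro!: derivative_eq_intros)
  from has_derivative_directional[OF m_smooth(1) m_C2 _ this has_derivative_const[of "(0, v)"]] z00_in
  show ?thesis
    by (simp add: B_def linear_0[OF has_derivative_linear[OF smooth_on_has_derivative[OF m_smooth(2) z00_in]], unfolded zero_prod_def] zero_prod_def)
qed

lemma local_rep_c0_lf: "y \<in> snd c0 ` fst c0 \<Longrightarrow> local_rep A c0 (lf v) y = fderiv m (y, z0) (0, v)"
  by (simp add: local_rep_lf[OF c0_smooth_chart] ld_mulc(2)[OF chart_at(1)[of e]])

lemma local_rep_c0_derivative: "(local_rep A c0 (lf v) has_derivative (\<lambda>u. B u v)) (at z0)"
  by (rule has_derivative_cong_open[OF lf_coord_derivative c0D(2) z0_in])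
     (simp add: local_rep_c0_lf)

lemma br_eq: "br u v = B u v - B v u"
  unfolding lie_algebra_bracket_def lie_bracket_def
  by (simp add: frechet_derivativeI[OF local_rep_c0_derivative])

lemma linear_B1: "linear (\<lambda>u. B u v)"
  by (rule has_derivative_linear[OF local_rep_c0_derivative])

lemma B_alt: "B u v = fderiv (\<lambda>w. fderiv m w (u, 0)) (z0, z0) (0, v)"
  unfolding B_def by (rule second_derivative_symmetric[OF m_smooth(1) m_C2 z00_in])

lemma linear_B2: "linear (\<lambda>v. B u v)"
proof -
  have "Ck_on (Suc 0) Wm (\<lambda>w. fderiv m w (u, 0))"
    using smooth_on_frechet[OF m_smooth(2)] unfolding smooth_on_def by blast
  from has_derivative_linear[OF has_derivative_slice2[OF Ck_on_SucD[OF this z00_in]]]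
  show ?thesis unfolding B_alt .
qed

lemma linear_br1: "linear (\<lambda>u. br u v)" and linear_br2: "linear (br u)"
proof -
  show "linear (\<lambda>u. br u v)" unfolding br_eq by (intro linear_compose_sub linear_B1 linear_B2)
  have "linear (\<lambda>v. B u v - B v u)" by (intro linear_compose_sub linear_B1 linear_B2)
  then show "linear (br u)" unfolding br_eq[symmetric] .
qed

lemma br_antisym: "br u v = - br v u" by (simp add: br_eq)

section \<open>Derivatives of the adjoint representation\<close>

lemma inv_chart_smooth:
  "open (snd c0 ` (fst c0 \<inter> iv -` fst c0))" "z0 \<in> snd c0 ` (fst c0 \<inter> iv -` fst c0)"
  "smooth_on (snd c0 ` (fst c0 \<inter> iv -` fst c0)) (\<lambda>y. snd c0 (iv (chart_inv c0 y)))"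
proof -
  have "open (fst c0 \<inter> iv -` fst c0)"
    using continuous_open_preimage[OF continuous_on_subset[OF continuous_iv subset_UNIV] c0D(1) c0D(1)] .
  then show "open (snd c0 ` (fst c0 \<inter> iv -` fst c0))" by (intro chart_image_open[OF c0_chart]) auto
  show "z0 \<in> snd c0 ` (fst c0 \<inter> iv -` fst c0)" using chart_at(2)[of e] by simp
  show "smooth_on (snd c0 ` (fst c0 \<inter> iv -` fst c0)) (\<lambda>y. snd c0 (iv (chart_inv c0 y)))"
    using smooth_iv chart_at(1)[of e] unfolding smooth_map_def by (auto simp: o_def)
qed

text \<open>\<open>Ad\<close> is the partial derivative in \<open>z\<close> of the jointly smooth
  map \<open>(y, z) \<mapsto> y z y\<inverse>\<close>. Only existence of the derivative is extracted
  here; its value follows more easily by implicit differentiation.\<close>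

lemma Ad_differentiable: "\<exists>D. ((\<lambda>y. Ad (chart_inv c0 y) v) has_derivative D) (at z0)"
proof -
  let ?J = "snd c0 ` (fst c0 \<inter> iv -` fst c0)" and ?j = "\<lambda>y. snd c0 (iv (chart_inv c0 y))"
  \<comment> \<open>The points where both products in \<open>(y z) y\<inverse>\<close> can be
    computed in the chart around \<open>e\<close>.\<close>
  define S where "S = {w \<in> Wm \<inter> (?J \<times> UNIV). (m w, ?j (fst w)) \<in> Wm}"
  have oWJ: "open (Wm \<inter> (?J \<times> UNIV))" by (intro open_Int open_Times m_smooth(1) inv_chart_smooth(1) open_UNIV)
  have sj: "smooth_on (Wm \<inter> (?J \<times> UNIV)) (\<lambda>w. ?j (fst w))"
    by (rule smooth_on_compose[OF oWJ inv_chart_smooth(1) _ inv_chart_smooth(3)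
          smooth_on_bounded_linear[OF oWJ bounded_linear_fst smooth_on_ident[OF oWJ]]])
       (rule image_subsetI, erule IntE, simp only: mem_Times_iff)
  have sm: "smooth_on (Wm \<inter> (?J \<times> UNIV)) (\<lambda>w. (m w, ?j (fst w)))"
    by (rule smooth_on_Pair[OF oWJ smooth_on_subset[OF m_smooth(2)] sj]) (rule Int_lower1)
  have S: "open S"
  proof -
    from continuous_open_preimage[OF smooth_on_continuous[OF sm] oWJ m_smooth(1)]
    show ?thesis by (rule back_subst[where P="open"]) (unfold S_def, blast)
  qed
  have SW: "S \<subseteq> Wm \<inter> (?J \<times> UNIV)" "(\<lambda>w. (m w, ?j (fst w))) ` S \<subseteq> Wm" unfolding S_def by blast+
  have "smooth_on S (\<lambda>w. m (m w, ?j (fst w)))"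
    by (rule smooth_on_compose[OF S m_smooth(1) SW(2) m_smooth(2) smooth_on_subset[OF sm SW(1)]])
  then have N: "smooth_on S (\<lambda>w. snd c0 (mul (mul (chart_inv c0 (fst w)) (chart_inv c0 (snd w))) (iv (chart_inv c0 (fst w)))))"
  proof (rule smooth_on_cong[OF S, rotated])
    fix w assume "w \<in> S"
    then have "w \<in> Wm" "fst w \<in> ?J" using SW(1) by auto
    then have "mul (chart_inv c0 (fst w)) (chart_inv c0 (snd w)) \<in> fst c0" "iv (chart_inv c0 (fst w)) \<in> fst c0"
      by (auto simp: muldom_def c0D(5))
    from c0D(5)[OF this(1)] c0D(5)[OF this(2)]
    show "m (m w, ?j (fst w)) = snd c0 (mul (mul (chart_inv c0 (fst w)) (chart_inv c0 (snd w))) (iv (chart_inv c0 (fst w))))"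
      by (simp add: mulc_def)
  qed
  have zS: "(z0, z0) \<in> S"
    using z00_in inv_chart_smooth(2) chart_at(2)[of e] by (simp add: S_def mulc_def)
  let ?N = "\<lambda>w. snd c0 (mul (mul (chart_inv c0 (fst w)) (chart_inv c0 (snd w))) (iv (chart_inv c0 (fst w))))"
  have eq: "fderiv ?N (y, z0) (0, v) = Ad (chart_inv c0 y) v" if "(y, z0) \<in> S" for y
  proof -
    have 1: "((\<lambda>z. ?N (y, z)) has_derivative (\<lambda>v. fderiv ?N (y, z0) (0, v))) (at z0)"
      by (rule has_derivative_slice2[OF smooth_on_has_derivative[OF N that]])
    have 2: "((\<lambda>z. ?N (y, z)) has_derivative Ad (chart_inv c0 y)) (at z0)"
      unfolding fst_conv snd_conv by (rule conj_has_derivative)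
    show ?thesis by (rule fun_cong[OF has_derivative_unique[OF 1 2]])
  qed
  have d: "((\<lambda>y. (y, z0)) has_derivative (\<lambda>u. (u, 0))) (at z0)" by (auto intro!: derivative_eq_intros)
  have C2: "Ck_on 2 S ?N" using N unfolding smooth_on_def by blast
  note D = has_derivative_directional[OF S C2 zS d has_derivative_const[of "(0, v)"]]
  have "open ((\<lambda>y. (y, z0)) -` S)" by (intro open_vimage S continuous_intros)
  from has_derivative_cong_open[OF D this, of "\<lambda>y. Ad (chart_inv c0 y) v"] eq zS
  show ?thesis by blast
qed

text \<open>Differentiating \<open>(y z y\<inverse>) y = y z\<close> in \<open>z\<close> at
  \<open>e\<close> gives the identity \<open>key\<close>. Differentiating that in \<open>y\<close>
  at \<open>e\<close> yields \<open>B v w + D w = B w v\<close>, so the unknown derivative is the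
  bracket.\<close>

lemma Ad_has_derivative: "((\<lambda>y. Ad (chart_inv c0 y) v) has_derivative (\<lambda>w. br w v)) (at z0)"
proof -
  obtain D where D: "((\<lambda>y. Ad (chart_inv c0 y) v) has_derivative D) (at z0)"
    using Ad_differentiable by blast
  have key: "fderiv m (z0, y) (Ad (chart_inv c0 y) v, 0) = fderiv m (y, z0) (0, v)"
    if y: "y \<in> snd c0 ` fst c0" for y
  proof -
    let ?p = "chart_inv c0 y"
    have dom: "(z0, y) \<in> Wm" "(y, z0) \<in> Wm" using y z0_in c0D(7)[OF y] by (auto simp: muldom_def)
    have 1: "((\<lambda>z. m (z, y)) has_derivative (\<lambda>v. fderiv m (z0, y) (v, 0))) (at z0)"
      by (rule has_derivative_slice1[OF smooth_on_has_derivative[OF m_smooth(2) dom(1)]])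
    have 1: "((\<lambda>z. m (z, y)) has_derivative (\<lambda>v. fderiv m (z0, y) (v, 0)))
         (at (snd c0 (mul (mul ?p (chart_inv c0 z0)) (iv ?p))))"
      using 1 by simp
    have "((\<lambda>z. m (snd c0 (mul (mul ?p (chart_inv c0 z)) (iv ?p)), y)) has_derivative
       (\<lambda>v. fderiv m (z0, y) (Ad ?p v, 0))) (at z0)"
      using diff_chain_at[OF conj_has_derivative[of ?p] 1] by (simp add: o_def)
    then have "((\<lambda>z. m (y, z)) has_derivative (\<lambda>v. fderiv m (z0, y) (Ad ?p v, 0))) (at z0)"
      by (rule has_derivative_cong_open[OF _ conj_open[of ?p]])
         (use z0_in chart_at(2)[of e] in \<open>auto simp: mulc_def c0D(5) assoc\<close>)
    moreover have "((\<lambda>z. m (y, z)) has_derivative (\<lambda>v. fderiv m (y, z0) (0, v))) (at z0)"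
      by (rule has_derivative_slice2[OF smooth_on_has_derivative[OF m_smooth(2) dom(2)]])
    ultimately show ?thesis by (metis has_derivative_unique)
  qed
  have d1: "((\<lambda>y. (z0, y)) has_derivative (\<lambda>u. (0, u))) (at z0)" by (auto intro!: derivative_eq_intros)
  have d2: "((\<lambda>y. (Ad (chart_inv c0 y) v, 0)) has_derivative (\<lambda>u. (D u, 0))) (at z0)"
    by (intro has_derivative_Pair D has_derivative_const)
  have "((\<lambda>y. fderiv m (z0, y) (Ad (chart_inv c0 y) v, 0)) has_derivative
     (\<lambda>w. fderiv (\<lambda>w. fderiv m w (v, 0)) (z0, z0) (0, w)
        + fderiv m (z0, z0) (D w, 0))) (at z0)"
    using has_derivative_directional[OF m_smooth(1) m_C2 z00_in d1 d2] by simp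
  then have "((\<lambda>y. fderiv m (y, z0) (0, v)) has_derivative (\<lambda>w. B v w + D w)) (at z0)"
    unfolding m_derivative_left B_alt[symmetric]
    by (rule has_derivative_cong_open[OF _ c0D(2) z0_in]) (simp add: key)
  from fun_cong[OF has_derivative_unique[OF lf_coord_derivative this]]
  have eq: "B w v = B v w + D w" for w .
  have "D w = br w v" for w unfolding br_eq eq[of w] by (rule add_diff_cancel_left'[symmetric])
  then have "D = (\<lambda>w. br w v)" by (rule ext)
  from D[unfolded this] show ?thesis .
qed

lemma hld_Ad: "hld (\<lambda>p. Ad p v) p (\<lambda>w. Ad p (br w v))"
proof -
  have "((\<lambda>z. Ad p (Ad (chart_inv c0 z) v)) has_derivative (\<lambda>w. Ad p (br w v))) (at z0)"
    by (rule bounded_linear.has_derivative[OF has_derivative_bounded_linear[OF conj_has_derivative] Ad_has_derivative])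
  then show ?thesis by (simp add: hld_def lt_def Ad_mul)
qed

lemma inv_has_derivative: "((\<lambda>y. snd c0 (iv (chart_inv c0 y))) has_derivative (\<lambda>w. - w)) (at z0)"
proof -
  let ?j = "\<lambda>y. snd c0 (iv (chart_inv c0 y))"
  obtain J where J: "(?j has_derivative J) (at z0)"
    using smooth_on_has_derivative[OF inv_chart_smooth(3) inv_chart_smooth(2)] by blast
  have "((\<lambda>y. (y, ?j y)) has_derivative (\<lambda>w. (w, J w))) (at z0)"
    by (intro has_derivative_Pair J has_derivative_ident)
  moreover have mD: "(m has_derivative fderiv m (z0, z0)) (at (z0, z0))"
    by (rule smooth_on_has_derivative[OF m_smooth(2) z00_in])
  ultimately have "((\<lambda>y. m (y, ?j y)) has_derivative (\<lambda>w. fderiv m (z0, z0) (w, J w))) (at z0)"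
    using diff_chain_at[of "\<lambda>y. (y, ?j y)" "\<lambda>w. (w, J w)" z0 m] by (simp add: o_def)
  then have "((\<lambda>y. z0) has_derivative (\<lambda>w. fderiv m (z0, z0) (w, J w))) (at z0)"
    by (rule has_derivative_cong_open[OF _ inv_chart_smooth(1,2)]) (auto simp: mulc_def c0D(5))
  from fun_cong[OF has_derivative_unique[OF has_derivative_const this]]
  have "fderiv m (z0, z0) (w, J w) = 0" for w by simp
  moreover have "fderiv m (z0, z0) (w, J w) = w + J w" for w
    using linear_add[OF has_derivative_linear[OF mD], of "(w, 0)" "(0, J w)"] m_derivative_left m_derivative_right by simp
  ultimately have "J = (\<lambda>w. - w)" by (metis add_eq_0_iff)
  then show ?thesis using J by simp
qed

text \<open>Follows from \<open>Ad ((p h)\<inverse>) = Ad (h\<inverse>) Ad (p\<inverse>)\<close> and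
  the derivative \<open>- w\<close> of inversion at \<open>e\<close>. It expresses that left and
  right invariant fields commute, and it is the differential equation behind all later computations
  with \<open>al\<close> and \<open>Fn\<close>.\<close>

lemma hld_Ad_iv: "hld (\<lambda>p. Ad (iv p) v) p (\<lambda>w. - br w (Ad (iv p) v))"
proof -
  let ?u = "Ad (iv p) v"
  have "((\<lambda>y. Ad (chart_inv c0 y) ?u) has_derivative (\<lambda>w. br w ?u)) (at (snd c0 (iv (chart_inv c0 z0))))"
    using Ad_has_derivative by simp
  from diff_chain_at[OF inv_has_derivative this]
  have "((\<lambda>y. Ad (chart_inv c0 (snd c0 (iv (chart_inv c0 y)))) ?u) has_derivative (\<lambda>w. - br w ?u)) (at z0)"
    by (simp add: o_def linear_neg[OF linear_br1])
  then have "((\<lambda>y. Ad (iv (lt p y)) v) has_derivative (\<lambda>w. - br w ?u)) (at z0)"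
    by (rule has_derivative_cong_open[OF _ inv_chart_smooth(1,2)])
       (auto simp: c0D(5) lt_def inverse_distrib_swap Ad_mul)
  then show ?thesis by (simp add: hld_def)
qed

text \<open>\<open>Ad (g h) v\<close> is differentiated in \<open>h\<close> at \<open>e\<close> in
  two ways: as \<open>Ad g (Ad h v)\<close> and as
  \<open>Ad (g h g\<inverse>) (Ad g v)\<close>.\<close>

lemma Ad_br: "Ad g (br w v) = br (Ad g w) (Ad g v)"
proof -
  have h: "((\<lambda>y. Ad (chart_inv c0 y) (Ad g v)) has_derivative (\<lambda>w. br w (Ad g v))) (at (snd c0 (mul (mul g (chart_inv c0 z0)) (iv g))))"
    using Ad_has_derivative by simp
  from diff_chain_at[OF conj_has_derivative[of g] this]
  have "((\<lambda>z. Ad (chart_inv c0 (snd c0 (mul (mul g (chart_inv c0 z)) (iv g)))) (Ad g v)) has_derivative (\<lambda>w. br (Ad g w) (Ad g v))) (at z0)"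
    by (simp add: o_def)
  then have "((\<lambda>z. Ad (lt g z) v) has_derivative (\<lambda>w. br (Ad g w) (Ad g v))) (at z0)"
    by (rule has_derivative_cong_open[OF _ conj_open[of g]])
       (use z0_in chart_at(2)[of e] in \<open>auto simp: c0D(5) lt_def Ad_mul\<close>)
  then show ?thesis using has_derivative_unique[OF hld_Ad[unfolded hld_def]] by metis
qed

section \<open>The bracket of left invariant fields at an arbitrary point\<close>

lemma local_rep_lf_has_derivative:
  assumes c: "c \<in> A" and p: "p \<in> fst c"
  shows "(local_rep A c (lf v) has_derivative fderiv (local_rep A c (lf v)) (snd c p)) (at (snd c p))"
  by (rule smooth_on_has_derivative[of "snd c ` fst c"]) (use lf_smooth c p in \<open>auto simp: smooth_vector_field_def\<close>)

text \<open>Naturality of the bracket under left translation by \<open>p\<close>, written as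
  \<open>?F\<close> in charts. Each term splits into a second derivative of \<open>?F\<close> and
  the image of \<open>B\<close>; the former cancel by symmetry, the latter give
  \<open>br\<close>.\<close>

lemma bracket_chart:
  assumes c: "c \<in> A" and p: "p \<in> fst c"
  shows "fderiv (local_rep A c (lf v)) (snd c p) (ld (snd c) p u) -
    fderiv (local_rep A c (lf u)) (snd c p) (ld (snd c) p v) = ld (snd c) p (br u v)"
proof -
  note cs = atlas_smooth_chart[OF c]
  note C = is_chartD[OF atlas_chart[OF c]]
  let ?F = "\<lambda>z. snd c (lt p z)"
  obtain S where S: "open S" "z0 \<in> S" "S \<subseteq> snd c0 ` fst c0" "\<forall>z\<in>S. lt p z \<in> fst c" "smooth_on S ?F"
    using smooth_lt[OF cs p] by blast
  have C2: "Ck_on 2 S ?F" using S(5) unfolding smooth_on_def by blast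
  have FD: "(?F has_derivative ld (snd c) p) (at z0)" using hld_chart[OF cs p] by (simp add: hld_def)
  \<comment> \<open>Left translation by \<open>p\<close> maps a left invariant field to itself; in
    charts this is the relation to be differentiated at \<open>z0\<close>.\<close>
  have rel: "local_rep A c (lf a) (?F z) = fderiv ?F z (local_rep A c0 (lf a) z)" if z: "z \<in> S" for z a
  proof -
    let ?h = "chart_inv c0 z"
    have zin: "z \<in> snd c0 ` fst c0" using z S(3) by auto
    have h: "?h \<in> fst c0" "snd c0 ?h = z" using c0D(6,7)[OF zin] by auto
    have "(?F has_derivative fderiv ?F z) (at (snd c0 (lt ?h z0)))"
      using smooth_on_has_derivative[OF S(5) z] h by simp
    from diff_chain_at[OF hld_chart[OF c0_smooth_chart h(1), unfolded hld_def] this]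
    have "((\<lambda>z'. ?F (snd c0 (lt ?h z'))) has_derivative (\<lambda>a. fderiv ?F z (ld (snd c0) ?h a))) (at z0)"
      by (simp add: o_def)
    then have "((\<lambda>z'. snd c (lt (lt p z) z')) has_derivative (\<lambda>a. fderiv ?F z (ld (snd c0) ?h a))) (at z0)"
      by (rule has_derivative_cong_open[OF _ open_lt[OF c0D(1), of ?h]])
         (use z0_in h in \<open>auto simp: lt_def c0D(5) assoc\<close>)
    then have "ld (snd c) (lt p z) a = fderiv ?F z (ld (snd c0) ?h a)"
      unfolding ld_def[of "snd c"] by (metis frechet_derivativeI)
    moreover have "?F z \<in> snd c ` fst c" "chart_inv c (?F z) = lt p z" using S(4) z C(5) by auto
    ultimately show ?thesis using local_rep_lf[OF cs] local_rep_lf[OF c0_smooth_chart zin] by simp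
  qed
  have main: "fderiv (local_rep A c (lf a)) (snd c p) (ld (snd c) p b)
      = fderiv (\<lambda>y. fderiv ?F y a) z0 b + ld (snd c) p (B b a)" for a b
  proof -
    have d1: "((\<lambda>z. local_rep A c (lf a) (?F z)) has_derivative
        (\<lambda>b. fderiv (local_rep A c (lf a)) (snd c p) (ld (snd c) p b))) (at z0)"
      using diff_chain_at[OF FD, of "local_rep A c (lf a)"] local_rep_lf_has_derivative[OF c p] by (simp add: o_def)
    have "((\<lambda>z. fderiv ?F z (local_rep A c0 (lf a) z)) has_derivative
        (\<lambda>b. fderiv (\<lambda>y. fderiv ?F y (local_rep A c0 (lf a) z0)) z0 b
           + fderiv ?F z0 (B b a))) (at z0)"
      by (rule has_derivative_directional[OF S(1) C2 S(2) has_derivative_ident local_rep_c0_derivative])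
    then have d2: "((\<lambda>z. local_rep A c (lf a) (?F z)) has_derivative
        (\<lambda>b. fderiv (\<lambda>y. fderiv ?F y (local_rep A c0 (lf a) z0)) z0 b
           + fderiv ?F z0 (B b a))) (at z0)"
      by (rule has_derivative_cong_open[OF _ S(1,2)]) (simp add: rel)
    have "local_rep A c0 (lf a) z0 = a"
      by (simp add: local_rep_c0_lf[OF z0_in] m_derivative_right)
    then show ?thesis
      using fun_cong[OF has_derivative_unique[OF d1 d2], of b] frechet_derivativeI[OF FD] by simp
  qed
  have sym: "fderiv (\<lambda>y. fderiv ?F y v) z0 u = fderiv (\<lambda>y. fderiv ?F y u) z0 v"
    by (rule second_derivative_symmetric[OF S(1) C2 S(2)])
  show ?thesis
    unfolding main[of v u] main[of u v] br_eq linear_diff[OF linear_ld[OF hld_chart[OF cs p]]] sym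
    by (rule add_diff_cancel_left)
qed

lemma lie_bracket_lf: "lie_bracket A (lf u) (lf v) p = lf (br u v) p"
  using bracket_chart[OF chart_at(1) chart_at(2), of p v u]
  by (simp add: lie_bracket_def Let_def lf_eq)

end

section \<open>The symplectic form and its connection in the left trivialization\<close>

lemma alternating_cong: "alternating k T \<Longrightarrow> (\<And>i. i < k \<Longrightarrow> v i = w i) \<Longrightarrow> T v = T w"
  unfolding alternating_def by blast

lemma alternating_linear: "alternating k T \<Longrightarrow> i < k \<Longrightarrow> linear (\<lambda>x. T (v(i := x)))"
  unfolding alternating_def by blast

lemma alternating_zero: "alternating k T \<Longrightarrow> i < k \<Longrightarrow> j < k \<Longrightarrow> i \<noteq> j \<Longrightarrow> v i = v j \<Longrightarrow> T v = 0"
  unfolding alternating_def by blast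

lemma alternating_pair_linear:
  assumes "alternating 2 T"
  shows "linear (\<lambda>u. T (pair u v))" "linear (\<lambda>v. T (pair u v))"
proof -
  have "T ((pair v v)(0 := u)) = T (pair u v)" "T ((pair u u)(1 := v)) = T (pair u v)" for u v
    by (auto intro!: alternating_cong[OF assms] simp: pair_def)
  then show "linear (\<lambda>u. T (pair u v))" "linear (\<lambda>v. T (pair u v))"
    using alternating_linear[OF assms, of 0 "pair v v"] alternating_linear[OF assms, of 1 "pair u u"] by simp_all
qed

lemma alternating_pair_antisym:
  assumes "alternating 2 T"
  shows "T (pair u v) = - T (pair v u)"
proof -
  have z: "T (pair a a) = 0" for a
    by (rule alternating_zero[OF assms, of 0 1]) (auto simp: pair_def)
  have "T (pair (u + v) (u + v)) = T (pair u u) + T (pair u v) + (T (pair v u) + T (pair v v))"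
    by (simp only: linear_add[OF alternating_pair_linear(1)[OF assms]] linear_add[OF alternating_pair_linear(2)[OF assms]])
  then show ?thesis unfolding z by linarith
qed

lemma has_derivative_vecI:
  fixes f :: "'a::real_normed_vector \<Rightarrow> real^'n"
  assumes "\<And>i. ((\<lambda>x. f x $ i) has_derivative (\<lambda>v. f' v $ i)) F"
  shows "(f has_derivative f') F"
proof -
  have "((\<lambda>x. \<Sum>i\<in>UNIV. (f x $ i) *\<^sub>R (axis i 1 :: real^'n)) has_derivative (\<lambda>v. \<Sum>i\<in>UNIV. (f' v $ i) *\<^sub>R axis i 1)) F"
    by (intro has_derivative_sum has_derivative_scaleR_left assms)
  moreover have "(\<Sum>i\<in>UNIV. (x $ i) *\<^sub>R (axis i 1 :: real^'n)) = x" for x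
    by (simp add: scalar_mult_eq_scaleR[symmetric] basis_expansion)
  ultimately show ?thesis by simp
qed

lemma vec_axis_expansion: "(x :: real^'n) = (\<Sum>i\<in>UNIV. (x $ i) *\<^sub>R axis i 1)"
  by (simp add: scalar_mult_eq_scaleR[symmetric] basis_expansion)

lemma linear_axis_expansion:
  assumes "linear L"
  shows "L (x :: real^'n) = (\<Sum>i\<in>UNIV. (x $ i) *\<^sub>R L (axis i 1))"
proof -
  have "L (\<Sum>i\<in>UNIV. (x $ i) *\<^sub>R axis i 1) = (\<Sum>i\<in>UNIV. (x $ i) *\<^sub>R L (axis i 1))"
    using assms by (simp add: linear_sum linear_cmul)
  then show ?thesis by (simp flip: vec_axis_expansion)
qed

lemma bounded_bilinearI:
  fixes h :: "'a::euclidean_space \<Rightarrow> 'b::euclidean_space \<Rightarrow> 'c::real_normed_vector"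
  assumes "\<And>v. linear (\<lambda>u. h u v)" "\<And>u. linear (h u)"
  shows "bounded_bilinear h"
  using assms by (simp add: bilinear_conv_bounded_bilinear[symmetric] bilinear_def)

section \<open>The form on the Lie algebra and its cocycle identity\<close>

context symplectic_lie_group
begin

lemma omega_alternating: "alternating 2 (\<omega> p)"
  using symplectic unfolding symplectic_form_def differential_form_def by blast

lemma omega_lf_family: "\<omega> p (\<lambda>j. lf (v j) p) = \<omega> e v"
  using left_invariant unfolding left_invariant_form_def form_invariant_def left_field_def
  by (metis right_neutral)

definition w0 where "w0 u v = \<omega> e (pair u v)"

lemma omega_lf: "\<omega> p (pair (lf u p) (lf v p)) = w0 u v"
proof -
  have "(\<lambda>j. lf (pair u v j) p) = pair (lf u p) (lf v p)" by (auto simp: pair_def)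
  then show ?thesis using omega_lf_family[of p "pair u v"] by (simp add: w0_def)
qed

lemma w0_linear1: "linear (\<lambda>u. w0 u v)" and w0_linear2: "linear (w0 u)"
  unfolding w0_def using alternating_pair_linear[OF omega_alternating] by auto

lemmas w0_lin =
  linear_sum[OF w0_linear1] linear_sum[OF w0_linear2] linear_cmul[OF w0_linear1] linear_cmul[OF w0_linear2]
  linear_add[OF w0_linear1] linear_add[OF w0_linear2] linear_neg[OF w0_linear1] linear_neg[OF w0_linear2]
lemmas Ad_lin = linear_sum[OF linear_Ad] linear_cmul[OF linear_Ad] linear_add[OF linear_Ad] linear_0[OF linear_Ad]

lemma w0_antisym: "w0 u v = - w0 v u"
  unfolding w0_def by (rule alternating_pair_antisym[OF omega_alternating])

lemma w0_nondeg: "(\<And>v. w0 u v = 0) \<Longrightarrow> u = 0"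
  using symplectic unfolding symplectic_form_def w0_def by blast

lemma w0_eqI: "(\<And>v. w0 a v = w0 b v) \<Longrightarrow> a = b"
  using w0_nondeg[of "a - b"] linear_diff[OF w0_linear1] by simp

lemma w0_bilinear: "bounded_bilinear w0"
  by (rule bounded_bilinearI[OF w0_linear1 w0_linear2])

lemma w0_riesz:
  assumes "linear l"
  shows "\<exists>x. \<forall>v. w0 x v = l v"
proof -
  let ?T = "\<lambda>x. (\<chi> i. w0 x (axis i 1)) :: real^'n"
  have lin: "linear ?T"
    by (rule linearI) (simp_all add: vec_eq_iff w0_lin)
  have z: "x = 0" if "?T x = 0" for x
  proof (rule w0_nondeg)
    fix v
    have "w0 x (axis i 1) = 0" for i using that by (simp add: vec_eq_iff)
    then show "w0 x v = 0" using linear_axis_expansion[OF w0_linear2, of x v] by simp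
  qed
  have "inj ?T" using z by (simp only: linear_injective_0[OF lin]) blast
  then have "surj ?T" by (rule linear_injective_imp_surjective[OF lin]) (rule refl)
  from surjD[OF this, of "\<chi> i. l (axis i 1)"] obtain x where "?T x = (\<chi> i. l (axis i 1))" by metis
  then have "w0 x (axis i 1) = l (axis i 1)" for i by (simp add: vec_eq_iff)
  then have "w0 x v = l v" for v
    using linear_axis_expansion[OF w0_linear2, of x v] linear_axis_expansion[OF assms, of v] by simp
  then show ?thesis by blast
qed

text \<open>Obtained by differentiating \<open>?M y (?g y) = s\<close>, where the derivative of
  \<open>?M\<close> is \<open>B\<close> and \<open>?M z0\<close> is the identity. It measures how a
  constant coordinate field varies in the left invariant frame.\<close>

lemma lcoord_c0_derivative:
  "((\<lambda>y. lcoord c0 (chart_inv c0 y) s) has_derivative (\<lambda>u. - B u s)) (at z0)"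
proof -
  let ?g = "\<lambda>y. lcoord c0 (chart_inv c0 y) s"
  let ?M = "\<lambda>y. ld (snd c0) (chart_inv c0 y)"
  have Mg: "?M y (?g y) = s" if "y \<in> snd c0 ` fst c0" for y
    by (rule ld_lcoord[OF c0_smooth_chart c0D(7)[OF that]])
  have "smooth_on (snd c0 ` fst c0) ?g"
    by (rule smooth_on_ld_solve[OF chart_at(1) smooth_on_const[OF c0D(2)] Mg])
  then obtain G where G: "(?g has_derivative G) (at z0)" using smooth_on_has_derivative z0_in by blast
  have gz: "?g z0 = s" using Mg[OF z0_in] by simp
  have d1: "((\<lambda>y. (y, z0)) has_derivative (\<lambda>u. (u, 0))) (at z0)" by (auto intro!: derivative_eq_intros)
  have d2: "((\<lambda>y. (0, ?g y)) has_derivative (\<lambda>u. (0, G u))) (at z0)"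
    by (intro has_derivative_Pair G has_derivative_const)
  from has_derivative_directional[OF m_smooth(1) m_C2 z00_in d1 d2]
  have "((\<lambda>y. fderiv m (y, z0) (0, ?g y)) has_derivative (\<lambda>u. B u s + G u)) (at z0)"
    unfolding gz B_def[symmetric] m_derivative_right .
  then have "((\<lambda>y. s) has_derivative (\<lambda>u. B u s + G u)) (at z0)"
    by (rule has_derivative_cong_open[OF _ c0D(2) z0_in])
       (simp add: Mg ld_mulc(2)[OF chart_at(1)[of e], symmetric])
  from fun_cong[OF has_derivative_unique[OF has_derivative_const this]]
  have "G u = - B u s" for u by (metis add.commute eq_neg_iff_add_eq_0)
  then have "G = (\<lambda>u. - B u s)" by (rule ext)
  from G[unfolded this] show ?thesis .
qed

text \<open>Closedness is evaluated at \<open>e\<close> on the constant fields of the chart there.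
  Each derivative of a coefficient of \<open>\<omega>\<close> produces two terms in
  \<open>B\<close>, and the alternating sum combines them into brackets.\<close>

lemma cocycle: "w0 (br a b) c + w0 (br b c) a + w0 (br c a) b = 0"
proof -
  define \<Omega> where "\<Omega> s t y = w0 (lcoord c0 (chart_inv c0 y) s) (lcoord c0 (chart_inv c0 y) t)" for s t y
  define v where "v i = (if i = 0 then a else if i = 1 then b else c)" for i :: nat
  have Lz: "lcoord c0 e s = s" for s
    using ld_lcoord[OF c0_smooth_chart chart_at(2), of s] by simp
  have d: "fderiv (\<Omega> s t) z0 u = - w0 (B u s) t - w0 s (B u t)" for s t u
  proof -
    have "(\<Omega> s t has_derivative (\<lambda>u. w0 (lcoord c0 (chart_inv c0 z0) s) (- B u t) + w0 (- B u s) (lcoord c0 (chart_inv c0 z0) t))) (at z0)"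
      unfolding \<Omega>_def by (rule bounded_bilinear.FDERIV[OF w0_bilinear lcoord_c0_derivative lcoord_c0_derivative])
    from frechet_derivativeI[OF this] show ?thesis
      by (simp add: Lz w0_lin algebra_simps)
  qed
  \<comment> \<open>The exterior derivative uses families indexed by \<open>nat\<close> with one
    member omitted; only the entries 0 and 1 of such a family matter to a 2-form.\<close>
  have om: "\<omega> (chart_inv c0 y) (\<lambda>j. coord_vec A c0 (chart_inv c0 y) (f j)) = \<Omega> s t y"
    if y: "y \<in> snd c0 ` fst c0" and f: "f 0 = s" "f 1 = t" for y and f :: "nat \<Rightarrow> real^'n" and s t
  proof -
    have "\<omega> (chart_inv c0 y) (\<lambda>j. coord_vec A c0 (chart_inv c0 y) (f j))
       = \<omega> (chart_inv c0 y) (pair (coord_vec A c0 (chart_inv c0 y) s) (coord_vec A c0 (chart_inv c0 y) t))"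
      by (rule alternating_cong[OF omega_alternating]) (use f in \<open>auto simp: pair_def less_2_cases_iff\<close>)
    then show ?thesis
      by (simp add: coord_vec_eq[OF c0_smooth_chart c0D(7)[OF y]] omega_lf \<Omega>_def)
  qed
  have fr: "fderiv (\<lambda>y. \<omega> (chart_inv c0 y) (\<lambda>j. coord_vec A c0 (chart_inv c0 y) (f j))) z0 = fderiv (\<Omega> s t) z0"
    if f: "f 0 = s" "f 1 = t" for f :: "nat \<Rightarrow> real^'n" and s t
    by (rule frechet_derivative_cong_open[OF c0D(2) z0_in om[OF _ f]])
  define G where "G i = fderiv (\<lambda>y. \<omega> (chart_inv c0 y)
      (\<lambda>j. coord_vec A c0 (chart_inv c0 y) (v (if j < i then j else Suc j)))) z0" for i :: nat
  have "ext_deriv A 2 \<omega> e v = 0" using symplectic unfolding symplectic_form_def by blast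
  then have "(\<Sum>i\<le>2. (- 1) ^ i * G i (v i)) = 0"
    unfolding ext_deriv_def Let_def G_def .
  then have "G 0 (v 0) - G 1 (v 1) + G 2 (v 2) = 0" by (simp add: numeral_2_eq_2)
  moreover have "G 0 = fderiv (\<Omega> b c) z0" "G 1 = fderiv (\<Omega> a c) z0"
    "G 2 = fderiv (\<Omega> a b) z0"
    unfolding G_def by (rule fr; simp add: v_def)+
  moreover have "v 0 = a" "v 1 = b" "v 2 = c" by (simp_all add: v_def)
  ultimately have "fderiv (\<Omega> b c) z0 a - fderiv (\<Omega> a c) z0 b + fderiv (\<Omega> a b) z0 c = 0"
    by metis
  then show ?thesis
    unfolding d br_eq linear_diff[OF w0_linear1]
    using w0_antisym[of b "B a c"] w0_antisym[of a "B b c"] w0_antisym[of a "B c b"] by linarith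
qed

text \<open>In the left trivialization, \<open>al u\<close> is the 1-form \<open>\<omega>(u\<^sup>-, \<cdot>)\<close> and \<open>Fn u v\<close> the function
  \<open>\<omega>(u\<^sup>-, v\<^sup>-)\<close>.\<close>

abbreviation al where "al u p v \<equiv> w0 (Ad (iv p) u) v"

definition Fn where "Fn u v p = w0 (Ad (iv p) u) (Ad (iv p) v)"

lemma hld_al: "hld (\<lambda>p. al u p v) p (\<lambda>w. - w0 (br w (Ad (iv p) u)) v)"
proof -
  have "((\<lambda>z. w0 (Ad (iv (lt p z)) u) v) has_derivative (\<lambda>w. w0 (- br w (Ad (iv p) u)) v)) (at z0)"
    using bounded_linear.has_derivative[OF bounded_bilinear.bounded_linear_left[OF w0_bilinear] hld_Ad_iv[unfolded hld_def]] .
  then show ?thesis by (simp add: hld_def w0_lin)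
qed

lemma hld_Fn: "hld (Fn u v) p (\<lambda>w. al (br u v) p w)"
proof -
  let ?u = "Ad (iv p) u" and ?v = "Ad (iv p) v"
  have "((\<lambda>z. w0 (Ad (iv (lt p z)) u) (Ad (iv (lt p z)) v)) has_derivative
      (\<lambda>w. w0 (Ad (iv (lt p z0)) u) (- br w ?v) + w0 (- br w ?u) (Ad (iv (lt p z0)) v))) (at z0)"
    by (rule bounded_bilinear.FDERIV[OF w0_bilinear hld_Ad_iv[unfolded hld_def] hld_Ad_iv[unfolded hld_def]])
  moreover have "w0 (Ad (iv (lt p z0)) u) (- br w ?v) + w0 (- br w ?u) (Ad (iv (lt p z0)) v) = al (br u v) p w" for w
  proof -
    have "w0 ?u (br w ?v) = w0 (br ?v w) ?u"
      using w0_antisym[of ?u "br w ?v"] br_antisym[of w ?v] by (simp add: w0_lin)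
    then show ?thesis
      using cocycle[of ?u ?v w] by (simp add: w0_lin Ad_br)
  qed
  ultimately show ?thesis by (simp add: hld_def Fn_def)
qed

end

section \<open>The connection in the left invariant frame\<close>

locale symplectic_connection = symplectic_lie_group mul e iv A \<omega>
  for mul :: "'a::{t2_space, second_countable_topology} \<Rightarrow> 'a \<Rightarrow> 'a" and e :: 'a
    and iv :: "'a \<Rightarrow> 'a" and A :: "('a, real^'n) chart set" and \<omega> :: "('a, 'n) form_field" +
  fixes D :: "('a, real^'n) connection"
  assumes assoc_connection: "associated_connection mul e A \<omega> D"
begin

lemma linear_connection: "linear_connection A D"
  using assoc_connection unfolding associated_connection_def by blast

text \<open>Minus the \<open>\<omega>\<close>-adjoint of \<open>ad u\<close>, applied to
  \<open>v\<close>. Nondegeneracy makes the choice by \<open>SOME\<close> both possible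
  (\<open>w0_riesz\<close>) and unique (\<open>w0_eqI\<close>).\<close>

definition Gam where "Gam u v = (SOME x. \<forall>w. w0 x w = - w0 v (br u w))"

lemma w0_Gam: "w0 (Gam u v) w = - w0 v (br u w)"
proof -
  have "linear (\<lambda>w. - w0 v (br u w))"
    using linear_compose[OF linear_compose[OF linear_br2 w0_linear2] linear_uminus] by (simp add: o_def)
  from someI_ex[OF w0_riesz[OF this]] show ?thesis unfolding Gam_def by blast
qed

lemma linear_Gam1: "linear (\<lambda>u. Gam u v)" and linear_Gam2: "linear (Gam u)"
proof -
  show "linear (\<lambda>u. Gam u v)"
    by (rule linearI; rule w0_eqI)
       (simp_all add: w0_Gam w0_lin
          w0_lin linear_add[OF linear_br1] linear_cmul[OF linear_br1])
  show "linear (Gam u)"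
    by (rule linearI; rule w0_eqI)
       (simp_all add: w0_Gam w0_lin)
qed

lemma D_lf: "D (lf u) (lf v) p = lf (Gam u v) p"
proof -
  let ?x = "lco p (D (lf u) (lf v) p)"
  have "?x = Gam u v"
  proof (rule w0_eqI)
    fix w
    have "\<omega> p (pair (D (lf u) (lf v) p) (lf w p)) = - \<omega> p (pair (lf v p) (lie_bracket A (lf u) (lf w) p))"
      using assoc_connection unfolding associated_connection_def by blast
    moreover have "\<omega> p (pair (D (lf u) (lf v) p) (lf w p)) = w0 ?x w"
      using omega_lf[of p ?x w] by simp
    ultimately show "w0 ?x w = w0 (Gam u v) w" by (simp add: lie_bracket_lf omega_lf w0_Gam)
  qed
  then show ?thesis by (metis lf_lco)
qed

lemma local_rep_sum:
  assumes c: "c \<in> A" and y: "y \<in> snd c ` fst c"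
  shows "local_rep A c (\<lambda>q. \<Sum>i\<in>I. f i q *\<^sub>R X i q) y = (\<Sum>i\<in>I. f i (chart_inv c y) *\<^sub>R local_rep A c (X i) y)"
proof -
  have "linear (dfun A (snd c) (chart_inv c y))"
    using dfun_bounded_linear[OF hld_chart[OF atlas_smooth_chart[OF c] is_chartD(7)[OF atlas_chart[OF c] y]]]
    by (simp add: linear_conv_bounded_linear)
  then show ?thesis unfolding local_rep_def by (simp add: linear_sum linear_cmul)
qed

lemma smooth_vector_field_sum:
  assumes "\<And>i. i \<in> I \<Longrightarrow> smooth_fun A (f i)" "\<And>i. i \<in> I \<Longrightarrow> smooth_vector_field A (X i)"
  shows "smooth_vector_field A (\<lambda>q. \<Sum>i\<in>I. f i q *\<^sub>R X i q)"
  unfolding smooth_vector_field_def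
proof
  fix c assume c: "c \<in> A"
  note C = is_chartD[OF atlas_chart[OF c]]
  have "smooth_on (snd c ` fst c) (\<lambda>y. \<Sum>i\<in>I. f i (chart_inv c y) *\<^sub>R local_rep A c (X i) y)"
    using assms c unfolding smooth_fun_def smooth_vector_field_def o_def
    by (intro smooth_on_sum smooth_on_scaleR C(2)) auto
  then show "smooth_on (snd c ` fst c) (local_rep A c (\<lambda>q. \<Sum>i\<in>I. f i q *\<^sub>R X i q))"
    by (rule smooth_on_cong[OF C(2), rotated]) (simp add: local_rep_sum[OF c])
qed

lemma smooth_vector_field_scale:
  assumes "smooth_fun A f" "smooth_vector_field A X"
  shows "smooth_vector_field A (\<lambda>q. f q *\<^sub>R X q)"
  using smooth_vector_field_sum[of "{0::nat}" "\<lambda>_. f" "\<lambda>_. X"] assms by simp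

lemma smooth_fun_const: "smooth_fun A (\<lambda>q. c)"
  unfolding smooth_fun_def o_def using smooth_on_const is_chartD(2) atlas_chart by blast

lemma hld_const: "hld (\<lambda>q. c) p (\<lambda>_. 0)"
  by (simp add: hld_def)

lemma dfun_const: "dfun A (\<lambda>q. c) p v = 0"
  using dfun_lf[OF hld_const, of c p "lco p v"] by simp

lemma D_scale1:
  "smooth_fun A f \<Longrightarrow> smooth_vector_field A X \<Longrightarrow> smooth_vector_field A Y \<Longrightarrow>
    D (\<lambda>q. f q *\<^sub>R X q) Y = (\<lambda>q. f q *\<^sub>R D X Y q)"
  using linear_connection unfolding linear_connection_def by blast

lemma D_scale2:
  "smooth_fun A f \<Longrightarrow> smooth_vector_field A X \<Longrightarrow> smooth_vector_field A Y \<Longrightarrow>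
    D X (\<lambda>q. f q *\<^sub>R Y q) = (\<lambda>q. dfun A f q (X q) *\<^sub>R Y q + f q *\<^sub>R D X Y q)"
  using linear_connection unfolding linear_connection_def by blast

lemma D_add1:
  "smooth_vector_field A X \<Longrightarrow> smooth_vector_field A X' \<Longrightarrow> smooth_vector_field A Y \<Longrightarrow>
    D (\<lambda>q. X q + X' q) Y = (\<lambda>q. D X Y q + D X' Y q)"
  using linear_connection unfolding linear_connection_def by blast

lemma D_add2:
  "smooth_vector_field A X \<Longrightarrow> smooth_vector_field A Y \<Longrightarrow> smooth_vector_field A Y' \<Longrightarrow>
    D X (\<lambda>q. Y q + Y' q) = (\<lambda>q. D X Y q + D X Y' q)"
  using linear_connection unfolding linear_connection_def by blast

lemma D_sum1:
  assumes "finite I" "\<And>i. smooth_fun A (f i)" "\<And>i. smooth_vector_field A (X i)" "smooth_vector_field A Y"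
  shows "D (\<lambda>q. \<Sum>i\<in>I. f i q *\<^sub>R X i q) Y = (\<lambda>q. \<Sum>i\<in>I. f i q *\<^sub>R D (X i) Y q)"
  using assms(1)
proof (induction I rule: finite_induct)
  case empty
  \<comment> \<open>For the empty sum, the value of \<open>D\<close> at the zero field comes from
    the scaling rule with the constant function 0.\<close>
  show ?case using D_scale1[OF smooth_fun_const[of 0] lf_smooth[of 0] assms(4)] by simp
next
  case (insert i I)
  show ?case
    using D_add1[OF smooth_vector_field_scale[OF assms(2,3)] smooth_vector_field_sum[OF assms(2,3)] assms(4), of i i "\<lambda>i. i" "\<lambda>i. i" I]
    by (simp add: insert D_scale1 assms)
qed

lemma D_sum2:
  assumes "finite I" "\<And>i. smooth_fun A (f i)" "\<And>i. smooth_vector_field A (Y i)" "smooth_vector_field A X"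
  shows "D X (\<lambda>q. \<Sum>i\<in>I. f i q *\<^sub>R Y i q) = (\<lambda>q. \<Sum>i\<in>I. dfun A (f i) q (X q) *\<^sub>R Y i q + f i q *\<^sub>R D X (Y i) q)"
  using assms(1)
proof (induction I rule: finite_induct)
  case empty
  show ?case using D_scale2[OF smooth_fun_const[of 0] assms(4) lf_smooth[of 0]] by (simp add: dfun_const)
next
  case (insert i I)
  show ?case
    using D_add2[OF assms(4) smooth_vector_field_scale[OF assms(2,3)] smooth_vector_field_sum[OF assms(2,3)], of i i "\<lambda>i. i" "\<lambda>i. i" I]
    by (simp add: insert D_scale2 assms)
qed

lemma vector_field_frame: "X = (\<lambda>q. \<Sum>i\<in>UNIV. (lco q (X q) $ i) *\<^sub>R lf (axis i 1) q)"
proof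
  fix q
  show "X q = (\<Sum>i\<in>UNIV. (lco q (X q) $ i) *\<^sub>R lf (axis i 1) q)"
    using linear_axis_expansion[OF linear_lf, of "lco q (X q)" q] by simp
qed

lemma hld_lco:
  assumes "smooth_vector_field A Y"
  shows "hld (\<lambda>q. lco q (Y q)) p (ld (\<lambda>q. lco q (Y q)) p)"
proof -
  let ?g = "\<lambda>v. (\<chi> i. ld (\<lambda>q. lco q (Y q) $ i) p v)"
  have h: "hld (\<lambda>q. lco q (Y q)) p ?g"
    unfolding hld_def
    by (rule has_derivative_vecI)
       (unfold vec_lambda_beta, rule smooth_fun_hld[OF vector_field_lco_smooth[OF assms], unfolded hld_def])
  from h show ?thesis unfolding hld_ld[OF h] .
qed

lemma D_lf_field:
  assumes Y: "smooth_vector_field A Y"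
  shows "D (lf u) Y p = lf (ld (\<lambda>q. lco q (Y q)) p u + Gam u (lco p (Y p))) p"
proof -
  let ?\<eta> = "\<lambda>i q. lco q (Y q) $ i"
  have \<eta>: "smooth_fun A (?\<eta> i)" for i by (rule vector_field_lco_smooth[OF Y])
  have h: "hld (?\<eta> i) p (\<lambda>v. ld (\<lambda>q. lco q (Y q)) p v $ i)" for i
    using bounded_linear.has_derivative[OF bounded_linear_vec_nth hld_lco[OF Y, of p, unfolded hld_def]]
    by (simp add: hld_def)
  have lin: "linear (\<lambda>v. lf (Gam u v) p)"
    using linear_compose[OF linear_Gam2[of u] linear_lf[of p]] by (simp add: o_def)
  have "D (lf u) Y p = (\<Sum>i\<in>UNIV. dfun A (?\<eta> i) p (lf u p) *\<^sub>R lf (axis i 1) p + ?\<eta> i p *\<^sub>R D (lf u) (lf (axis i 1)) p)"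
    using fun_cong[OF D_sum2[where I=UNIV and f="?\<eta>" and Y="\<lambda>i. lf (axis i 1)" and X="lf u", OF finite \<eta> lf_smooth lf_smooth], of p]
    unfolding vector_field_frame[of Y, symmetric] .
  also have "\<dots> = (\<Sum>i\<in>UNIV. (ld (\<lambda>q. lco q (Y q)) p u $ i) *\<^sub>R lf (axis i 1) p) + (\<Sum>i\<in>UNIV. ?\<eta> i p *\<^sub>R lf (Gam u (axis i 1)) p)"
    by (simp add: dfun_lf[OF h] D_lf sum.distrib)
  also have "\<dots> = lf (ld (\<lambda>q. lco q (Y q)) p u) p + lf (Gam u (lco p (Y p))) p"
    using linear_axis_expansion[OF linear_lf, of "ld (\<lambda>q. lco q (Y q)) p u" p]
      linear_axis_expansion[OF lin, of "lco p (Y p)"] by simp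
  finally show ?thesis by (simp add: linear_add[OF linear_lf])
qed

text \<open>Both fields are expanded in the left invariant frame, which is global, and the Leibniz
  rule reduces everything to \<open>D_lf\<close>. Hence the associated connection is known on all
  smooth fields, not only on invariant ones.\<close>

lemma D_expand:
  assumes X: "smooth_vector_field A X" and Y: "smooth_vector_field A Y"
  shows "D X Y p = lf (ld (\<lambda>q. lco q (Y q)) p (lco p (X p)) + Gam (lco p (X p)) (lco p (Y p))) p"
proof -
  let ?L = "\<lambda>u. lf (ld (\<lambda>q. lco q (Y q)) p u + Gam u (lco p (Y p))) p"
  have lin: "linear ?L"
    using linear_compose[OF linear_compose_add[OF linear_ld[OF hld_lco[OF Y, of p]] linear_Gam1[of "lco p (Y p)"]] linear_lf[of p]]
    by (simp add: o_def)
  have "D X Y p = (\<Sum>i\<in>UNIV. (lco p (X p) $ i) *\<^sub>R D (lf (axis i 1)) Y p)"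
    using fun_cong[OF D_sum1[where I=UNIV and f="\<lambda>i q. lco q (X q) $ i" and X="\<lambda>i. lf (axis i 1)", OF finite vector_field_lco_smooth[OF X] lf_smooth Y], of p]
    unfolding vector_field_frame[of X, symmetric] .
  also have "\<dots> = ?L (lco p (X p))"
    unfolding D_lf_field[OF Y] by (rule linear_axis_expansion[OF lin, symmetric])
  finally show ?thesis .
qed

end

section \<open>Affine charts\<close>

context symplectic_connection
begin

lemma cov_deriv_one_form:
  "cov_deriv A D 1 (\<lambda>p v. \<beta> p (v 0)) X Y p = dfun A (\<lambda>q. \<beta> q (Y 0 q)) p (X p) - \<beta> p (D X (Y 0) p)"
  by (simp add: cov_deriv_def)

text \<open>Along \<open>w\<close> the vector \<open>Ad (iv p) u\<close> changes by minus its
  bracket with \<open>w\<close>, while \<open>Gam\<close> is minus the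
  \<open>\<omega>\<close>-adjoint of the bracket. The two contributions to the covariant derivative
  cancel.\<close>

lemma parallel_one_form_al:
  assumes U: "open U" and \<beta>: "\<And>p v. p \<in> U \<Longrightarrow> \<beta> p (lf v p) = al u p v"
  shows "parallel_form_on A D U 1 (\<lambda>p v. \<beta> p (v 0))"
  unfolding parallel_form_on_def cov_deriv_one_form
proof (intro allI impI ballI)
  fix X :: "'a \<Rightarrow> real^'n" and Y :: "nat \<Rightarrow> 'a \<Rightarrow> real^'n" and p
  assume "smooth_vector_field A X \<and> (\<forall>j<1. smooth_vector_field A (Y j))" and p: "p \<in> U"
  then have X: "smooth_vector_field A X" and Y: "smooth_vector_field A (Y 0)" by auto
  let ?\<eta> = "\<lambda>q. lco q (Y 0 q)" and ?\<xi> = "lco p (X p)" and ?u = "Ad (iv p) u"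
  have "((\<lambda>z. w0 (Ad (iv (lt p z)) u) (?\<eta> (lt p z))) has_derivative
      (\<lambda>w. w0 (Ad (iv (lt p z0)) u) (ld ?\<eta> p w) + w0 (- br w ?u) (?\<eta> (lt p z0)))) (at z0)"
    by (rule bounded_bilinear.FDERIV[OF w0_bilinear hld_Ad_iv[unfolded hld_def] hld_lco[OF Y, unfolded hld_def]])
  then have "hld (\<lambda>q. al u q (?\<eta> q)) p (\<lambda>w. w0 ?u (ld ?\<eta> p w) + w0 (- br w ?u) (?\<eta> p))"
    by (simp add: hld_def)
  then have "hld (\<lambda>q. \<beta> q (Y 0 q)) p (\<lambda>w. w0 ?u (ld ?\<eta> p w) + w0 (- br w ?u) (?\<eta> p))"
    by (rule hld_cong[OF U p, rotated]) (metis \<beta> lf_lco)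
  from dfun_lf[OF this, of ?\<xi>]
  have 1: "dfun A (\<lambda>q. \<beta> q (Y 0 q)) p (X p) = w0 ?u (ld ?\<eta> p ?\<xi>) - w0 (br ?\<xi> ?u) (?\<eta> p)"
    by (simp add: w0_lin)
  have 2: "\<beta> p (D X (Y 0) p) = w0 ?u (ld ?\<eta> p ?\<xi>) + w0 ?u (Gam ?\<xi> (?\<eta> p))"
    unfolding D_expand[OF X Y] \<beta>[OF p] by (rule linear_add[OF w0_linear2])
  have "w0 ?u (Gam ?\<xi> (?\<eta> p)) = - w0 (br ?\<xi> ?u) (?\<eta> p)"
    using w0_antisym[of ?u "Gam ?\<xi> (?\<eta> p)"] w0_antisym[of "br ?\<xi> ?u" "?\<eta> p"] by (simp add: w0_Gam)
  with 1 2 show "dfun A (\<lambda>q. \<beta> q (Y 0 q)) p (X p) - \<beta> p (D X (Y 0) p) = 0" by simp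
qed

lemma hld_vec_nth: "hld f p f' \<Longrightarrow> hld (\<lambda>q. f q $ i) p (\<lambda>v. f' v $ i)"
  unfolding hld_def by (rule bounded_linear.has_derivative[OF bounded_linear_vec_nth])

lemma affine_chartD:
  assumes "affine_chart A D c"
  shows "smooth_chart A c" "connected (fst c)" "open (fst c)"
    "\<And>i. parallel_form_on A D (fst c) 1 (\<lambda>p v. dfun A (\<lambda>q. snd c q $ i) p (v 0))"
  using assms is_chartD(1)[OF smooth_chart_chart] unfolding affine_chart_def by blast+

lemma dfun_coordinate:
  assumes "smooth_chart A c" "p \<in> fst c"
  shows "dfun A (\<lambda>q. snd c q $ i) p (lf v p) = ld (snd c) p v $ i"
  by (rule dfun_lf[OF hld_vec_nth[OF hld_chart[OF assms]]])

text \<open>Supplies only the existence of the derivative, through a transition map to a chart of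
  the atlas; for affine charts its value is then dictated by parallelism.\<close>

lemma ld_chart_differentiable:
  assumes c: "smooth_chart A c" and p: "p \<in> fst c"
  shows "\<exists>G. hld (\<lambda>q. ld (snd c) q v) p G"
proof -
  let ?k = "chart_at A p"
  note ks = chart_at_smooth[of p]
  note K = chart_atD[where g=p]
  note tr = transition_smooth(1,2)[OF c chart_at(1)[of p]]
  let ?t = "\<lambda>y. snd c (chart_inv ?k y)" and ?S = "snd ?k ` (fst c \<inter> fst ?k)"
  let ?M = "\<lambda>y. ld (snd ?k) (chart_inv ?k y) v"
  have rel: "ld (snd c) (chart_inv ?k y) v = fderiv ?t y (?M y)" if y: "y \<in> ?S" for y
  proof -
    have q: "chart_inv ?k y \<in> fst ?k" "snd ?k (chart_inv ?k y) = y" using y K(5) by auto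
    have "(?t has_derivative fderiv ?t y) (at (snd ?k (chart_inv ?k y)))"
      using smooth_on_has_derivative[OF tr(2) y] q(2) by simp
    from hld_ld[OF hld_from_chart[OF ks q(1) this]] show ?thesis by simp
  qed
  have pin: "snd ?k p \<in> ?S" using p chart_at(2) by blast
  have C2: "Ck_on 2 ?S ?t" using tr(2) unfolding smooth_on_def by blast
  have pin': "snd ?k p \<in> snd ?k ` fst ?k" using chart_at(2) by blast
  note M' = smooth_on_has_derivative[OF ld_chart_smooth[OF chart_at(1)] pin', of v]
  note d = has_derivative_directional[where \<phi>="\<lambda>y. y" and x="snd ?k p", OF tr(1) C2 pin has_derivative_ident M']
  obtain G where G: "((\<lambda>z. fderiv ?t z (?M z)) has_derivative G) (at (snd ?k p))"
    by (rule that, rule d)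
  have "((\<lambda>y. ld (snd c) (chart_inv ?k y) v) has_derivative G) (at (snd ?k p))"
    by (rule has_derivative_cong_open[OF G tr(1) pin]) (simp only: rel)
  note h = hld_from_chart[OF ks chart_at(2) this]
  show ?thesis by (rule exI, rule h)
qed

text \<open>Testing \<open>\<nabla>dx_i = 0\<close> on left invariant fields says that the
  derivative of \<open>dx_i\<close> on the field of \<open>v\<close> along that of \<open>u\<close>
  is \<open>dx_i\<close> applied to \<open>Gam u v\<close>.\<close>

lemma affine_chart_second_derivative:
  assumes c: "affine_chart A D c" and p: "p \<in> fst c"
  shows "hld (\<lambda>q. ld (snd c) q v) p (\<lambda>u. ld (snd c) p (Gam u v))"
proof -
  note C = affine_chartD[OF c]
  obtain G where G: "hld (\<lambda>q. ld (snd c) q v) p G" using ld_chart_differentiable[OF C(1) p] ..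
  have "G u $ i = ld (snd c) p (Gam u v) $ i" for u i
  proof -
    let ?T = "\<lambda>p v. dfun A (\<lambda>q. snd c q $ i) p (v 0)"
    have "cov_deriv A D 1 ?T (lf u) (\<lambda>_. lf v) p = 0"
      using C(4)[of i] p by (simp add: parallel_form_on_def lf_smooth)
    then have e: "dfun A (\<lambda>q. dfun A (\<lambda>q. snd c q $ i) q (lf v q)) p (lf u p) = dfun A (\<lambda>q. snd c q $ i) p (D (lf u) (lf v) p)"
      unfolding cov_deriv_one_form by simp
    have "hld (\<lambda>q. dfun A (\<lambda>q. snd c q $ i) q (lf v q)) p (\<lambda>u. G u $ i)"
      by (rule hld_cong[OF C(3) p _ hld_vec_nth[OF G]]) (simp add: dfun_coordinate[OF C(1)])
    from dfun_lf[OF this] e show ?thesis by (simp add: D_lf dfun_coordinate[OF C(1) p])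
  qed
  then have "G = (\<lambda>u. ld (snd c) p (Gam u v))" by (auto simp: vec_eq_iff)
  from G[unfolded this] show ?thesis .
qed

lemma w0_dual_basis: "\<exists>d :: 'n \<Rightarrow> real^'n. \<forall>j v. w0 (d j) v = v $ j"
proof -
  have "\<exists>x. \<forall>v. w0 x v = v $ j" for j
    by (rule w0_riesz) (simp add: linear_conv_bounded_linear bounded_linear_vec_nth)
  then show ?thesis by metis
qed

text \<open>A parallel 1-form is \<open>\<omega>(b\<^sup>-, \<cdot>)\<close> for a right invariant field \<open>b\<^sup>-\<close>; in the left
  trivialization \<open>b\<^sup>-\<close> is \<open>p \<mapsto> Ad(p\<inverse>) b\<close>.\<close>

lemma affine_chart_covectors:
  assumes c: "affine_chart A D c"
  shows "\<exists>b :: 'n \<Rightarrow> real^'n. \<forall>p\<in>fst c. \<forall>i v. ld (snd c) p v $ i = al (b i) p v"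
proof (cases "fst c = {}")
  case False
  then obtain p0 where p0: "p0 \<in> fst c" by blast
  note C = affine_chartD[OF c]
  obtain d :: "'n \<Rightarrow> real^'n" where d: "\<And>j v. w0 (d j) v = v $ j" using w0_dual_basis by blast
  define s where "s i p v = ld (snd c) p v $ i" for i p v
  define \<sigma> where "\<sigma> i p = (\<Sum>j\<in>UNIV. s i p (axis j 1) *\<^sub>R d j)" for i p
  have lins: "linear (s i p)" if "p \<in> fst c" for i p
    using linear_compose[OF linear_ld[OF hld_chart[OF C(1) that]], of "\<lambda>v. v $ i"]
    by (simp add: s_def[abs_def] o_def linear_conv_bounded_linear bounded_linear_vec_nth)
  have w\<Sigma>: "w0 (\<Sum>j\<in>UNIV. t j *\<^sub>R d j) v = (\<Sum>j\<in>UNIV. t j * v $ j)" for t v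
    by (simp add: w0_lin d)
  have w\<sigma>: "w0 (\<sigma> i p) v = s i p v" if "p \<in> fst c" for i p v
    unfolding \<sigma>_def w\<Sigma> using linear_axis_expansion[OF lins[OF that], of i v] by (simp add: mult.commute)
  \<comment> \<open>\<open>\<sigma> i p\<close> represents \<open>dx_i\<close> through
    \<open>w0\<close>, and \<open>Ad p (\<sigma> i p)\<close> is the candidate for the constant
    \<open>b i\<close>. It is written as a sum over the fixed vectors \<open>d j\<close> so that the
    product rule applies to scalar coefficients and to \<open>Ad\<close> separately.\<close>
  define f where "f i p = (\<Sum>j\<in>UNIV. s i p (axis j 1) *\<^sub>R Ad p (d j))" for i p
  have fAd: "f i p = Ad p (\<sigma> i p)" for i p
    by (simp add: f_def \<sigma>_def Ad_lin)
  have hs: "hld (\<lambda>q. s i q v) p (\<lambda>u. s i p (Gam u v))" if "p \<in> fst c" for i p v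
    unfolding s_def by (rule hld_vec_nth[OF affine_chart_second_derivative[OF c that]])
  have der: "hld (f i) p (\<lambda>_. 0)" if p: "p \<in> fst c" for i p
  proof -
    have "((\<lambda>z. \<Sum>j\<in>UNIV. s i (lt p z) (axis j 1) *\<^sub>R Ad (lt p z) (d j)) has_derivative
      (\<lambda>w. \<Sum>j\<in>UNIV. s i (lt p z0) (axis j 1) *\<^sub>R Ad p (br w (d j)) + s i p (Gam w (axis j 1)) *\<^sub>R Ad (lt p z0) (d j))) (at z0)"
      by (intro has_derivative_sum has_derivative_scaleR hs[OF p, unfolded hld_def] hld_Ad[unfolded hld_def])
    moreover have "(\<Sum>j\<in>UNIV. s i (lt p z0) (axis j 1) *\<^sub>R Ad p (br w (d j)) + s i p (Gam w (axis j 1)) *\<^sub>R Ad (lt p z0) (d j)) = 0" for w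
    proof -
      \<comment> \<open>The left-hand side is the derivative of \<open>\<sigma> i\<close> along
        \<open>w\<close>. Parallelism thus gives it the same differential equation as
        \<open>Ad (iv p) u\<close>, which makes \<open>Ad p (\<sigma> i p)\<close> constant.\<close>
      have "(\<Sum>j\<in>UNIV. s i p (Gam w (axis j 1)) *\<^sub>R d j) = - br w (\<sigma> i p)"
      proof (rule w0_eqI)
        fix v
        have "linear (\<lambda>v. s i p (Gam w v))"
          using linear_compose[OF linear_Gam2 lins[OF p]] by (simp add: o_def)
        from linear_axis_expansion[OF this, of v]
        have "w0 (\<Sum>j\<in>UNIV. s i p (Gam w (axis j 1)) *\<^sub>R d j) v = s i p (Gam w v)"
          unfolding w\<Sigma> by (simp add: mult.commute)
        also have "\<dots> = w0 (- br w (\<sigma> i p)) v"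
          using w0_antisym[of "\<sigma> i p" "Gam w v"] w0_antisym[of "br w (\<sigma> i p)" v]
          by (simp add: w\<sigma>[OF p, symmetric] w0_Gam w0_lin)
        finally show "w0 (\<Sum>j\<in>UNIV. s i p (Gam w (axis j 1)) *\<^sub>R d j) v = w0 (- br w (\<sigma> i p)) v" .
      qed
      moreover have "(\<Sum>j\<in>UNIV. s i p (axis j 1) *\<^sub>R br w (d j)) = br w (\<sigma> i p)"
        by (simp add: \<sigma>_def linear_sum[OF linear_br2] linear_cmul[OF linear_br2])
      ultimately have "(\<Sum>j\<in>UNIV. s i p (axis j 1) *\<^sub>R br w (d j) + s i p (Gam w (axis j 1)) *\<^sub>R d j) = 0"
        by (simp add: sum.distrib)
      then have "Ad p (\<Sum>j\<in>UNIV. s i p (axis j 1) *\<^sub>R br w (d j) + s i p (Gam w (axis j 1)) *\<^sub>R d j) = 0"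
        by (simp add: linear_0[OF linear_Ad])
      then show ?thesis
        by (simp add: Ad_lin)
    qed
    ultimately show ?thesis by (simp add: hld_def f_def)
  qed
  have "s i p v = al (f i p0) p v" if p: "p \<in> fst c" for i p v
  proof -
    have "f i p = f i p0" by (rule constant_on_connected[OF C(3,2) der p p0])
    then have "Ad (iv p) (f i p0) = \<sigma> i p" by (metis fAd Ad_iv(2))
    then show ?thesis by (simp add: w\<sigma>[OF p])
  qed
  from this[unfolded s_def] show ?thesis by (intro exI[where x="\<lambda>i. f i p0"] ballI allI)
qed simp

text \<open>\<open>a\<close> is the coordinate expression of the 1-form \<open>al b\<close> in the
  chart \<open>k\<close>. The symmetry of its Jacobian is the closedness of that form, hence another
  guise of the cocycle identity.\<close>

lemma parallel_gradient:
  assumes k: "k \<in> A"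
  obtains a where "smooth_on (snd k ` fst k) a"
    "\<And>y v. y \<in> snd k ` fst k \<Longrightarrow> a y \<bullet> ld (snd k) (chart_inv k y) v = al b (chart_inv k y) v"
    "\<And>y h h'. y \<in> snd k ` fst k \<Longrightarrow> fderiv a y h \<bullet> h' = fderiv a y h' \<bullet> h"
proof -
  note ks = atlas_smooth_chart[OF k]
  note K = is_chartD[OF atlas_chart[OF k]]
  let ?S = "snd k ` fst k" and ?p = "chart_inv k"
  define M where "M y = ld (snd k) (?p y)" for y
  have linM: "linear (M y)" if "y \<in> ?S" for y
    unfolding M_def by (rule linear_ld[OF hld_chart[OF ks K(7)[OF that]]])
  have Msmooth: "smooth_on ?S (\<lambda>y. M y v)" for v unfolding M_def by (rule ld_chart_smooth[OF k])
  have Minv: "M y (lcoord k (?p y) h) = h" "lcoord k (?p y) (M y v) = v" if "y \<in> ?S" for y h v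
    unfolding M_def using ld_lcoord[OF ks K(7)[OF that]] lcoord_ld[OF ks K(7)[OF that]] by auto
  define a where "a y = (\<chi> j. al b (?p y) (lcoord k (?p y) (axis j 1)))" for y
  have aM: "a y \<bullet> M y v = al b (?p y) v" if y: "y \<in> ?S" for y v
  proof -
    have "linear (\<lambda>h. al b (?p y) (lcoord k (?p y) h))"
      using linear_compose[OF linear_lcoord[OF ks K(7)[OF y]] w0_linear2] by (simp add: o_def)
    from linear_axis_expansion[OF this, of "M y v"]
    show ?thesis by (simp add: a_def inner_vec_def Minv[OF y] mult.commute)
  qed
  \<comment> \<open>\<open>a y\<close> is recovered from its inner products with the columns of
    \<open>M y\<close>, whose smoothness and that of the right-hand side are already known.\<close>
  have asm: "smooth_on ?S a"
  proof (rule smooth_on_linear_solve'[where M="\<lambda>y x. \<chi> j. x \<bullet> M y (axis j 1)" and b="\<lambda>y. \<chi> j. al b (?p y) (axis j 1)"])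
    show "smooth_on ?S (\<lambda>y. \<chi> j. v \<bullet> M y (axis j 1))" for v
      by (rule smooth_on_vecI[OF K(2)])
         (simp add: smooth_on_bounded_linear[OF K(2) bounded_linear_inner_right Msmooth])
    show "smooth_on ?S (\<lambda>y. \<chi> j. al b (?p y) (axis j 1))"
      by (rule smooth_on_vecI[OF K(2)])
         (simp add: smooth_on_bounded_linear[OF K(2) bounded_bilinear.bounded_linear_left[OF w0_bilinear] Ad_iv_smooth[OF k]])
    fix y assume y: "y \<in> ?S"
    show "linear (\<lambda>x. \<chi> j. x \<bullet> M y (axis j 1))"
      by (rule linearI) (simp_all add: vec_eq_iff inner_left_distrib)
    show "x = 0" if "(\<chi> j. x \<bullet> M y (axis j 1)) = 0" for x
    proof -
      have z: "x \<bullet> M y (axis j 1) = 0" for j using that by (simp add: vec_eq_iff)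
      have "linear (\<lambda>v. x \<bullet> M y v)"
        using linear_compose[OF linM[OF y], of "\<lambda>v. x \<bullet> v"] by (simp add: o_def linear_conv_bounded_linear bounded_linear_inner_right)
      from linear_axis_expansion[OF this] z have "x \<bullet> M y v = 0" for v by simp
      from this[of "lcoord k (?p y) x"] show ?thesis by (simp add: Minv[OF y])
    qed
    show "(\<chi> j. a y \<bullet> M y (axis j 1)) = (\<chi> j. al b (?p y) (axis j 1))" by (simp add: aM[OF y])
  qed (rule K(2))
  \<comment> \<open>The product rule for \<open>a y \<bullet> M y v = al b (?p y) v\<close>, with
    the derivative of \<open>al\<close> known from \<open>hld_al\<close>.\<close>
  have key: "fderiv a y (M y u) \<bullet> M y v
      = - w0 (br u (Ad (iv (?p y)) b)) v - a y \<bullet> fderiv (local_rep A k (lf v)) y (M y u)"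
    if y: "y \<in> ?S" for y u v
  proof -
    have p: "?p y \<in> fst k" "snd k (?p y) = y" using K(6,7)[OF y] by auto
    have Md: "((\<lambda>y. M y v) has_derivative fderiv (local_rep A k (lf v)) y) (at y)"
      by (rule has_derivative_cong_open[OF local_rep_lf_has_derivative[OF k p(1), unfolded p(2)] K(2) y])
         (simp add: local_rep_lf[OF ks] M_def)
    have d1: "((\<lambda>y. a y \<bullet> M y v) has_derivative
       (\<lambda>h. a y \<bullet> fderiv (local_rep A k (lf v)) y h + fderiv a y h \<bullet> M y v)) (at y)"
      by (rule has_derivative_inner[OF smooth_on_has_derivative[OF asm y] Md])
    have "((\<lambda>y. al b (?p y) v) has_derivative (\<lambda>h. - w0 (br (lcoord k (?p y) h) (Ad (iv (?p y)) b)) v)) (at y)"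
      using chart_from_hld[OF ks p(1) hld_al[of b v]] unfolding p(2) .
    then have d2: "((\<lambda>y. a y \<bullet> M y v) has_derivative (\<lambda>h. - w0 (br (lcoord k (?p y) h) (Ad (iv (?p y)) b)) v)) (at y)"
      by (rule has_derivative_cong_open[OF _ K(2) y]) (simp add: aM)
    from fun_cong[OF has_derivative_unique[OF d1 d2], of "M y u"] show ?thesis by (simp add: Minv[OF y])
  qed
  have sym: "fderiv a y h \<bullet> h' = fderiv a y h' \<bullet> h" if y: "y \<in> ?S" for y h h'
  proof -
    let ?u = "lcoord k (?p y) h" and ?v = "lcoord k (?p y) h'" and ?b = "Ad (iv (?p y)) b"
    have p: "?p y \<in> fst k" "snd k (?p y) = y" using K(6,7)[OF y] by auto
    have "fderiv a y (M y ?u) \<bullet> M y ?v - fderiv a y (M y ?v) \<bullet> M y ?u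
       = - w0 (br ?u ?b) ?v + w0 (br ?v ?b) ?u - a y \<bullet> (fderiv (local_rep A k (lf ?v)) y (M y ?u)
            - fderiv (local_rep A k (lf ?u)) y (M y ?v))"
      unfolding key[OF y] inner_diff_right by linarith
    \<comment> \<open>After antisymmetrization the derivatives of the left invariant fields combine
      into their bracket, and what remains is the cocycle identity.\<close>
    also have "\<dots> = - w0 (br ?u ?b) ?v + w0 (br ?v ?b) ?u - a y \<bullet> M y (br ?u ?v)"
      using bracket_chart[OF k p(1), of ?v ?u] by (simp add: p(2) M_def)
    also have "\<dots> = - w0 (br ?u ?b) ?v + w0 (br ?v ?b) ?u - w0 ?b (br ?u ?v)"
      unfolding aM[OF y] ..
    also have "\<dots> = 0"
      using cocycle[of ?u ?b ?v] br_antisym[of ?v ?b] br_antisym[of ?v ?u] w0_antisym[of ?b "br ?u ?v"]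
      by (simp add: w0_lin)
    finally show ?thesis by (simp add: Minv[OF y])
  qed
  show thesis by (rule that[OF asm aM[unfolded M_def] sym])
qed

text \<open>The closed forms \<open>al (axis i 1)\<close> are integrated on a ball to functions
  \<open>f i\<close>. Nondegeneracy of \<open>\<omega>\<close> makes their differentials
  independent, so the inverse function theorem turns them into coordinates.\<close>

lemma affine_chart_exists:
  "\<exists>c. affine_chart A D c \<and> g \<in> fst c \<and> (\<forall>p\<in>fst c. \<forall>i v. ld (snd c) p v $ i = al (axis i 1) p v)"
proof -
  let ?k = "chart_at A g"
  note kA = chart_at(1)[of g]
  note ks = atlas_smooth_chart[OF kA]
  note K = is_chartD[OF atlas_chart[OF kA]]
  let ?S = "snd ?k ` fst ?k"
  have "\<exists>a. smooth_on ?S a \<and> (\<forall>y\<in>?S. \<forall>v. a y \<bullet> ld (snd ?k) (chart_inv ?k y) v = al (axis i 1) (chart_inv ?k y) v) \<and>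
     (\<forall>y\<in>?S. \<forall>h h'. fderiv a y h \<bullet> h' = fderiv a y h' \<bullet> h)" for i :: 'n
    by (rule parallel_gradient[OF kA, of "axis i 1"]) blast
  then obtain a :: "'n \<Rightarrow> real^'n \<Rightarrow> real^'n" where asm: "\<And>i. smooth_on ?S (a i)"
    and aM: "\<And>i y v. y \<in> ?S \<Longrightarrow> a i y \<bullet> ld (snd ?k) (chart_inv ?k y) v = al (axis i 1) (chart_inv ?k y) v"
    and sym: "\<And>i y h h'. y \<in> ?S \<Longrightarrow> fderiv (a i) y h \<bullet> h' = fderiv (a i) y h' \<bullet> h"
    by metis
  have gin: "snd ?k g \<in> ?S" using chart_at(2) by blast
  obtain r where r: "r > 0" "ball (snd ?k g) r \<subseteq> ?S" using K(2) gin openE by blast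
  let ?B = "ball (snd ?k g) r"
  have BS: "y \<in> ?S" if "y \<in> ?B" for y using r(2) that by blast
  have "\<exists>f. \<forall>y\<in>?B. (f has_derivative (\<lambda>v. a i y \<bullet> v)) (at y)" for i
  proof (rule gradient_potential[OF open_ball convex_ball])
    show "Ck_on (Suc 0) ?B (a i)" using smooth_on_subset[OF asm r(2)] unfolding smooth_on_def by blast
  qed (rule sym[OF BS])
  then obtain f where f: "\<And>i y. y \<in> ?B \<Longrightarrow> (f i has_derivative (\<lambda>v. a i y \<bullet> v)) (at y)" by metis
  define F where "F y = (\<chi> i. f i y)" for y
  have Fd: "(F has_derivative (\<lambda>v. \<chi> i. a i y \<bullet> v)) (at y)" if "y \<in> ?B" for y
    by (rule has_derivative_vecI) (simp add: F_def f[OF that])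
  \<comment> \<open>The derivative of \<open>F\<close> is given by the smooth maps
    \<open>a i\<close>, so each class \<open>Suc k\<close> is reached directly and then weakened to
    \<open>k\<close>.\<close>
  have Fsm: "smooth_on ?B F"
    unfolding smooth_on_def
  proof (rule allI, rule Ck_on_Suc_imp, rule Ck_on_SucI[OF open_ball Fd], assumption)
    show "Ck_on k ?B (\<lambda>y. \<chi> i. a i y \<bullet> v)" for k v
    proof (rule Ck_on_vecI[OF open_ball])
      show "Ck_on k ?B (\<lambda>y. (\<chi> i. a i y \<bullet> v) $ i)" for i
        using smooth_on_bounded_linear[OF open_ball bounded_linear_inner_left smooth_on_subset[OF asm r(2)], of i v]
        unfolding smooth_on_def by simp
    qed
  qed
  have inj: "h = 0" if y: "y \<in> ?B" and "fderiv F y h = 0" for y h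
  proof -
    let ?v = "lcoord ?k (chart_inv ?k y) h" and ?p = "chart_inv ?k y"
    have h: "h = ld (snd ?k) ?p ?v" by (rule ld_lcoord[OF ks K(7)[OF BS[OF y]], symmetric])
    have "(\<chi> i. a i y \<bullet> h) = 0" using that(2) unfolding frechet_derivativeI[OF Fd[OF y]] .
    then have "a i y \<bullet> h = 0" for i by (simp add: vec_eq_iff)
    then have "al (axis i 1) ?p ?v = 0" for i using aM[OF BS[OF y], of i ?v] h by simp
    moreover have "linear (\<lambda>x. al x ?p ?v)"
      using linear_compose[OF linear_Ad w0_linear1] by (simp add: o_def)
    ultimately have "al x ?p ?v = 0" for x using linear_axis_expansion[of "\<lambda>x. al x ?p ?v" x] by simp
    \<comment> \<open>Since \<open>Ad ?p\<close> inverts \<open>Ad (iv ?p)\<close>, the vanishing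
      holds for every first argument of \<open>w0\<close>, and nondegeneracy applies.\<close>
    from this[of "Ad ?p x" for x] have "w0 x ?v = 0" for x by simp
    then have "?v = 0" using w0_nondeg[of ?v] w0_antisym[of ?v] by simp
    then show ?thesis using h linear_0[OF linear_ld[OF hld_chart[OF ks K(7)[OF BS[OF y]]]]] by simp
  qed
  obtain U V G where U: "open U" "connected U" "U \<subseteq> ?B" "snd ?k g \<in> U" and V: "open V"
    and hom: "homeomorphism U V F G" and G: "smooth_on V G"
    by (rule smooth_local_inverse[OF open_ball Fsm centre_in_ball[THEN iffD2, OF r(1)] inj])
  \<comment> \<open>The new chart is the chart around \<open>g\<close> followed by the local
    diffeomorphism \<open>F\<close>; both compatibility conditions are then compositions with
    transition maps of the atlas.\<close>
  define c where "c = (chart_inv ?k ` U, \<lambda>p. F (snd ?k p))"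
  have US: "U \<subseteq> ?S" using U(3) r(2) by blast
  have fstc: "fst c = chart_inv ?k ` U" "snd c = (\<lambda>p. F (snd ?k p))" by (simp_all add: c_def)
  have pc: "p \<in> fst ?k" "snd ?k p \<in> U" if "p \<in> fst c" for p
    using that US K(6,7) unfolding fstc by auto
  have fstc': "fst c = fst ?k \<inter> snd ?k -` U"
    using US K(5,6,7) unfolding fstc by force
  have openc: "open (fst c)" unfolding fstc' by (rule continuous_open_preimage[OF K(3,1) U(1)])
  have homk: "homeomorphism (fst c) U (snd ?k) (chart_inv ?k)"
    unfolding homeomorphism_def
    using US K(5,6,7) pc fstc(1) continuous_on_subset[OF K(4) US] continuous_on_subset[OF K(3), of "fst c"]
    by (auto simp: image_image subset_iff intro: image_eqI)
  have homc: "homeomorphism (fst c) V (snd c) (chart_inv ?k \<circ> G)"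
    using homeomorphism_compose[OF homk hom] unfolding fstc(2) by (simp add: o_def)
  have ci: "chart_inv c y = chart_inv ?k (G y)" if "y \<in> V" for y
  proof -
    have "inj_on (snd c) (fst c)" using homc unfolding homeomorphism_def by (metis inj_on_inverseI)
    then show ?thesis
      unfolding chart_inv_def[of c] using homc that by (intro inv_into_f_eq) (auto simp: homeomorphism_def)
  qed
  have imc: "snd c ` fst c = V" using homc unfolding homeomorphism_def by blast
  have "homeomorphism (fst c) V (snd c) (chart_inv c)"
    by (rule homeomorphism_cong[OF homc]) (simp_all add: ci)
  then have chart: "is_chart c" unfolding is_chart_def imc using openc V by simp
  have GU: "G ` V = U" "\<And>x. x \<in> U \<Longrightarrow> G (F x) = x" using hom unfolding homeomorphism_def by auto
  have compat: "smooth_compat c d" if d: "d \<in> A" for d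
  proof -
    note tr = transition_smooth[OF atlas_smooth_chart[OF d] kA]
    note Dd = is_chartD[OF atlas_chart[OF d]]
    have o1: "open (snd c ` (fst c \<inter> fst d))" by (rule chart_image_open[OF chart]) (use openc Dd(1) in auto)
    have o2: "open (snd d ` (fst c \<inter> fst d))" by (rule chart_image_open[OF atlas_chart[OF d]]) (use openc Dd(1) in auto)
    have sub1: "snd c ` (fst c \<inter> fst d) \<subseteq> V" using imc by blast
    have g1: "G ` (snd c ` (fst c \<inter> fst d)) \<subseteq> snd ?k ` (fst d \<inter> fst ?k)"
      using pc GU(2) unfolding fstc(2) by (auto simp: image_image)
    have "smooth_on (snd c ` (fst c \<inter> fst d)) (\<lambda>y. snd d (chart_inv ?k (G y)))"
      by (rule smooth_on_compose[OF o1 tr(1) g1 tr(2) smooth_on_subset[OF G sub1]])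
    then have 1: "smooth_on (snd c ` (fst c \<inter> fst d)) (snd d \<circ> chart_inv c)"
      by (rule smooth_on_cong[OF o1, rotated]) (use sub1 ci in auto)
    have s2: "smooth_on (snd d ` (fst c \<inter> fst d)) (\<lambda>y. snd ?k (chart_inv d y))"
      by (rule smooth_on_subset[OF tr(4)]) (use pc in auto)
    have "(\<lambda>y. snd ?k (chart_inv d y)) ` (snd d ` (fst c \<inter> fst d)) \<subseteq> ?B"
      using pc U(3) Dd(5) by auto
    from smooth_on_compose[OF o2 open_ball this Fsm s2]
    have 2: "smooth_on (snd d ` (fst c \<inter> fst d)) (snd c \<circ> chart_inv d)" by (simp add: fstc(2) o_def)
    from 1 2 show ?thesis unfolding smooth_compat_def by simp
  qed
  have cs: "smooth_chart A c" unfolding smooth_chart_def using chart compat by simp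
  have "connected (fst c)" unfolding fstc(1)
    by (rule connected_continuous_image[OF continuous_on_subset[OF K(4) US] U(2)])
  have ldc: "ld (snd c) p v $ i = al (axis i 1) p v" if p: "p \<in> fst c" for p i v
  proof -
    have y: "snd ?k p \<in> U" "snd ?k p \<in> ?B" "snd ?k p \<in> ?S" "chart_inv ?k (snd ?k p) = p"
      using pc[OF p] U(3) US K(5) by auto
    have "((\<lambda>y. snd c (chart_inv ?k y)) has_derivative (\<lambda>v. \<chi> i. a i (snd ?k p) \<bullet> v)) (at (snd ?k p))"
      by (rule has_derivative_cong_open[OF Fd[OF y(2)] U(1) y(1)])
         (use US K(6) in \<open>auto simp: fstc(2)\<close>)
    from hld_ld[OF hld_from_chart[OF ks pc(1)[OF p] this]]
    show ?thesis using aM[OF y(3), of i v] y(4) by simp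
  qed
  have par: "parallel_form_on A D (fst c) 1 (\<lambda>p v. dfun A (\<lambda>q. snd c q $ i) p (v 0))" for i
    by (rule parallel_one_form_al[OF openc]) (simp add: dfun_coordinate[OF cs] ldc)
  have "g \<in> fst c" unfolding fstc' using chart_at(2) U(4) by simp
  with cs \<open>connected (fst c)\<close> par have "affine_chart A D c \<and> g \<in> fst c" by (simp add: affine_chart_def)
  with ldc show ?thesis by (intro exI[where x=c]) simp
qed

end

section \<open>Polynomial functions\<close>

abbreviation multi_monomial :: "('n::finite \<Rightarrow> nat) \<Rightarrow> real^'n \<Rightarrow> real" where
  "multi_monomial m y \<equiv> \<Prod>i\<in>UNIV. (y $ i) ^ m i"

lemma finite_multiindices: "finite {m :: 'n::finite \<Rightarrow> nat. (\<Sum>i\<in>UNIV. m i) \<le> d}"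
proof (rule finite_subset)
  show "{m :: 'n \<Rightarrow> nat. (\<Sum>i\<in>UNIV. m i) \<le> d} \<subseteq> PiE UNIV (\<lambda>_. {..d})"
  proof
    fix m :: "'n \<Rightarrow> nat" assume "m \<in> {m. (\<Sum>i\<in>UNIV. m i) \<le> d}"
    then have "m i \<le> d" for i using member_le_sum[of i UNIV m] by simp
    then show "m \<in> PiE UNIV (\<lambda>_. {..d})" by auto
  qed
  show "finite (PiE (UNIV :: 'n set) (\<lambda>_. {..d}))" by (intro finite_PiE) auto
qed

lemma poly_monomial:
  fixes m :: "'n::finite \<Rightarrow> nat"
  assumes "(\<Sum>i\<in>UNIV. m i) \<le> d"
  shows "poly_fun_deg_le d (\<lambda>y. c * multi_monomial m y)"
  unfolding poly_fun_deg_le_def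
proof (intro exI[of _ "\<lambda>m'. if m' = m then c else 0"] allI)
  fix y :: "real^'n"
  have "(\<Sum>m' | (\<Sum>i\<in>UNIV. m' i) \<le> d. (if m' = m then c else 0) * multi_monomial m' y)
      = (\<Sum>m' | (\<Sum>i\<in>UNIV. m' i) \<le> d. if m' = m then c * multi_monomial m' y else 0)"
    by (rule sum.cong) auto
  then show "c * multi_monomial m y = (\<Sum>m' | (\<Sum>i\<in>UNIV. m' i) \<le> d. (if m' = m then c else 0) * multi_monomial m' y)"
    using assms by (simp add: sum.delta'[OF finite_multiindices] sum.delta[OF finite_multiindices])
qed

lemma poly_zero: "poly_fun_deg_le d (\<lambda>y. 0)"
  unfolding poly_fun_deg_le_def by (rule exI[of _ "\<lambda>_. 0"]) simp

lemma poly_add: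
  assumes "poly_fun_deg_le d P" "poly_fun_deg_le d Q"
  shows "poly_fun_deg_le d (\<lambda>y. P y + Q y)"
proof -
  obtain c c' where "\<forall>y. P y = (\<Sum>m | (\<Sum>i\<in>UNIV. m i) \<le> d. c m * multi_monomial m y)"
    "\<forall>y. Q y = (\<Sum>m | (\<Sum>i\<in>UNIV. m i) \<le> d. c' m * multi_monomial m y)"
    using assms unfolding poly_fun_deg_le_def by auto
  then have "\<forall>y. P y + Q y = (\<Sum>m | (\<Sum>i\<in>UNIV. m i) \<le> d. (c m + c' m) * multi_monomial m y)"
    by (simp add: sum.distrib distrib_right)
  then show ?thesis unfolding poly_fun_deg_le_def by (rule exI[of _ "\<lambda>m. c m + c' m"])
qed

lemma poly_sum:
  assumes "\<And>i. i \<in> I \<Longrightarrow> poly_fun_deg_le d (P i)"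
  shows "poly_fun_deg_le d (\<lambda>y. \<Sum>i\<in>I. P i y)"
  using assms by (induction I rule: infinite_finite_induct) (auto simp: poly_zero poly_add)

lemma poly_decomp:
  assumes "poly_fun_deg_le d P"
  obtains c where "P = (\<lambda>y. \<Sum>m | (\<Sum>i\<in>UNIV. m i) \<le> d. c m * multi_monomial m y)"
  using assms unfolding poly_fun_deg_le_def by auto

lemma poly_mult:
  assumes "poly_fun_deg_le d P" "poly_fun_deg_le d' Q"
  shows "poly_fun_deg_le (d + d') (\<lambda>y. P y * Q y)"
proof -
  obtain c where P: "P = (\<lambda>y. \<Sum>m | (\<Sum>i\<in>UNIV. m i) \<le> d. c m * multi_monomial m y)"
    using poly_decomp[OF assms(1)] .
  obtain c' where Q: "Q = (\<lambda>y. \<Sum>m | (\<Sum>i\<in>UNIV. m i) \<le> d'. c' m * multi_monomial m y)"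
    using poly_decomp[OF assms(2)] .
  have eq: "P y * Q y = (\<Sum>m | (\<Sum>i\<in>UNIV. m i) \<le> d. \<Sum>m' | (\<Sum>i\<in>UNIV. m' i) \<le> d'.
      (c m * c' m') * multi_monomial (\<lambda>i. m i + m' i) y)" for y
    unfolding P Q sum_product by (simp add: power_add prod.distrib mult_ac)
  show ?thesis unfolding eq
  proof (intro poly_sum poly_monomial)
    fix m m' :: "'a \<Rightarrow> nat"
    assume "m \<in> {m. (\<Sum>i\<in>UNIV. m i) \<le> d}" "m' \<in> {m. (\<Sum>i\<in>UNIV. m i) \<le> d'}"
    then show "(\<Sum>i\<in>UNIV. m i + m' i) \<le> d + d'" by (simp add: sum.distrib)
  qed
qed

lemma poly_const: "poly_fun_deg_le d (\<lambda>y. c)"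
  using poly_monomial[of "\<lambda>_. 0" d c] by simp

lemma poly_coord:
  fixes i :: "'n::finite"
  shows "poly_fun_deg_le 1 (\<lambda>y :: real^'n. y $ i)"
proof -
  have "(y $ k) ^ (if k = i then 1 else 0) = (if k = i then y $ k else 1)" for y :: "real^'n" and k by simp
  then have "multi_monomial (\<lambda>k. if k = i then 1 else 0) y = y $ i" for y by simp
  with poly_monomial[of "\<lambda>k. if k = i then 1 else 0" 1 1] show ?thesis by simp
qed

lemma poly_affine: "poly_fun_deg_le 1 (\<lambda>y. (\<Sum>k\<in>UNIV. C k * y $ k) + \<mu>)"
  using poly_mult[OF poly_const[of 0] poly_coord] by (intro poly_add poly_sum poly_const) simp

lemma poly_prod:
  assumes "finite I" "\<And>i. i \<in> I \<Longrightarrow> poly_fun_deg_le (d i) (P i)"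
  shows "poly_fun_deg_le (\<Sum>i\<in>I. d i) (\<lambda>y. \<Prod>i\<in>I. P i y)"
  using assms by (induction I rule: finite_induct) (auto simp: poly_const poly_mult)

text \<open>Multilinear expansion, one slot at a time: the induction replaces the first
  \<open>l\<close> arguments by combinations and keeps the others arbitrary. Each slot adds its own
  degree.\<close>

lemma poly_alternating:
  fixes B :: "'n::finite \<Rightarrow> 'v::real_vector"
  assumes T: "alternating k T" and a: "\<And>i l. i < k \<Longrightarrow> poly_fun_deg_le (d i) (a i l)"
  shows "poly_fun_deg_le (\<Sum>i<k. d i) (\<lambda>y. T (\<lambda>i. \<Sum>l\<in>UNIV. a i l y *\<^sub>R B l))"
proof -
  let ?w = "\<lambda>i y. \<Sum>l\<in>UNIV. a i l y *\<^sub>R B l"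
  have "poly_fun_deg_le (\<Sum>i<l. d i) (\<lambda>y. T (\<lambda>i. if i < l then ?w i y else v i))" if "l \<le> k" for l v
    using that
  proof (induction l arbitrary: v)
    case 0
    then show ?case by (simp add: poly_const)
  next
    case (Suc l)
    let ?u = "\<lambda>y i. if i < l then ?w i y else v i"
    have "T (\<lambda>i. if i < Suc l then ?w i y else v i) = (\<Sum>j\<in>UNIV. a l j y * T (\<lambda>i. if i < l then ?w i y else (v(l := B j)) i))" for y
    proof -
      have L: "linear (\<lambda>x. T ((?u y)(l := x)))" by (rule alternating_linear[OF T]) (use Suc.prems in simp)
      have "(\<lambda>i. if i < Suc l then ?w i y else v i) = (?u y)(l := ?w l y)" by auto
      moreover have "(?u y)(l := B j) = (\<lambda>i. if i < l then ?w i y else (v(l := B j)) i)" for j by auto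
      ultimately show ?thesis by (simp add: linear_sum[OF L] linear_cmul[OF L])
    qed
    moreover have "poly_fun_deg_le (d l + (\<Sum>i<l. d i)) (\<lambda>y. \<Sum>j\<in>UNIV. a l j y * T (\<lambda>i. if i < l then ?w i y else (v(l := B j)) i))"
      by (intro poly_sum poly_mult a Suc.IH) (use Suc.prems in auto)
    ultimately show ?case by (simp add: add.commute)
  qed
  from this[of k "\<lambda>_. 0"] have "poly_fun_deg_le (\<Sum>i<k. d i) (\<lambda>y. T (\<lambda>i. if i < k then ?w i y else 0))" by simp
  moreover have "T (\<lambda>i. if i < k then ?w i y else 0) = T (\<lambda>i. ?w i y)" for y
    by (rule alternating_cong[OF T]) simp
  ultimately show ?thesis by simp
qed

text \<open>The origin of the degree \<open>n - 1\<close>: every term of the Leibniz formula takes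
  exactly one factor from the constant column \<open>l\<close>, and the other factors have degree at
  most 1.\<close>

lemma poly_det_column:
  fixes q :: "'n::finite \<Rightarrow> 'n \<Rightarrow> real^'n \<Rightarrow> real"
  assumes "\<And>i j. poly_fun_deg_le 1 (q i j)"
  shows "poly_fun_deg_le (CARD('n) - 1) (\<lambda>y. det (\<chi> i j. if j = l then b i else q i j y))"
proof -
  have "poly_fun_deg_le (CARD('n) - 1) (\<lambda>y. \<Prod>i\<in>UNIV. if \<sigma> i = l then b i else q i (\<sigma> i) y)"
    if "\<sigma> permutes (UNIV :: 'n set)" for \<sigma>
  proof -
    have "poly_fun_deg_le (\<Sum>i\<in>UNIV. if \<sigma> i = l then 0 else 1) (\<lambda>y. \<Prod>i\<in>UNIV. if \<sigma> i = l then b i else q i (\<sigma> i) y)"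
      by (rule poly_prod) (auto simp: poly_const assms[unfolded One_nat_def])
    moreover have "(\<Sum>i\<in>(UNIV::'n set). if \<sigma> i = l then 0 else 1) = CARD('n) - (1::nat)"
    proof -
      have "bij \<sigma>" using that by (rule permutes_bij)
      then have "{i. \<sigma> i \<noteq> l} = UNIV - {inv \<sigma> l}" using bij_inv_eq_iff by fastforce
      moreover have "(\<Sum>i\<in>(UNIV::'n set). if \<sigma> i = l then 0 else 1) = card {i. \<sigma> i \<noteq> l}"
        by (simp add: sum.If_cases Collect_neg_eq)
      ultimately show ?thesis by (simp add: card_Diff_singleton)
    qed
    ultimately show ?thesis by simp
  qed
  then have "poly_fun_deg_le (CARD('n) - 1) (\<lambda>y. \<Sum>\<sigma> | \<sigma> permutes (UNIV :: 'n set). of_int (sign \<sigma>) * (\<Prod>i\<in>UNIV. if \<sigma> i = l then b i else q i (\<sigma> i) y))"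
    using poly_mult[OF poly_const[of 0]] by (intro poly_sum) fastforce
  then show ?thesis by (simp add: det_def)
qed

section \<open>Alternating forms of top degree\<close>

lemma alternating_swap:
  fixes \<Phi> :: "('i \<Rightarrow> 'v::real_vector) \<Rightarrow> real"
  assumes lin: "\<And>f k. linear (\<lambda>x. \<Phi> (f(k := x)))"
    and alt: "\<And>f k l. k \<noteq> l \<Longrightarrow> f k = f l \<Longrightarrow> \<Phi> f = 0" and "m \<noteq> n"
  shows "\<Phi> (f(m := f n, n := f m)) = - \<Phi> f"
proof -
  define G where "G x y = \<Phi> (f(m := x, n := y))" for x y
  have G2: "linear (G x)" for x unfolding G_def by (rule lin)
  have G1: "linear (\<lambda>x. G x y)" for y
    unfolding G_def using lin[of "f(n := y)" m] \<open>m \<noteq> n\<close> by (simp add: fun_upd_twist)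
  have G0: "G x x = 0" for x unfolding G_def using alt[OF \<open>m \<noteq> n\<close>] \<open>m \<noteq> n\<close> by simp
  have "G (f m + f n) (f m + f n) = G (f m) (f m) + G (f m) (f n) + (G (f n) (f m) + G (f n) (f n))"
    by (simp only: linear_add[OF G1] linear_add[OF G2])
  then have "G (f n) (f m) = - G (f m) (f n)" unfolding G0 by linarith
  then show ?thesis by (simp add: G_def)
qed

text \<open>Both sides behave multiplicatively in the matrix, so it is enough to treat zero rows,
  diagonal matrices, transpositions and shears. Indexing by \<open>'n\<close> lets families
  correspond to matrix rows.\<close>

lemma alternating_top_det:
  fixes \<Phi> :: "('n::finite \<Rightarrow> 'v::real_vector) \<Rightarrow> real" and M :: "real^'n^'n"
  assumes lin: "\<And>f k. linear (\<lambda>x. \<Phi> (f(k := x)))"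
    and alt: "\<And>f k l. k \<noteq> l \<Longrightarrow> f k = f l \<Longrightarrow> \<Phi> f = 0"
  shows "\<Phi> (\<lambda>k. \<Sum>j\<in>UNIV. (M $ k $ j) *\<^sub>R f j) = det M * \<Phi> f"
proof (induction M arbitrary: f rule: induct_matrix_elementary_alt)
  case (1 A B)
  have "(\<Sum>j\<in>UNIV. ((A ** B) $ k $ j) *\<^sub>R f j) = (\<Sum>l\<in>UNIV. (A $ k $ l) *\<^sub>R (\<Sum>j\<in>UNIV. (B $ l $ j) *\<^sub>R f j))" for k
    unfolding matrix_matrix_mult_def scaleR_sum_right
    by (subst sum.swap) (simp add: scaleR_sum_left)
  then show ?case by (simp add: 1 det_mul)
next
  case (2 A i)
  let ?g = "\<lambda>k. \<Sum>j\<in>UNIV. (A $ k $ j) *\<^sub>R f j"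
  have "A $ i = 0" using 2 by (simp add: row_def vec_eq_iff)
  then have "?g = ?g(i := 0)" by auto
  then have "\<Phi> ?g = \<Phi> (?g(i := 0))" by simp
  then show ?case using linear_0[OF lin] by (simp add: det_zero_row(1)[OF 2])
next
  case (3 A)
  have e: "(\<Sum>j\<in>UNIV. (A $ k $ j) *\<^sub>R f j) = A $ k $ k *\<^sub>R f k" for k
  proof -
    have "(\<Sum>j\<in>UNIV. (A $ k $ j) *\<^sub>R f j) = (\<Sum>j\<in>{k}. (A $ k $ j) *\<^sub>R f j)"
      by (rule sum.mono_neutral_right) (use 3 in auto)
    then show ?thesis by simp
  qed
  have "\<Phi> (\<lambda>k. if k \<in> S then A $ k $ k *\<^sub>R f k else f k) = (\<Prod>k\<in>S. A $ k $ k) * \<Phi> f" if "finite S" for S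
    using that
  proof (induction S rule: finite_induct)
    case (insert i S)
    let ?h = "\<lambda>k. if k \<in> S then A $ k $ k *\<^sub>R f k else f k"
    have "(\<lambda>k. if k \<in> insert i S then A $ k $ k *\<^sub>R f k else f k) = ?h(i := A $ i $ i *\<^sub>R f i)" by auto
    moreover have "?h(i := f i) = ?h" using insert by auto
    ultimately show ?case using insert linear_cmul[OF lin, of ?h i "A $ i $ i" "f i"] by simp
  qed simp
  from this[of UNIV] show ?case unfolding e using det_diagonal[OF 3] by simp
next
  case (4 m n)
  have "(\<Sum>j\<in>UNIV. ((\<chi> i j. mat 1 $ i $ Transposition.transpose m n j) $ k $ j :: real) *\<^sub>R f j) = (f(m := f n, n := f m)) k" for k
  proof -
    have "(\<Sum>j\<in>UNIV. ((\<chi> i j. mat 1 $ i $ Transposition.transpose m n j) $ k $ j :: real) *\<^sub>R f j)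
        = (\<Sum>j\<in>UNIV. if j = Transposition.transpose m n k then f j else 0)"
      by (rule sum.cong) (auto simp: mat_def transpose_eq_iff)
    also have "\<dots> = f (Transposition.transpose m n k)" by simp
    finally show ?thesis by (auto simp: Transposition.transpose_def)
  qed
  moreover have "det (\<chi> i j. (mat 1 :: real^'n^'n) $ i $ Transposition.transpose m n j) = - 1"
    using det_permute_columns[of "Transposition.transpose m n" "mat 1 :: real^'n^'n"] 4
    by (simp add: permutes_swap_id sign_swap_id)
  moreover have "\<Phi> (f(m := f n, n := f m)) = - \<Phi> f"
    by (rule alternating_swap) (use lin alt 4 in blast)+
  ultimately show ?case by (simp only:)
next
  case (5 m n)
  have "(\<Sum>j\<in>UNIV. ((\<chi> i j. of_bool (i = m \<and> j = n \<or> i = j)) $ k $ j :: real) *\<^sub>R f j) = (f(m := f m + f n)) k" for k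
  proof -
    have "(\<Sum>j\<in>UNIV. ((\<chi> i j. of_bool (i = m \<and> j = n \<or> i = j)) $ k $ j :: real) *\<^sub>R f j)
       = (\<Sum>j\<in>UNIV. (if j = n then (if k = m then f j else 0) else 0) + (if j = k then f j else 0))"
      by (rule sum.cong) (use 5 in auto)
    then show ?thesis by (simp add: sum.distrib)
  qed
  then have "\<Phi> (\<lambda>k. \<Sum>j\<in>UNIV. ((\<chi> i j. of_bool (i = m \<and> j = n \<or> i = j)) $ k $ j :: real) *\<^sub>R f j) = \<Phi> (f(m := f m + f n))"
    by (simp only:)
  also have "\<dots> = \<Phi> (f(m := f m)) + \<Phi> (f(m := f n))" by (rule linear_add[OF lin])
  also have "\<Phi> (f(m := f n)) = 0" using alt[OF 5] 5 by simp
  moreover have "det (\<chi> i j. of_bool (i = m \<and> j = n \<or> i = j) :: real^'n^'n) = 1"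
  proof -
    have "(\<chi> i j. of_bool (i = m \<and> j = n \<or> i = j) :: real^'n^'n) =
       (\<chi> k. if k = m then row m (mat 1) + 1 *s row n (mat 1) else row k (mat 1 :: real^'n^'n))"
      by (use 5 in \<open>auto simp: vec_eq_iff row_def mat_def\<close>)
    then show ?thesis using det_row_operation[OF 5, of "mat 1 :: real^'n^'n" 1] by simp
  qed
  ultimately show ?case by simp
qed

text \<open>Top degree forms scale by the determinant. An enumeration of \<open>'n\<close> transfers
  the form from families indexed by \<open>nat\<close> to families indexed by \<open>'n\<close>,
  where it is a multiple of the determinant.\<close>

lemma alternating_top:
  fixes T :: "(nat \<Rightarrow> real^'n) \<Rightarrow> real"
  assumes T: "alternating CARD('n) T" and L: "linear L"
  shows "T (\<lambda>i. L (v i)) = det (matrix L) * T v"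
proof -
  obtain \<beta> :: "nat \<Rightarrow> 'n" where \<beta>: "bij_betw \<beta> {..<CARD('n)} UNIV"
    using ex_bij_betw_nat_finite[of "UNIV :: 'n set"] by (auto simp: atLeast0LessThan)
  define \<gamma> where "\<gamma> = inv_into {..<CARD('n)} \<beta>"
  have \<gamma>: "\<gamma> k < CARD('n)" "\<beta> (\<gamma> k) = k" for k
    using bij_betw_inv_into_right[OF \<beta>, of k] bij_betw_apply[OF bij_betw_inv_into[OF \<beta>], of k] by (auto simp: \<gamma>_def)
  have \<gamma>': "\<gamma> (\<beta> i) = i" if "i < CARD('n)" for i
    using bij_betw_inv_into_left[OF \<beta>] that by (simp add: \<gamma>_def)
  define \<Phi> where "\<Phi> f = T (\<lambda>i. f (\<beta> i))" for f
  have lin: "linear (\<lambda>x. \<Phi> (f(k := x)))" for f k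
  proof -
    have "\<Phi> (f(k := x)) = T ((\<lambda>i. f (\<beta> i))(\<gamma> k := x))" for x
      unfolding \<Phi>_def by (rule alternating_cong[OF T]) (auto simp: \<gamma> \<gamma>')
    then show ?thesis using alternating_linear[OF T \<gamma>(1)] by simp
  qed
  have alt: "\<Phi> f = 0" if "k \<noteq> l" "f k = f l" for f k l
    unfolding \<Phi>_def by (rule alternating_zero[OF T \<gamma>(1)[of k] \<gamma>(1)[of l]]) (use that \<gamma>(2) in \<open>metis, simp add: \<gamma>\<close>)
  have exp: "\<Phi> g = det (\<chi> k. g k) * \<Phi> (\<lambda>j. axis j 1)" for g
  proof -
    have "\<Phi> (\<lambda>k. \<Sum>j\<in>UNIV. ((\<chi> k. g k) $ k $ j) *\<^sub>R axis j 1) = det (\<chi> k. g k) * \<Phi> (\<lambda>j. axis j 1)"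
      by (rule alternating_top_det[OF lin alt])
    then show ?thesis using vec_axis_expansion[of "g k" for k] by simp
  qed
  let ?f = "\<lambda>k. v (\<gamma> k)"
  have "(\<chi> k. L (?f k)) = (\<chi> k. ?f k) ** transpose (matrix L)"
  proof -
    have "L x = matrix L *v x" for x using matrix_works[of L x] L by simp
    then have "L x $ i = (\<Sum>j\<in>UNIV. matrix L $ i $ j * x $ j)" for x i
      by (simp add: matrix_vector_mult_def)
    then show ?thesis by (simp add: vec_eq_iff matrix_matrix_mult_def transpose_def mult.commute)
  qed
  then have "\<Phi> (\<lambda>k. L (?f k)) = det (matrix L) * \<Phi> ?f"
    by (simp add: exp[of "\<lambda>k. L (?f k)"] exp[of ?f] det_mul det_transpose)
  moreover have "\<Phi> (\<lambda>k. L (?f k)) = T (\<lambda>i. L (v i))" "\<Phi> ?f = T v"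
    unfolding \<Phi>_def by (rule alternating_cong[OF T]; simp add: \<gamma>')+
  ultimately show ?thesis by simp
qed

text \<open>The Leibniz rule for a multilinear form with varying arguments. One slot at a time is
  expanded in the standard basis, which reduces the step to products of real functions.\<close>

lemma alternating_has_derivative:
  fixes g :: "nat \<Rightarrow> 'a::real_normed_vector \<Rightarrow> real^'n"
  assumes T: "alternating k T" and g: "\<And>i. i < k \<Longrightarrow> (g i has_derivative g' i) (at x)"
  shows "((\<lambda>z. T (\<lambda>i. g i z)) has_derivative (\<lambda>h. \<Sum>i<k. T ((\<lambda>j. g j x)(i := g' i h)))) (at x)"
proof -
  have "((\<lambda>z. T (\<lambda>i. if i < l then g i z else v i)) has_derivative
      (\<lambda>h. \<Sum>i<l. T ((\<lambda>j. if j < l then g j x else v j)(i := g' i h)))) (at x)" if "l \<le> k" for l v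
    using that
  proof (induction l arbitrary: v)
    case 0
    then show ?case by simp
  next
    case (Suc l)
    have l: "l < k" "l \<le> k" using Suc.prems by auto
    let ?u = "\<lambda>z v i. if i < l then g i z else v i" and ?w = "\<lambda>z j. if j < Suc l then g j z else v j"
    have upd: "(?w z) = (?u z v)(l := g l z)" for z by auto
    have vupd: "(?u z v)(l := y) = ?u z (v(l := y))" for z y by auto
    have L: "linear (\<lambda>y. T (w(l := y)))" for w by (rule alternating_linear[OF T l(1)])
    have exp: "T (w(l := y)) = (\<Sum>j\<in>UNIV. (y $ j) * T (w(l := axis j 1)))" for w y
      using linear_axis_expansion[OF L, of w y] by simp
    have "((\<lambda>z. \<Sum>j\<in>UNIV. (g l z $ j) * T (?u z (v(l := axis j 1)))) has_derivative
       (\<lambda>h. \<Sum>j\<in>UNIV. (g l x $ j) * (\<Sum>i<l. T ((?u x (v(l := axis j 1)))(i := g' i h))) + (g' l h $ j) * T (?u x (v(l := axis j 1))))) (at x)"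
      by (intro has_derivative_sum has_derivative_mult Suc.IH[OF l(2)]
            bounded_linear.has_derivative[OF bounded_linear_vec_nth g[OF l(1)]])
    moreover have "(\<Sum>j\<in>UNIV. (g l z $ j) * T (?u z (v(l := axis j 1)))) = T (?w z)" for z
      unfolding upd by (subst exp) (simp only: vupd)
    moreover have "(\<Sum>j\<in>UNIV. (g l x $ j) * (\<Sum>i<l. T ((?u x (v(l := axis j 1)))(i := g' i h))) + (g' l h $ j) * T (?u x (v(l := axis j 1))))
       = (\<Sum>i<Suc l. T ((?w x)(i := g' i h)))" for h
    proof -
      have "(\<Sum>j\<in>UNIV. (g l x $ j) * (\<Sum>i<l. T ((?u x (v(l := axis j 1)))(i := g' i h))))
          = (\<Sum>i<l. \<Sum>j\<in>UNIV. (g l x $ j) * T ((?u x (v(l := axis j 1)))(i := g' i h)))"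
        by (simp add: sum_distrib_left sum.swap[of _ UNIV])
      also have "\<dots> = (\<Sum>i<l. T ((?w x)(i := g' i h)))"
      proof (rule sum.cong[OF refl])
        fix i assume i: "i \<in> {..<l}"
        have "(?u x (v(l := axis j 1)))(i := g' i h) = ((?u x v)(i := g' i h))(l := axis j 1)" for j
          using i by auto
        moreover have "(?w x)(i := g' i h) = ((?u x v)(i := g' i h))(l := g l x)"
          using i by auto
        ultimately show "(\<Sum>j\<in>UNIV. (g l x $ j) * T ((?u x (v(l := axis j 1)))(i := g' i h))) = T ((?w x)(i := g' i h))"
          using exp[of "(?u x v)(i := g' i h)" "g l x"] by simp
      qed
      moreover have "(\<Sum>j\<in>UNIV. (g' l h $ j) * T (?u x (v(l := axis j 1)))) = T ((?w x)(l := g' l h))"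
      proof -
        have "(?w x)(l := g' l h) = (?u x v)(l := g' l h)" by auto
        then show ?thesis using exp[of "?u x v" "g' l h"] unfolding vupd by simp
      qed
      ultimately show ?thesis by (simp add: sum.distrib)
    qed
    ultimately show ?case by (simp only:)
  qed
  from this[of k "\<lambda>_. 0"]
  have d: "((\<lambda>z. T (\<lambda>i. if i < k then g i z else 0)) has_derivative
      (\<lambda>h. \<Sum>i<k. T ((\<lambda>j. if j < k then g j x else 0)(i := g' i h)))) (at x)" by simp
  have 1: "T (\<lambda>i. if i < k then g i z else 0) = T (\<lambda>i. g i z)" for z
    by (rule alternating_cong[OF T]) simp
  have 2: "T ((\<lambda>j. if j < k then g j x else 0)(i := y)) = T ((\<lambda>j. g j x)(i := y))" for i y
    by (rule alternating_cong[OF T]) simp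
  show ?thesis using d unfolding 1 2 .
qed

lemma alternating_wedge:
  fixes \<alpha> \<beta> :: "(nat \<Rightarrow> 'v::real_vector) \<Rightarrow> real"
  assumes \<alpha>: "alternating k \<alpha>" and \<beta>: "alternating l \<beta>"
  shows "alternating (k + l) (wedge k l \<alpha> \<beta>)"
proof -
  let ?S = "{\<sigma>. \<sigma> permutes {..<k + l}}"
  let ?t = "\<lambda>v \<sigma>. of_int (sign \<sigma>) * \<alpha> (\<lambda>i. v (\<sigma> i)) * \<beta> (\<lambda>i. v (\<sigma> (k + i)))"
  have w: "wedge k l \<alpha> \<beta> v = (\<Sum>\<sigma>\<in>?S. ?t v \<sigma>) / (fact k * fact l)" for v
    by (simp add: wedge_def)
  have inb: "\<sigma> i < k + l" if "\<sigma> \<in> ?S" "i < k + l" for \<sigma> i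
    using that permutes_in_image[of \<sigma> "{..<k + l}" i] by auto
  show ?thesis
    unfolding alternating_def
  proof (intro conjI allI impI)
    fix v w :: "nat \<Rightarrow> 'v" assume eq: "\<forall>i<k + l. v i = w i"
    have "?t v \<sigma> = ?t w \<sigma>" if "\<sigma> \<in> ?S" for \<sigma>
    proof -
      have "\<alpha> (\<lambda>i. v (\<sigma> i)) = \<alpha> (\<lambda>i. w (\<sigma> i))"
        by (rule alternating_cong[OF \<alpha>]) (use eq inb[OF that] in auto)
      moreover have "\<beta> (\<lambda>i. v (\<sigma> (k + i))) = \<beta> (\<lambda>i. w (\<sigma> (k + i)))"
        by (rule alternating_cong[OF \<beta>]) (use eq inb[OF that] in auto)
      ultimately show ?thesis by simp
    qed
    then have "(\<Sum>\<sigma>\<in>?S. ?t v \<sigma>) = (\<Sum>\<sigma>\<in>?S. ?t w \<sigma>)" by (rule sum.cong[OF refl])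
    then show "wedge k l \<alpha> \<beta> v = wedge k l \<alpha> \<beta> w" unfolding w by (rule arg_cong)
  next
    fix v :: "nat \<Rightarrow> 'v" and i assume i: "i < k + l"
    have "linear (\<lambda>x. ?t (v(i := x)) \<sigma>)" if \<sigma>: "\<sigma> \<in> ?S" for \<sigma>
    proof -
      \<comment> \<open>The argument \<open>v i\<close> occurs in the summand for
        \<open>\<sigma>\<close> exactly once, in position \<open>j\<close>; it belongs to
        \<open>\<alpha>\<close> if \<open>j < k\<close> and to \<open>\<beta>\<close> at position
        \<open>j - k\<close> otherwise.\<close>
      obtain j where j: "j < k + l" "\<sigma> j = i"
        using \<sigma> i permutes_surj[of \<sigma>] inb permutes_inv[of \<sigma> "{..<k + l}"] permutes_inverses(1)[of \<sigma> "{..<k + l}"]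
          permutes_in_image[of "inv \<sigma>" "{..<k + l}" i] by (metis lessThan_iff mem_Collect_eq)
      have inj: "\<sigma> a = i \<longleftrightarrow> a = j" for a
        using \<sigma> j permutes_inj[of \<sigma>] by (auto simp: inj_eq)
      show ?thesis
      proof (cases "j < k")
        case True
        have a: "(\<lambda>a. (v(i := x)) (\<sigma> a)) = (\<lambda>a. v (\<sigma> a))(j := x)" for x by (auto simp: inj)
        have b: "(\<lambda>a. (v(i := x)) (\<sigma> (k + a))) = (\<lambda>a. v (\<sigma> (k + a)))" for x using True by (auto simp: inj)
        have L: "linear (\<lambda>x. \<alpha> ((\<lambda>a. v (\<sigma> a))(j := x)))" by (rule alternating_linear[OF \<alpha> True])
        show ?thesis unfolding a b
          by (rule linearI) (simp_all add: linear_add[OF L] linear_cmul[OF L] algebra_simps)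
      next
        case False
        have a: "\<alpha> (\<lambda>a. (v(i := x)) (\<sigma> a)) = \<alpha> (\<lambda>a. v (\<sigma> a))" for x
          by (rule alternating_cong[OF \<alpha>]) (use False in \<open>auto simp: inj\<close>)
        have "k + a = j \<longleftrightarrow> a = j - k" for a using False by auto
        then have b: "(\<lambda>a. (v(i := x)) (\<sigma> (k + a))) = (\<lambda>a. v (\<sigma> (k + a)))(j - k := x)" for x
          by (simp add: fun_eq_iff inj)
        have L: "linear (\<lambda>x. \<beta> ((\<lambda>a. v (\<sigma> (k + a)))(j - k := x)))"
          by (rule alternating_linear[OF \<beta>]) (use False j in auto)
        show ?thesis unfolding a b
          by (rule linearI) (simp_all only: linear_add[OF L] linear_cmul[OF L] real_scaleR_def, simp_all add: algebra_simps)
      qed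
    qed
    then have L: "linear (\<lambda>x. \<Sum>\<sigma>\<in>?S. ?t (v(i := x)) \<sigma>)" by (intro linear_compose_sum) auto
    show "linear (\<lambda>x. wedge k l \<alpha> \<beta> (v(i := x)))"
      unfolding w by (rule linearI) (simp_all only: linear_add[OF L] linear_cmul[OF L] add_divide_distrib real_scaleR_def times_divide_eq_right)
  next
    fix v :: "nat \<Rightarrow> 'v" and i j assume i: "i < k + l" and j: "j < k + l" and ij: "i \<noteq> j \<and> v i = v j"
    let ?\<tau> = "Transposition.transpose i j"
    have \<tau>: "?\<tau> permutes {..<k + l}" using i j by (intro permutes_swap_id) auto
    have \<tau>\<tau>: "?\<tau> \<circ> (?\<tau> \<circ> \<sigma>) = \<sigma>" for \<sigma> :: "nat \<Rightarrow> nat" by (simp add: fun_eq_iff)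
    have v\<tau>: "v (?\<tau> a) = v a" for a using ij by (auto simp: Transposition.transpose_def)
    \<comment> \<open>Composition with the transposition of \<open>i\<close> and \<open>j\<close>
      permutes the summands; it changes their sign but not the arguments, as
      \<open>v i = v j\<close>. The sum equals its own negative.\<close>
    have "(\<Sum>\<sigma>\<in>?S. ?t v \<sigma>) = (\<Sum>\<sigma>\<in>?S. ?t v (?\<tau> \<circ> \<sigma>))"
      by (rule sum.reindex_bij_witness[of _ "\<lambda>\<sigma>. ?\<tau> \<circ> \<sigma>" "\<lambda>\<sigma>. ?\<tau> \<circ> \<sigma>"])
         (auto simp: \<tau>\<tau> intro: permutes_compose[OF _ \<tau>])
    also have "\<dots> = (\<Sum>\<sigma>\<in>?S. - ?t v \<sigma>)"
    proof (rule sum.cong[OF refl])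
      fix \<sigma> assume "\<sigma> \<in> ?S"
      then have "sign (?\<tau> \<circ> \<sigma>) = - sign \<sigma>"
        using ij \<tau> by (subst sign_compose) (auto simp: sign_swap_id intro: permutation_permutes[THEN iffD2] permutes_imp_permutation)
      then show "?t v (?\<tau> \<circ> \<sigma>) = - ?t v \<sigma>" by (simp add: v\<tau>)
    qed
    finally have "(\<Sum>\<sigma>\<in>?S. ?t v \<sigma>) = 0" by (simp add: sum_negf)
    then show "wedge k l \<alpha> \<beta> v = 0" unfolding w by simp
  qed
qed

lemma alternating_wedge_power:
  assumes "alternating 2 \<omega>"
  shows "alternating (2 * m) (wedge_power \<omega> m)"
proof (induction m)
  case 0
  show ?case by (simp add: alternating_def)
next
  case (Suc m)
  show ?case using alternating_wedge[OF assms Suc.IH] by simp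
qed

section \<open>Poisson brackets and invariant tensor fields\<close>

lemma linear_combination_coords:
  fixes b :: "'n::finite \<Rightarrow> real^'n"
  assumes "det (\<chi> k. b k) \<noteq> 0"
  shows "\<exists>C. w = (\<Sum>k\<in>UNIV. C k *\<^sub>R b k)"
proof -
  have "invertible (transpose (\<chi> k. b k))" using assms by (simp add: invertible_det_nz det_transpose)
  then obtain M' where "transpose (\<chi> k. b k) ** M' = mat 1" unfolding invertible_def by blast
  then have "transpose (\<chi> k. b k) *v (M' *v w) = w" by (simp add: matrix_vector_mul_assoc)
  moreover have "transpose (\<chi> k. b k) *v x = (\<Sum>k\<in>UNIV. (x $ k) *\<^sub>R b k)" for x
    by (simp add: vec_eq_iff matrix_vector_mult_def transpose_def mult.commute)
  ultimately show ?thesis by metis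
qed

section \<open>Affine coordinates, their Poisson brackets and right invariant multivectors\<close>

context symplectic_connection
begin

lemma covectors_independent:
  assumes c: "smooth_chart A c" and p: "p \<in> fst c"
    and b: "\<And>i v. ld (snd c) p v $ i = al (b i) p v"
  shows "det (\<chi> k. b k) \<noteq> 0"
proof -
  let ?L = "\<lambda>x. \<Sum>k\<in>UNIV. (x $ k) *\<^sub>R b k"
  have lin: "linear ?L"
    by (rule linearI) (simp_all add: scaleR_add_left sum.distrib scaleR_sum_right)
  have z: "x = 0" if "?L x = 0" for x
  proof -
    have "x \<bullet> ld (snd c) p v = al (?L x) p v" for v
      by (simp add: inner_vec_def b Ad_lin w0_lin)
    then have "x \<bullet> ld (snd c) p v = 0" for v
      unfolding that by (simp add: linear_0[OF linear_Ad] linear_0[OF w0_linear1])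
    from this[of "lcoord c p x"] show ?thesis by (simp add: ld_lcoord[OF c p])
  qed
  have "det (matrix ?L) \<noteq> 0" by (rule det_matrix_nonzero[OF lin z])
  moreover have "matrix ?L = transpose (\<chi> k. b k)"
    by (simp add: vec_eq_iff matrix_def transpose_def axis_def if_distrib[of "\<lambda>t. t * _"] cong: if_cong)
  ultimately show ?thesis by (simp add: det_transpose)
qed

text \<open>By \<open>hld_Fn\<close> the differential of \<open>Fn u v\<close> is
  \<open>al (br u v)\<close>, which is the combination of the \<open>dx_k\<close> with coefficients
  \<open>C k\<close>. The difference is constant on the connected domain, and this constant is
  \<open>\<mu>\<close>.\<close>

lemma Fn_affine:
  assumes c: "affine_chart A D c"
    and b: "\<And>p i v. p \<in> fst c \<Longrightarrow> ld (snd c) p v $ i = al (b i) p v"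
    and C: "br u v = (\<Sum>k\<in>UNIV. C k *\<^sub>R b k)"
  shows "\<exists>\<mu>. \<forall>p\<in>fst c. Fn u v p = (\<Sum>k\<in>UNIV. C k * snd c p $ k) + \<mu>"
proof (cases "fst c = {}")
  case False
  then obtain p0 where p0: "p0 \<in> fst c" by blast
  note cD = affine_chartD[OF c]
  let ?f = "\<lambda>p. Fn u v p - (\<Sum>k\<in>UNIV. C k * snd c p $ k)"
  have der: "hld ?f p (\<lambda>_. 0)" if p: "p \<in> fst c" for p
  proof -
    have "((\<lambda>z. Fn u v (lt p z) - (\<Sum>k\<in>UNIV. C k * snd c (lt p z) $ k)) has_derivative
       (\<lambda>w. al (br u v) p w - (\<Sum>k\<in>UNIV. C k * ld (snd c) p w $ k))) (at z0)"
      by (intro has_derivative_diff has_derivative_sum has_derivative_mult_right hld_Fn[unfolded hld_def]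
          hld_vec_nth[OF hld_chart[OF cD(1) p], unfolded hld_def])
    moreover have "al (br u v) p w - (\<Sum>k\<in>UNIV. C k * ld (snd c) p w $ k) = 0" for w
      by (simp add: C b[OF p] Ad_lin w0_lin)
    ultimately show ?thesis by (simp add: hld_def)
  qed
  have "?f p = ?f p0" if p: "p \<in> fst c" for p
    by (rule constant_on_connected[OF cD(3,2) der p p0])
  then have "Fn u v p = (\<Sum>k\<in>UNIV. C k * snd c p $ k) + ?f p0" if "p \<in> fst c" for p
    using that by (simp add: algebra_simps)
  then show ?thesis by (intro exI[of _ "?f p0"] ballI)
qed simp

text \<open>\<open>q i j\<close> is \<open>dx_i\<close> evaluated on the right invariant field of
  \<open>axis j 1\<close>, as an affine function of the coordinates. It holds in every nonempty
  affine chart and underlies all polynomial assertions.\<close>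

lemma affine_chart_structure:
  assumes c: "affine_chart A D c" and ne: "fst c \<noteq> {}"
  obtains b q where "\<And>p i v. p \<in> fst c \<Longrightarrow> ld (snd c) p v $ i = al (b i) p v" "det (\<chi> k. b k) \<noteq> 0"
    "\<And>i j. poly_fun_deg_le 1 (q i j)" "\<And>i j p. p \<in> fst c \<Longrightarrow> Fn (b i) (axis j 1) p = q i j (snd c p)"
proof -
  obtain b :: "'n \<Rightarrow> real^'n" where "\<forall>p\<in>fst c. \<forall>i v. ld (snd c) p v $ i = al (b i) p v"
    using affine_chart_covectors[OF c] ..
  then have b: "\<And>p i v. p \<in> fst c \<Longrightarrow> ld (snd c) p v $ i = al (b i) p v" by simp
  obtain p0 where p0: "p0 \<in> fst c" using ne by blast
  have det: "det (\<chi> k. b k) \<noteq> 0" by (rule covectors_independent[OF affine_chartD(1)[OF c] p0 b[OF p0]])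
  have "\<exists>P. poly_fun_deg_le 1 P \<and> (\<forall>p\<in>fst c. Fn (b i) (axis j 1) p = P (snd c p))" for i j
  proof -
    obtain C where C: "br (b i) (axis j 1) = (\<Sum>k\<in>UNIV. C k *\<^sub>R b k)"
      using linear_combination_coords[OF det, of "br (b i) (axis j 1)"] ..
    obtain \<mu> where "\<forall>p\<in>fst c. Fn (b i) (axis j 1) p = (\<Sum>k\<in>UNIV. C k * snd c p $ k) + \<mu>"
      using Fn_affine[OF c b C] ..
    then show ?thesis by (intro exI[of _ "\<lambda>y. (\<Sum>k\<in>UNIV. C k * y $ k) + \<mu>"] conjI poly_affine)
  qed
  then obtain q where q: "\<And>i j. poly_fun_deg_le 1 (q i j) \<and> (\<forall>p\<in>fst c. Fn (b i) (axis j 1) p = q i j (snd c p))"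
    by metis
  show thesis by (rule that[OF b det]) (use q in simp_all)
qed

text \<open>As \<open>dx_i\<close> is \<open>\<omega>\<close> contracted with the right invariant
  field of \<open>b i\<close>, its image under the sharp map is minus that field. The sign
  disappears again when antisymmetry exchanges the two arguments.\<close>

lemma poisson_bracket_coordinates:
  assumes c: "smooth_chart A c" and p: "p \<in> fst c"
    and b: "\<And>i v. ld (snd c) p v $ i = al (b i) p v"
  shows "poisson_bracket A \<omega> (\<lambda>q. snd c q $ i) (\<lambda>q. snd c q $ j) p = Fn (b i) (b j) p"
proof -
  let ?d = "\<lambda>i. dfun A (\<lambda>q. snd c q $ i) p"
  have bl: "blinfun_apply (Blinfun (?d i)) = ?d i" for i
    by (rule bounded_linear_Blinfun_apply[OF dfun_bounded_linear[OF hld_vec_nth[OF hld_chart[OF c p]]]])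
  have sharp: "poisson_sharp \<omega> p (Blinfun (?d i)) = lf (- Ad (iv p) (b i)) p"
    unfolding poisson_sharp_def bl
  proof (rule the_equality)
    have "\<omega> p (pair (lf (- Ad (iv p) (b i)) p) (lf v p)) = - ?d i (lf v p)" for v
      by (simp add: omega_lf dfun_coordinate[OF c p] b w0_lin)
    from this[of "lco p x" for x] show "\<forall>v. \<omega> p (pair (lf (- Ad (iv p) (b i)) p) v) = - ?d i v" by simp
    fix u assume u: "\<forall>v. \<omega> p (pair u v) = - ?d i v"
    have "lco p u = - Ad (iv p) (b i)"
    proof (rule w0_eqI)
      fix v
      have "w0 (lco p u) v = - ?d i (lf v p)" using u omega_lf[of p "lco p u" v] by simp
      then show "w0 (lco p u) v = w0 (- Ad (iv p) (b i)) v"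
        by (simp add: dfun_coordinate[OF c p] b w0_lin)
    qed
    then show "u = lf (- Ad (iv p) (b i)) p" by (metis lf_lco)
  qed
  have "poisson_bracket A \<omega> (\<lambda>q. snd c q $ i) (\<lambda>q. snd c q $ j) p = ?d j (lf (- Ad (iv p) (b i)) p)"
    unfolding poisson_bracket_def poisson_tensor_def by (simp add: pair_def sharp bl)
  also have "\<dots> = w0 (Ad (iv p) (b j)) (- Ad (iv p) (b i))" by (simp add: dfun_coordinate[OF c p] b)
  also have "\<dots> = Fn (b i) (b j) p"
    unfolding Fn_def using w0_antisym[of "Ad (iv p) (b j)" "- Ad (iv p) (b i)"] by (simp add: w0_lin)
  finally show ?thesis .
qed

lemma poisson_affine_chart:
  "\<exists>U x. affine_chart A D (U, x) \<and> g \<in> U \<and>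
    (\<exists>C \<mu>. structure_constants mul e A C \<and>
      (\<forall>i j. \<forall>p\<in>U. poisson_bracket A \<omega> (\<lambda>q. x q $ i) (\<lambda>q. x q $ j) p =
         (\<Sum>k\<in>UNIV. C i j k * x p $ k) + \<mu> i j))"
proof -
  obtain c where c: "affine_chart A D c" "g \<in> fst c"
    and b: "\<forall>p\<in>fst c. \<forall>i v. ld (snd c) p v $ i = al (axis i 1) p v"
    using affine_chart_exists[of g] by (elim exE conjE)
  let ?C = "\<lambda>i j k. br (axis i 1) (axis j 1) $ k"
  have "inj (\<lambda>i::'n. axis i (1::real))" by (auto intro!: injI simp: axis_eq_axis)
  moreover have "range (\<lambda>i::'n. axis i (1::real)) = Basis" by (auto simp: Basis_vec_def)
  ultimately have sc: "structure_constants mul e A ?C"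
    unfolding structure_constants_def
    by (intro exI[of _ "\<lambda>i. axis i 1"]) (simp add: independent_Basis flip: vec_axis_expansion)
  have "\<exists>\<mu>. \<forall>p\<in>fst c. Fn (axis i 1) (axis j 1) p = (\<Sum>k\<in>UNIV. ?C i j k * snd c p $ k) + \<mu>" for i j
    by (rule Fn_affine[OF c(1), where b="\<lambda>i. axis i 1"]) (use b vec_axis_expansion in simp_all)
  then obtain \<mu> where \<mu>: "\<And>i j. \<forall>p\<in>fst c. Fn (axis i 1) (axis j 1) p = (\<Sum>k\<in>UNIV. ?C i j k * snd c p $ k) + \<mu> i j"
    by metis
  have "poisson_bracket A \<omega> (\<lambda>q. snd c q $ i) (\<lambda>q. snd c q $ j) p = (\<Sum>k\<in>UNIV. ?C i j k * snd c p $ k) + \<mu> i j"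
    if p: "p \<in> fst c" for i j p
    using poisson_bracket_coordinates[OF affine_chartD(1)[OF c(1)] p, of "\<lambda>i. axis i 1" i j] b \<mu> p by simp
  then show ?thesis
    by (intro exI[of _ "fst c"] exI[of _ "snd c"] exI[of _ ?C] exI[of _ \<mu>] conjI allI ballI sc) (use c in simp_all)
qed

text \<open>Invariance moves the evaluation to \<open>e\<close>, where each \<open>dx\<close> pulled
  back by right translation has the affine components \<open>q\<close>. With \<open>k\<close> slots
  of degree 1 each, the total degree is at most \<open>k\<close>.\<close>

lemma right_invariant_mv_polynomial:
  assumes T: "is_multivector_field A k T" and inv: "right_invariant_mv mul A T"
  shows "polynomial_mv_deg_le A D k T"
  unfolding polynomial_mv_deg_le_def
proof (intro allI impI)
  fix c I assume c: "affine_chart A D c"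
  show "\<exists>P. poly_fun_deg_le k P \<and> (\<forall>p\<in>fst c. mv_coeff A c T I p = P (snd c p))"
  proof (cases "fst c = {}")
    case True
    then show ?thesis using poly_zero by blast
  next
    case False
    obtain b q where b: "\<And>p i v. p \<in> fst c \<Longrightarrow> ld (snd c) p v $ i = al (b i) p v" "det (\<chi> k. b k) \<noteq> 0"
      and q: "\<And>i j. poly_fun_deg_le 1 (q i j)" "\<And>i j p. p \<in> fst c \<Longrightarrow> Fn (b i) (axis j 1) p = q i j (snd c p)"
      by (rule affine_chart_structure[OF c False]) (rule that)
    note cs = affine_chartD(1)[OF c]
    have alt: "alternating k (T e)" using T unfolding is_multivector_field_def by simp
    define P where "P y = T e (\<lambda>j. \<Sum>l\<in>UNIV. q (I j) l y *\<^sub>R blinfun_inner_right (axis l 1))" for y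
    have "poly_fun_deg_le (\<Sum>i<k. 1) P" unfolding P_def by (rule poly_alternating[OF alt q(1)])
    moreover have "mv_coeff A c T I p = P (snd c p)" if p: "p \<in> fst c" for p
    proof -
      let ?d = "\<lambda>j. dfun A (\<lambda>q. snd c q $ I j) p" and ?R = "tmap A (\<lambda>h. mul h p) e"
      have bl: "blinfun_apply (Blinfun (?d j)) = ?d j" for j
        by (rule bounded_linear_Blinfun_apply[OF dfun_bounded_linear[OF hld_vec_nth[OF hld_chart[OF cs p]]]])
      have "linear (\<lambda>v. lf (Ad (iv p) v) p)"
        using linear_compose[OF linear_Ad linear_lf] by (simp add: o_def)
      then have "bounded_linear (\<lambda>v. lf (Ad (iv p) v) p)" by (simp add: linear_conv_bounded_linear)
      moreover have Req: "?R = (\<lambda>v. lf (Ad (iv p) v) p)" by (rule ext) (rule tmap_right)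
      ultimately have R: "blinfun_apply (Blinfun ?R) = (\<lambda>v. lf (Ad (iv p) v) p)"
        by (simp add: bounded_linear_Blinfun_apply)
      have "T (mul e p) (\<lambda>j. Blinfun (?d j)) = T e (\<lambda>j. Blinfun (?d j) o\<^sub>L Blinfun ?R)"
        by (rule inv[unfolded right_invariant_mv_def mv_invariant_def, rule_format])
      moreover have "Blinfun (?d j) o\<^sub>L Blinfun ?R = (\<Sum>l\<in>UNIV. q (I j) l (snd c p) *\<^sub>R blinfun_inner_right (axis l 1))" for j
      proof (rule blinfun_eqI)
        fix v
        have lin: "linear (\<lambda>v. Fn (b (I j)) v p)"
          using linear_compose[OF linear_Ad w0_linear2] by (simp add: o_def Fn_def)
        have "blinfun_apply (Blinfun (?d j) o\<^sub>L Blinfun ?R) v = Fn (b (I j)) v p"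
          by (simp add: bl R dfun_coordinate[OF cs p] b(1)[OF p] Fn_def)
        also have "\<dots> = (\<Sum>l\<in>UNIV. (v $ l) * q (I j) l (snd c p))"
          using linear_axis_expansion[OF lin, of v] by (simp add: q(2)[OF p])
        also have "\<dots> = blinfun_apply (\<Sum>l\<in>UNIV. q (I j) l (snd c p) *\<^sub>R blinfun_inner_right (axis l 1)) v"
          by (simp add: blinfun.sum_left blinfun.scaleR_left inner_axis' mult.commute)
        finally show "blinfun_apply (Blinfun (?d j) o\<^sub>L Blinfun ?R) v = blinfun_apply (\<Sum>l\<in>UNIV. q (I j) l (snd c p) *\<^sub>R blinfun_inner_right (axis l 1)) v" .
      qed
      ultimately show ?thesis by (simp add: mv_coeff_def P_def)
    qed
    ultimately show ?thesis by (intro exI[of _ P] conjI ballI) simp_all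
  qed
qed

section \<open>Determinants, unimodularity and polynomial forms\<close>

definition Om where "Om = (\<chi> i j. w0 (axis i 1) (axis j 1))"

lemma w0_Om: "w0 v w = v \<bullet> (Om *v w)"
proof -
  have "(Om *v w) $ i = w0 (axis i 1) w" for i
    using linear_axis_expansion[OF w0_linear2, of "axis i 1" w]
    by (simp add: Om_def matrix_vector_mult_def mult.commute)
  moreover have "w0 v w = (\<Sum>i\<in>UNIV. v $ i * w0 (axis i 1) w)"
    using linear_axis_expansion[OF w0_linear1, of v w] by simp
  ultimately show ?thesis by (simp add: inner_vec_def)
qed

lemma det_Om: "det Om \<noteq> 0"
proof -
  have "det (matrix ((*v) Om)) \<noteq> 0"
  proof (rule det_matrix_nonzero[OF matrix_vector_mul_linear])
    fix w assume "Om *v w = 0"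
    then have "w0 w v = 0" for v using w0_Om[of v w] w0_antisym[of w v] by simp
    then show "w = 0" by (rule w0_nondeg)
  qed
  then show ?thesis by simp
qed

text \<open>Antisymmetry gives \<open>det Om = (- 1) ^ n * det Om\<close> with \<open>det Om\<close>
  nonzero. Evenness ensures that the wedge power with exponent \<open>n div 2\<close> has top
  degree.\<close>

lemma even_dim: "even CARD('n)"
proof -
  have "transpose Om $ i $ j = (- Om) $ i $ j" for i j
    using w0_antisym[of "axis j 1" "axis i 1"] by (simp add: transpose_def Om_def)
  then have "transpose Om = - Om" by (simp add: vec_eq_iff)
  from arg_cong[OF this, of det] have "det Om = det (- Om)" by (simp only: det_transpose)
  also have "- Om = (\<chi> i. (- 1) *s (Om $ i))" by (simp add: vec_eq_iff)
  also have "det \<dots> = (- 1) ^ CARD('n) * det Om"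
    using det_rows_mul[of "\<lambda>_. - 1" "\<lambda>i. Om $ i"] by (simp add: vec_lambda_eta)
  finally show ?thesis using det_Om by (cases "even CARD('n)") auto
qed

text \<open>Adjointness with respect to \<open>w0\<close> means
  \<open>transpose (matrix L1) ** Om = Om ** matrix L2\<close>, and \<open>det Om\<close>
  cancels.\<close>

lemma adjoint_det:
  assumes "linear L1" "linear L2" "\<And>v w. w0 (L1 v) w = w0 v (L2 w)"
  shows "det (matrix L1) = det (matrix L2)"
proof -
  have "transpose (matrix L1) ** Om = Om ** matrix L2"
  proof -
    have "(transpose (matrix L1) ** Om) $ i $ j = w0 (L1 (axis i 1)) (axis j 1)" for i j
      using linear_axis_expansion[OF w0_linear1, of "L1 (axis i 1)" "axis j 1"]
      by (simp add: matrix_matrix_mult_def transpose_def matrix_def Om_def)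
    moreover have "(Om ** matrix L2) $ i $ j = w0 (axis i 1) (L2 (axis j 1))" for i j
      using linear_axis_expansion[OF w0_linear2, of "axis i 1" "L2 (axis j 1)"]
      by (simp add: matrix_matrix_mult_def matrix_def Om_def mult.commute)
    ultimately show ?thesis by (simp add: vec_eq_iff assms(3))
  qed
  from arg_cong[OF this, of det] show ?thesis using det_Om by (simp add: det_mul)
qed

text \<open>The matrix factors as the rows \<open>b\<close>, the transpose of
  \<open>Ad (iv p)\<close>, the Gram matrix \<open>Om\<close>, and \<open>Ad (iv p)\<close> again.
  The determinant of \<open>Ad\<close> thus enters squared, and the absolute value in the definition
  of unimodularity is enough.\<close>

lemma det_Fn:
  "det (\<chi> i j. Fn (b i) (axis j 1) p) = det (\<chi> k. b k) * (det (matrix (Ad (iv p))))\<^sup>2 * det Om"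
proof -
  define M where "M = matrix (Ad (iv p))"
  have Mv: "Ad (iv p) v = M *v v" for v
    unfolding M_def using matrix_works[of "Ad (iv p)" v] linear_Ad by simp
  have Mj: "Ad (iv p) (axis j 1) $ k = M $ k $ j" for j k by (simp add: M_def matrix_def)
  have "Fn (b i) (axis j 1) p = (((\<chi> k. b k) ** transpose M) ** (Om ** M)) $ i $ j" for i j
  proof -
    have "Ad (iv p) (b i) $ k = ((\<chi> k. b k) ** transpose M) $ i $ k" for k
      unfolding Mv by (simp add: matrix_vector_mult_def matrix_matrix_mult_def transpose_def mult.commute)
    moreover have "(Om *v Ad (iv p) (axis j 1)) $ k = (Om ** M) $ k $ j" for k
      unfolding matrix_vector_mult_def by (simp add: Mj matrix_matrix_mult_def)
    ultimately show ?thesis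
      unfolding Fn_def w0_Om by (simp add: inner_vec_def matrix_matrix_mult_def[of "(\<chi> k. b k) ** transpose M"])
  qed
  then have "(\<chi> i j. Fn (b i) (axis j 1) p) = ((\<chi> k. b k) ** transpose M) ** (Om ** M)"
    by (simp add: vec_eq_iff)
  then show ?thesis by (simp add: det_mul det_transpose power2_eq_square M_def)
qed

lemma unimodular_det:
  assumes "unimodular mul e iv A"
  shows "(det (matrix (Ad g)))\<^sup>2 = 1"
proof -
  have "\<bar>det (matrix (Ad g))\<bar> = 1" using assms unfolding unimodular_def tmap_conj by blast
  then show ?thesis by (metis one_power2 power2_abs)
qed

text \<open>The coefficients of the coordinate fields in the right invariant frame: by Cramer's rule they
  are minors of the matrix of affine functions \<open>\<omega>(b\<^sub>i\<^sup>-, e\<^sub>j\<^sup>-)\<close>, whose determinant is constant on a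
  unimodular group.\<close>

lemma coordinate_fields_polynomial:
  assumes uni: "unimodular mul e iv A" and c: "affine_chart A D c" and ne: "fst c \<noteq> {}"
  obtains b P where "\<And>p i v. p \<in> fst c \<Longrightarrow> ld (snd c) p v $ i = al (b i) p v" "det (\<chi> k. b k) \<noteq> 0"
    "\<And>a l. poly_fun_deg_le (CARD('n) - 1) (P a l)"
    "\<And>p a. p \<in> fst c \<Longrightarrow> Ad p (lcoord c p (axis a 1)) = (\<Sum>l\<in>UNIV. P a l (snd c p) *\<^sub>R axis l 1)"
proof -
  obtain b q where b: "\<And>p i v. p \<in> fst c \<Longrightarrow> ld (snd c) p v $ i = al (b i) p v" "det (\<chi> k. b k) \<noteq> 0"
    and q: "\<And>i j. poly_fun_deg_le 1 (q i j)" "\<And>i j p. p \<in> fst c \<Longrightarrow> Fn (b i) (axis j 1) p = q i j (snd c p)"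
    by (rule affine_chart_structure[OF c ne]) (rule that)
  let ?\<kappa> = "det (\<chi> k. b k) * det Om"
  define P where "P a l y = inverse ?\<kappa> * det (\<chi> i j. if j = l then (axis a 1 :: real^'n) $ i else q i j y)" for a l y
  have "poly_fun_deg_le (0 + (CARD('n) - 1)) (P a l)" for a l
    unfolding P_def by (intro poly_mult poly_const poly_det_column q)
  then have P1: "poly_fun_deg_le (CARD('n) - 1) (P a l)" for a l by simp
  have P2: "Ad p (lcoord c p (axis a 1)) = (\<Sum>l\<in>UNIV. P a l (snd c p) *\<^sub>R axis l 1)" if p: "p \<in> fst c" for p a
  proof -
    \<comment> \<open>\<open>?N\<close> is the matrix of the \<open>dx_i\<close> on the right
      invariant frame, and \<open>?\<rho>\<close> consists of the coefficients of the coordinate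
      field \<open>a\<close> in that frame; hence \<open>?N *v ?\<rho> = axis a 1\<close>.\<close>
    let ?N = "\<chi> i j. Fn (b i) (axis j 1) p" and ?\<rho> = "Ad p (lcoord c p (axis a 1))"
    have dN: "det ?N = ?\<kappa>" unfolding det_Fn by (simp add: unimodular_det[OF uni])
    then have dN0: "det ?N \<noteq> 0" using b(2) det_Om by simp
    have "?N *v \<rho> = (\<chi> i. ld (snd c) p (Ad (iv p) \<rho>) $ i)" for \<rho>
    proof -
      have lin: "linear (\<lambda>v. Fn (b i) v p)" for i
        using linear_compose[OF linear_Ad w0_linear2] by (simp add: o_def Fn_def)
      have "ld (snd c) p (Ad (iv p) \<rho>) $ i = Fn (b i) \<rho> p" for i by (simp add: b(1)[OF p] Fn_def)
      then show ?thesis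
        using linear_axis_expansion[OF lin, of _ \<rho>] by (simp add: vec_eq_iff matrix_vector_mult_def mult.commute)
    qed
    from this[of ?\<rho>] have "?N *v ?\<rho> = axis a 1" by (simp add: ld_lcoord[OF affine_chartD(1)[OF c] p] vec_lambda_eta)
    from iffD1[OF cramer[OF dN0] this]
    have "?\<rho> $ l = det (\<chi> i j. if j = l then (axis a 1 :: real^'n) $ i else ?N $ i $ j) / ?\<kappa>" for l
      unfolding dN by (simp only: vec_lambda_beta)
    then have "?\<rho> $ l = P a l (snd c p)" for l
      by (simp add: P_def q(2)[OF p] divide_inverse mult.commute cong: if_cong)
    then show ?thesis using vec_axis_expansion[of ?\<rho>] by simp
  qed
  show thesis by (rule that[OF b P1 P2])
qed

text \<open>Only the first coordinate field is expanded in the right invariant frame, at the cost of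
  degree \<open>n - 1\<close>. Each \<open>al (axis l 1)\<close> is a constant combination of the
  \<open>dx_k\<close>, so it takes a constant value on the second field and adds no degree.\<close>

lemma omega_polynomial:
  assumes uni: "unimodular mul e iv A"
  shows "polynomial_form_deg_le A D (CARD('n) - 1) \<omega>"
  unfolding polynomial_form_deg_le_def
proof (intro allI impI)
  fix c and I :: "nat \<Rightarrow> 'n" assume c: "affine_chart A D c"
  show "\<exists>P. poly_fun_deg_le (CARD('n) - 1) P \<and> (\<forall>p\<in>fst c. form_coeff A c \<omega> I p = P (snd c p))"
  proof (cases "fst c = {}")
    case True
    then show ?thesis using poly_zero by blast
  next
    case False
    obtain b P where b: "\<And>p i v. p \<in> fst c \<Longrightarrow> ld (snd c) p v $ i = al (b i) p v" "det (\<chi> k. b k) \<noteq> 0"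
      and P: "\<And>a l. poly_fun_deg_le (CARD('n) - 1) (P a l)"
      "\<And>p a. p \<in> fst c \<Longrightarrow> Ad p (lcoord c p (axis a 1)) = (\<Sum>l\<in>UNIV. P a l (snd c p) *\<^sub>R axis l 1)"
      by (rule coordinate_fields_polynomial[OF uni c False]) (rule that)
    note cs = affine_chartD(1)[OF c]
    have "\<exists>C. axis l 1 = (\<Sum>k\<in>UNIV. C k *\<^sub>R b k)" for l :: 'n by (rule linear_combination_coords[OF b(2)])
    then obtain C where C: "\<And>l. axis l 1 = (\<Sum>k\<in>UNIV. C l k *\<^sub>R b k)" by metis
    define Q where "Q y = (\<Sum>l\<in>UNIV. C l (I 1) * P (I 0) l y)" for y
    have "poly_fun_deg_le (0 + (CARD('n) - 1)) Q"
      unfolding Q_def by (intro poly_sum poly_mult poly_const P)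
    moreover have "form_coeff A c \<omega> I p = Q (snd c p)" if p: "p \<in> fst c" for p
    proof -
      let ?x = "\<lambda>j. lcoord c p (axis (I j) 1)"
      have "form_coeff A c \<omega> I p = w0 (?x 0) (?x 1)"
        unfolding form_coeff_def coord_vec_eq[OF cs p] omega_lf_family w0_def
        by (rule alternating_cong[OF omega_alternating]) (auto simp: pair_def less_2_cases_iff)
      also have "\<dots> = w0 (Ad (iv p) (\<Sum>l\<in>UNIV. P (I 0) l (snd c p) *\<^sub>R axis l 1)) (?x 1)"
        using P(2)[OF p, of "I 0"] by (metis Ad_iv(2))
      also have "\<dots> = (\<Sum>l\<in>UNIV. P (I 0) l (snd c p) * al (axis l 1) p (?x 1))"
        by (simp add: Ad_lin w0_lin)
      also have "\<dots> = Q (snd c p)"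
      proof -
        have "al (axis l 1) p (?x 1) = C l (I 1)" for l
        proof -
          have "al (axis l 1) p (?x 1) = (\<Sum>k\<in>UNIV. C l k * al (b k) p (?x 1))"
            by (subst C) (simp add: Ad_lin w0_lin)
          also have "\<dots> = (\<Sum>k\<in>UNIV. C l k * (axis (I 1) 1 :: real^'n) $ k)"
            by (simp add: b(1)[OF p, symmetric] ld_lcoord[OF cs p])
          also have "\<dots> = C l (I 1)" by (simp add: axis_def if_distrib cong: if_cong)
          finally show ?thesis .
        qed
        then show ?thesis by (simp add: Q_def mult.commute)
      qed
      finally show ?thesis .
    qed
    ultimately show ?thesis by (intro exI[of _ Q] conjI ballI) simp_all
  qed
qed

text \<open>Here every one of the \<open>k\<close> coordinate fields has to be expanded in the right
  invariant frame, on which \<open>T\<close> has constant coefficients; each contributes degree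
  \<open>n - 1\<close>.\<close>

lemma right_invariant_form_polynomial:
  assumes uni: "unimodular mul e iv A" and T: "differential_form A k T" and inv: "right_invariant_form mul A T"
  shows "polynomial_form_deg_le A D (k * (CARD('n) - 1)) T"
  unfolding polynomial_form_deg_le_def
proof (intro allI impI)
  fix c and I :: "nat \<Rightarrow> 'n" assume c: "affine_chart A D c"
  show "\<exists>P. poly_fun_deg_le (k * (CARD('n) - 1)) P \<and> (\<forall>p\<in>fst c. form_coeff A c T I p = P (snd c p))"
  proof (cases "fst c = {}")
    case True
    then show ?thesis using poly_zero by blast
  next
    case False
    obtain b P where b: "\<And>p i v. p \<in> fst c \<Longrightarrow> ld (snd c) p v $ i = al (b i) p v" "det (\<chi> k. b k) \<noteq> 0"
      and P: "\<And>a l. poly_fun_deg_le (CARD('n) - 1) (P a l)"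
      "\<And>p a. p \<in> fst c \<Longrightarrow> Ad p (lcoord c p (axis a 1)) = (\<Sum>l\<in>UNIV. P a l (snd c p) *\<^sub>R axis l 1)"
      by (rule coordinate_fields_polynomial[OF uni c False]) (rule that)
    have alt: "alternating k (T e)" using T unfolding differential_form_def by simp
    define Q where "Q y = T e (\<lambda>j. \<Sum>l\<in>UNIV. P (I j) l y *\<^sub>R axis l 1)" for y
    have "poly_fun_deg_le (\<Sum>j<k. CARD('n) - 1) Q" unfolding Q_def by (rule poly_alternating[OF alt P(1)])
    moreover have "form_coeff A c T I p = Q (snd c p)" if p: "p \<in> fst c" for p
    proof -
      have "T (mul e p) (\<lambda>j. tmap A (\<lambda>h. mul h p) e (v j)) = T e v" for v
        by (rule inv[unfolded right_invariant_form_def form_invariant_def, rule_format])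
      then have R: "T p (\<lambda>j. lf (Ad (iv p) (v j)) p) = T e v" for v by (simp add: tmap_right)
      have "form_coeff A c T I p = T p (\<lambda>j. lf (Ad (iv p) (Ad p (lcoord c p (axis (I j) 1)))) p)"
        by (simp add: form_coeff_def coord_vec_eq[OF affine_chartD(1)[OF c] p])
      then show ?thesis unfolding R P(2)[OF p] Q_def .
    qed
    ultimately show ?thesis by (intro exI[of _ Q] conjI ballI) simp_all
  qed
qed

section \<open>The volume form\<close>

lemma wedge_power_lf: "wedge_power (\<omega> p) r (\<lambda>j. lf (v j) p) = wedge_power (\<omega> e) r v"
proof (induction r arbitrary: v)
  case (Suc r)
  show ?case by (simp add: wedge_def omega_lf_family Suc.IH)
qed simp

text \<open>The sum is the infinitesimal change of \<open>V\<close> under \<open>Gam u\<close>, so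
  the claim is that \<open>Gam u\<close> has trace zero. It is derived from the group: unimodularity
  controls the determinants of the adjoints of \<open>Ad p\<close>, which are then differentiated at
  \<open>e\<close>.\<close>

lemma Gam_traceless:
  assumes uni: "unimodular mul e iv A" and V: "alternating CARD('n) V"
  shows "(\<Sum>i<CARD('n). V (v(i := Gam u (v i)))) = 0"
proof -
  obtain d :: "'n \<Rightarrow> real^'n" where d: "\<And>j v. w0 (d j) v = v $ j" using w0_dual_basis by blast
  \<comment> \<open>The \<open>w0\<close>-adjoint of \<open>Ad p\<close>, written in the basis dual
    to the coordinates so that it can be differentiated. Its derivative at \<open>e\<close> along
    \<open>u\<close> is \<open>- Gam u\<close>.\<close>
  define As where "As p v = (\<Sum>j\<in>UNIV. w0 v (Ad p (axis j 1)) *\<^sub>R d j)" for p v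
  have w0d: "w0 (\<Sum>j\<in>UNIV. t (axis j 1) *\<^sub>R d j) w = t w" if "linear t" for t w
    using linear_axis_expansion[OF that, of w]
    by (simp add: w0_lin d mult.commute)
  have As: "w0 (As p v) w = w0 v (Ad p w)" for p v w
    unfolding As_def by (rule w0d) (use linear_compose[OF linear_Ad w0_linear2] in \<open>simp add: o_def\<close>)
  have linAs: "linear (As p)" for p
    by (rule linearI; rule w0_eqI) (simp_all add: As w0_lin)
  \<comment> \<open>The determinant of \<open>As p\<close> is known only up to sign, so the constant
    quantity to differentiate is the square.\<close>
  have "(V (\<lambda>i. As p (v i)))\<^sup>2 = (V v)\<^sup>2" for p
    unfolding alternating_top[OF V linAs] adjoint_det[OF linAs linear_Ad As] power_mult_distrib
    by (simp add: unimodular_det[OF uni])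
  then have sq: "V (\<lambda>i. As p (v i)) * V (\<lambda>i. As p (v i)) = V v * V v" for p by (simp add: power2_eq_square)
  have Ase: "As e w = w" for w by (rule w0_eqI) (simp add: As)
  have AsD: "((\<lambda>z. As (chart_inv c0 z) w) has_derivative (\<lambda>u. - Gam u w)) (at z0)" for w
  proof -
    have "((\<lambda>z. \<Sum>j\<in>UNIV. w0 w (Ad (chart_inv c0 z) (axis j 1)) *\<^sub>R d j) has_derivative
        (\<lambda>u. \<Sum>j\<in>UNIV. w0 w (br u (axis j 1)) *\<^sub>R d j)) (at z0)"
      by (intro has_derivative_sum has_derivative_scaleR_left
          bounded_linear.has_derivative[OF bounded_bilinear.bounded_linear_right[OF w0_bilinear] Ad_has_derivative])
    moreover have "(\<Sum>j\<in>UNIV. w0 w (br u (axis j 1)) *\<^sub>R d j) = - Gam u w" for u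
    proof (rule w0_eqI)
      fix x
      have "linear (\<lambda>x. w0 w (br u x))" using linear_compose[OF linear_br2 w0_linear2] by (simp add: o_def)
      from w0d[OF this, of x] show "w0 (\<Sum>j\<in>UNIV. w0 w (br u (axis j 1)) *\<^sub>R d j) x = w0 (- Gam u w) x"
        by (simp add: w0_lin w0_Gam)
    qed
    ultimately show ?thesis by (simp add: As_def)
  qed
  have VD: "((\<lambda>z. V (\<lambda>i. As (chart_inv c0 z) (v i))) has_derivative
      (\<lambda>u. \<Sum>i<CARD('n). V ((\<lambda>j. As (chart_inv c0 z0) (v j))(i := - Gam u (v i))))) (at z0)"
    by (rule alternating_has_derivative[OF V AsD])
  have neg: "V (v(i := - x)) = - V (v(i := x))" if "i < CARD('n)" for i x
    by (rule linear_neg[OF alternating_linear[OF V that]])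
  have "((\<lambda>z. V v * V v) has_derivative (\<lambda>u. - (2 * V v * (\<Sum>i<CARD('n). V (v(i := Gam u (v i))))))) (at z0)"
    using has_derivative_mult[OF VD VD] by (simp add: sq Ase neg sum_negf algebra_simps)
  from fun_cong[OF has_derivative_unique[OF has_derivative_const this], of u]
  have 1: "V v * (\<Sum>i<CARD('n). V (v(i := Gam u (v i)))) = 0" by simp
  \<comment> \<open>Differentiating the square yields the claim multiplied by \<open>V v\<close>. If
    \<open>V v = 0\<close>, the function \<open>V (As p v)\<close> itself vanishes for all
    \<open>p\<close>, and its own derivative gives the claim.\<close>
  show ?thesis
  proof (cases "V v = 0")
    case True
    have "V (\<lambda>i. As p (v i)) = 0" for p using sq[of p] True by simp
    then have "((\<lambda>z. 0) has_derivative (\<lambda>u. - (\<Sum>i<CARD('n). V (v(i := Gam u (v i)))))) (at z0)"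
      using VD by (simp add: Ase neg sum_negf)
    from fun_cong[OF has_derivative_unique[OF has_derivative_const this], of u] show ?thesis by simp
  qed (use 1 in simp)
qed

text \<open>In the left invariant frame the form has the constant coefficients \<open>V\<close>. The
  Leibniz terms cancel against the flat part of \<open>D\<close>, and the terms with
  \<open>Gam\<close> add up to zero by \<open>Gam_traceless\<close>.\<close>

lemma volume_parallel:
  assumes uni: "unimodular mul e iv A"
  shows "parallel_form_on A D UNIV CARD('n) (\<lambda>p. wedge_power (\<omega> p) (CARD('n) div 2))"
  unfolding parallel_form_on_def cov_deriv_def
proof (intro allI impI ballI)
  fix X :: "'a \<Rightarrow> real^'n" and Y :: "nat \<Rightarrow> 'a \<Rightarrow> real^'n" and p
  assume XY: "smooth_vector_field A X \<and> (\<forall>j<CARD('n). smooth_vector_field A (Y j))"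
  let ?r = "CARD('n) div 2"
  define V where "V = wedge_power (\<omega> e) ?r"
  let ?\<eta> = "\<lambda>j q. lco q (Y j q)" and ?\<xi> = "lco p (X p)"
  have V: "alternating CARD('n) V"
    using alternating_wedge_power[OF omega_alternating, of ?r e] even_dim by (simp add: V_def)
  have vol: "wedge_power (\<omega> q) ?r y = V (\<lambda>j. lco q (y j))" for q y
    using wedge_power_lf[of q ?r "\<lambda>j. lco q (y j)"] by (simp add: V_def)
  have \<eta>D: "((\<lambda>z. ?\<eta> i (lt p z)) has_derivative ld (?\<eta> i) p) (at z0)" if "i < CARD('n)" for i
    using hld_lco[of "Y i" p] XY that unfolding hld_def by simp
  have "hld (\<lambda>q. V (\<lambda>j. ?\<eta> j q)) p (\<lambda>w. \<Sum>i<CARD('n). V ((\<lambda>j. ?\<eta> j (lt p z0))(i := ld (?\<eta> i) p w)))"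
    using alternating_has_derivative[where g="\<lambda>j z. ?\<eta> j (lt p z)" and g'="\<lambda>i. ld (?\<eta> i) p", OF V \<eta>D]
    unfolding hld_def .
  from dfun_lf[OF this, of ?\<xi>]
  have 1: "dfun A (\<lambda>q. wedge_power (\<omega> q) ?r (\<lambda>j. Y j q)) p (X p) = (\<Sum>i<CARD('n). V ((\<lambda>j. ?\<eta> j p)(i := ld (?\<eta> i) p ?\<xi>)))"
    unfolding vol by simp
  have "wedge_power (\<omega> p) ?r ((\<lambda>j. Y j p)(i := D X (Y i) p))
      = V ((\<lambda>j. ?\<eta> j p)(i := ld (?\<eta> i) p ?\<xi>)) + V ((\<lambda>j. ?\<eta> j p)(i := Gam ?\<xi> (?\<eta> i p)))"
    if i: "i < CARD('n)" for i
  proof -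
    have "lco p (D X (Y i) p) = ld (?\<eta> i) p ?\<xi> + Gam ?\<xi> (?\<eta> i p)"
      using D_expand[of X "Y i" p] XY i by simp
    then have "(\<lambda>j. lco p (((\<lambda>j. Y j p)(i := D X (Y i) p)) j)) = (\<lambda>j. ?\<eta> j p)(i := ld (?\<eta> i) p ?\<xi> + Gam ?\<xi> (?\<eta> i p))"
      by auto
    then show ?thesis unfolding vol by (simp only: linear_add[OF alternating_linear[OF V i]])
  qed
  then have "(\<Sum>i<CARD('n). wedge_power (\<omega> p) ?r ((\<lambda>j. Y j p)(i := D X (Y i) p)))
     = (\<Sum>i<CARD('n). V ((\<lambda>j. ?\<eta> j p)(i := ld (?\<eta> i) p ?\<xi>)))"
    using Gam_traceless[OF uni V, of "\<lambda>j. ?\<eta> j p" ?\<xi>] by (simp add: sum.distrib)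
  with 1 show "dfun A (\<lambda>q. wedge_power (\<omega> q) ?r (\<lambda>j. Y j q)) p (X p) -
     (\<Sum>i<CARD('n). wedge_power (\<omega> p) ?r ((\<lambda>j. Y j p)(i := D X (Y i) p))) = 0" by simp
qed

end

theorem theorem1p1:
  fixes mul :: "'a::{t2_space, second_countable_topology} \<Rightarrow> 'a \<Rightarrow> 'a"
    and e :: 'a and iv :: "'a \<Rightarrow> 'a"
    and A :: "('a, real^'n) chart set"
    and \<omega> :: "('a, 'n) form_field"
    and D :: "('a, real^'n) connection"
  assumes "symplectic_lie_group mul e iv A \<omega>"
    and "connected (UNIV :: 'a set)"
    and "associated_connection mul e A \<omega> D"
  shows "(\<forall>g. \<exists>U x. affine_chart A D (U, x) \<and> g \<in> U \<and>
            (\<exists>C \<mu>. structure_constants mul e A C \<and>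
              (\<forall>i j. \<forall>p\<in>U. poisson_bracket A \<omega> (\<lambda>q. x q $ i) (\<lambda>q. x q $ j) p =
                 (\<Sum>k\<in>UNIV. C i j k * x p $ k) + \<mu> i j)))
       \<and> (\<forall>k T. is_multivector_field A k T \<and> right_invariant_mv mul A T \<longrightarrow>
            polynomial_mv_deg_le A D k T)
       \<and> (unimodular mul e iv A \<longrightarrow>
            polynomial_form_deg_le A D (CARD('n) - 1) \<omega>
          \<and> parallel_form_on A D UNIV CARD('n) (\<lambda>p. wedge_power (\<omega> p) (CARD('n) div 2))
          \<and> (\<forall>k T. differential_form A k T \<and> right_invariant_form mul A T \<longrightarrow>
               (\<exists>d. polynomial_form_deg_le A D d T)))"
proof -
  interpret symplectic_connection mul e iv A \<omega> D
    using assms(1,3) by (intro symplectic_connection.intro symplectic_connection_axioms.intro)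
  show ?thesis
    using poisson_affine_chart right_invariant_mv_polynomial omega_polynomial volume_parallel
      right_invariant_form_polynomial by (intro conjI allI impI) (simp, simp, simp, simp, metis)
qed

end
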